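(* Let $A(z)$ be an $n\times n$ Hermite matrix of Laurent polynomials such that $\det A(z)$ is not identically zero. Suppose there are nonnegative integers $\nu_+,\nu_-$ with $\nu_+(A(z))=\nu_+$ and $\nu_-(A(z))=\nu_-$ for all $z\in\mathbb{T}\setminus\sigma(A)$. Then there exists an $n\times n$ matrix $U(z)$ of Laurent polynomials such that $A(z)=U(z)\,D\,U^\star(z)$ with $D:=\operatorname{diag}(I_{\nu_+},-I_{\nu_-})$.
   Context: For a matrix $U(z)=\sum_k U_k z^k$ of Laurent polynomials, $U^\star(z):=\sum_k\overline{U_k}^T z^{-k}$ (so $U^\star(z)=U(z)^*$ on $\mathbb{T}$). A square matrix $A(z)$ of Laurent polynomials is a Hermite matrix of Laurent polynomials if $A^\star(z)=A(z)$. $\mathbb{T}$ is the unit circle. $\sigma(A):=\{z\in\mathbb{C}\setminus\{0\}:\det A(z)=0\}$. For a Hermitian matrix $H$, $\nu_+(H)$ and $\nu_-(H)$ are the numbers of its positive and negative eigenvalues. *)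

theory Defs
  imports "Jordan_Normal_Form.Char_Poly"
begin

text \<open>A square matrix of Laurent polynomials of size n x n is represented by its
  coefficient family: U k is the n x n complex coefficient matrix of z^k; only
  finitely many coefficients are nonzero.\<close>

definition laurent_mat :: "nat \<Rightarrow> (int \<Rightarrow> complex mat) \<Rightarrow> bool" where
  "laurent_mat n U \<longleftrightarrow> (\<forall>k. U k \<in> carrier_mat n n) \<and> finite {k. U k \<noteq> 0\<^sub>m n n}"

definition leval :: "nat \<Rightarrow> (int \<Rightarrow> complex mat) \<Rightarrow> complex \<Rightarrow> complex mat" where
  "leval n U z = mat n n (\<lambda>(i,j). \<Sum>k\<in>{k. U k \<noteq> 0\<^sub>m n n}. z powi k * U k $$ (i,j))"

definition cadjoint :: "complex mat \<Rightarrow> complex mat" where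
  "cadjoint M = transpose_mat (map_mat cnj M)"

text \<open>U^star(z) = sum_k conj(U_k)^T z^(-k), i.e. its k-th coefficient is conj(U_(-k))^T.\<close>
definition lstar :: "(int \<Rightarrow> complex mat) \<Rightarrow> (int \<Rightarrow> complex mat)" where
  "lstar U = (\<lambda>k. cadjoint (U (- k)))"

definition hermite_laurent_mat :: "nat \<Rightarrow> (int \<Rightarrow> complex mat) \<Rightarrow> bool" where
  "hermite_laurent_mat n A \<longleftrightarrow> laurent_mat n A \<and> lstar A = A"

definition nu_plus :: "complex mat \<Rightarrow> nat" where
  "nu_plus H = (\<Sum>r\<in>{r. Im r = 0 \<and> Re r > 0 \<and> poly (char_poly H) r = 0}. order r (char_poly H))"

definition nu_minus :: "complex mat \<Rightarrow> nat" where
  "nu_minus H = (\<Sum>r\<in>{r. Im r = 0 \<and> Re r < 0 \<and> poly (char_poly H) r = 0}. order r (char_poly H))"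

text \<open>D = diag(I_p, -I_q) as an n x n matrix (n = p + q in the theorem).\<close>
definition sig_diag :: "nat \<Rightarrow> nat \<Rightarrow> complex mat" where
  "sig_diag n p = mat n n (\<lambda>(i,j). if i = j then (if i < p then 1 else -1) else 0)"

end

theory Submission
  imports Defs "Jordan_Normal_Form.Gauss_Jordan_Elimination"
begin

text \<open>The zeros of \<open>det A\<close> are removed one conjugate pair at a time.  If \<open>A(a)\<close> kills a constant vector \<open>v\<close>
  and \<open>v\<^sup>* A v\<close> is divisible by \<open>(z - a)(1/z - cnj a)\<close>, a congruence splits off the factor
  \<open>(z - a)(1/z - cnj a)\<close> from the determinant.  Off the circle every kernel vector qualifies.  On the circle one
  needs a kernel vector isotropic for the derivative of the form along the circle; if there were none,
  that derivative would be definite on the kernel and the signature would jump at \<open>a\<close>.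

  What remains is a Hermitian \<open>B\<close> with constant determinant.  Counting dimensions gives a nonzero polynomial
  vector \<open>v\<close> such that \<open>B v\<close> is a polynomial in \<open>1/z\<close>; then \<open>v\<^sup>* B v\<close> is self-adjoint and a polynomial
  in \<open>1/z\<close>, hence constant.  Completing \<open>v\<close> (made primitive) to a basis makes \<open>B\<^sub>0\<^sub>0\<close> constant.
  If it is \<open>0\<close>, invertibility of \<open>B\<close> yields a vector of norm \<open>1\<close>, so \<open>B\<^sub>0\<^sub>0\<close> may be taken nonzero, and the
  Schur complement has constant determinant again.  The number of positive signs is \<open>\<nu>\<^sub>+\<close> by
  Sylvester's law of inertia.\<close>

section \<open>Laurent polynomial functions\<close>

text \<open>The factor \<open>1 / z - cnj a\<close> is the star of \<open>z - a\<close>. The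
  congruence divides one column by \<open>z - a\<close> and the matching row by its star, so the
  diagonal entry where they cross has to contain both factors. Off the circle these vanish at the
  two different points \<open>a\<close> and \<open>1 / cnj a\<close>, and self-adjointness supplies
  the second zero. On the circle they differ only by a unit, so a double zero at \<open>a\<close> is
  required; this is the obstacle for which the constant signature is used, and it is used once more
  to count signs at the end. The signature is carried along as two upper bounds \<open>p\<close> and
  \<open>q\<close> on the dimensions of positive and negative subspaces, valid on the circle off a
  finite set. Such bounds survive congruences that degenerate at finitely many points. Because
  \<open>p + q \<le> n\<close>, upper bounds suffice: they exclude a jump at a zero of the
  determinant, and for a diagonal matrix of signs they become equalities.\<close>

text \<open>Laurent polynomials are handled as functions on the punctured plane; the value at \<open>0\<close> is irrelevant.\<close>

definition lpoly :: "(complex \<Rightarrow> complex) \<Rightarrow> bool" where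
  "lpoly f \<longleftrightarrow> (\<exists>p k. \<forall>z. z \<noteq> 0 \<longrightarrow> f z = poly p z / z ^ k)"

lemma lpolyI: "(\<And>z. z \<noteq> 0 \<Longrightarrow> f z = poly p z / z ^ k) \<Longrightarrow> lpoly f"
  unfolding lpoly_def by blast

lemma lpoly_poly: "lpoly (\<lambda>z. poly p z)"
  by (rule lpolyI[of _ p 0]) simp

lemma lpoly_const: "lpoly (\<lambda>z. c)"
  using lpoly_poly[of "[:c:]"] by simp

lemma lpoly_id: "lpoly (\<lambda>z. z)"
  using lpoly_poly[of "[:0,1:]"] by simp

lemma lpoly_inverse_id: "lpoly (\<lambda>z. 1 / z)"
  by (rule lpolyI[of _ 1 1]) simp

lemma lpoly_add: assumes "lpoly f" "lpoly g" shows "lpoly (\<lambda>z. f z + g z)"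
proof -
  obtain p k q l where
    "\<And>z. z \<noteq> 0 \<Longrightarrow> f z = poly p z / z ^ k" "\<And>z. z \<noteq> 0 \<Longrightarrow> g z = poly q z / z ^ l"
    using assms unfolding lpoly_def by blast
  then show ?thesis
    by (intro lpolyI[of _ "p * monom 1 l + q * monom 1 k" "k + l"])
      (simp add: poly_monom power_add field_simps)
qed

lemma lpoly_mult: assumes "lpoly f" "lpoly g" shows "lpoly (\<lambda>z. f z * g z)"
proof -
  obtain p k q l where
    "\<And>z. z \<noteq> 0 \<Longrightarrow> f z = poly p z / z ^ k" "\<And>z. z \<noteq> 0 \<Longrightarrow> g z = poly q z / z ^ l"
    using assms unfolding lpoly_def by blast
  then show ?thesis
    by (intro lpolyI[of _ "p * q" "k + l"]) (simp add: power_add)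
qed

lemma lpoly_uminus: "lpoly f \<Longrightarrow> lpoly (\<lambda>z. - f z)"
  using lpoly_mult[OF lpoly_const[of "-1"], of f] by simp

lemma lpoly_diff: "lpoly f \<Longrightarrow> lpoly g \<Longrightarrow> lpoly (\<lambda>z. f z - g z)"
  using lpoly_add[OF _ lpoly_uminus, of f g] by simp

lemma lpoly_sum: "(\<And>i. i \<in> I \<Longrightarrow> lpoly (f i)) \<Longrightarrow> lpoly (\<lambda>z. \<Sum>i\<in>I. f i z)"
  by (induction I rule: infinite_finite_induct) (auto intro: lpoly_add lpoly_const)

lemma lpoly_prod: "(\<And>i. i \<in> I \<Longrightarrow> lpoly (f i)) \<Longrightarrow> lpoly (\<lambda>z. \<Prod>i\<in>I. f i z)"
  by (induction I rule: infinite_finite_induct) (auto intro: lpoly_mult lpoly_const)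

lemma lpoly_power: "lpoly f \<Longrightarrow> lpoly (\<lambda>z. f z ^ k)"
  by (induction k) (auto intro: lpoly_mult lpoly_const)

lemma lpoly_powi: "lpoly (\<lambda>z. z powi k)"
proof (cases "k \<ge> 0")
  case True
  then show ?thesis using lpoly_power[OF lpoly_id, of "nat k"] by (simp add: power_int_def)
next
  case False
  then show ?thesis using lpoly_power[OF lpoly_inverse_id, of "nat (-k)"]
    by (simp add: power_int_def divide_inverse)
qed

text \<open>The star conjugates coefficients and negates exponents, so the reflected conjugate
  polynomial is the new numerator and the old denominator moves into it.\<close>

lemma lpoly_star: assumes "lpoly f" shows "lpoly (\<lambda>z. cnj (f (1 / cnj z)))"
proof -
  obtain p k where f: "\<And>z. z \<noteq> 0 \<Longrightarrow> f z = poly p z / z ^ k"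
    using assms unfolding lpoly_def by blast
  let ?r = "map_poly cnj p"
  show ?thesis
  proof (rule lpolyI[of _ "reflect_poly ?r * monom 1 k" "degree ?r"])
    fix z :: complex assume z: "z \<noteq> 0"
    have "cnj (f (1 / cnj z)) = cnj (poly p (1 / cnj z)) * z ^ k"
      using z by (simp add: f power_one_over)
    also have "cnj (poly p (1 / cnj z)) = poly ?r (inverse z)"
      unfolding poly_cnj by (simp add: divide_inverse)
    finally have "cnj (f (1 / cnj z)) = poly ?r (inverse z) * z ^ k" .
    then show "cnj (f (1 / cnj z)) = poly (reflect_poly ?r * monom 1 k) z / z ^ degree ?r"
      using z by (simp add: poly_reflect_poly_nz poly_monom)
  qed
qed

lemmas lpoly_intros = lpoly_const lpoly_id lpoly_inverse_id lpoly_poly lpoly_powi lpoly_add lpoly_mult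
  lpoly_uminus lpoly_diff lpoly_sum lpoly_prod lpoly_power lpoly_star

section \<open>Laurent polynomials as an integral domain: zeros, normal forms and units\<close>

lemma poly_eq_0_off_0: assumes "\<And>z::complex. z \<noteq> 0 \<Longrightarrow> poly p z = 0" shows "p = 0"
proof (rule ccontr)
  assume "p \<noteq> 0"
  then have "finite {z. poly p z = 0}" by (rule poly_roots_finite)
  then have "finite (insert 0 {z. poly p z = 0})" by simp
  moreover have "insert 0 {z. poly p z = 0} = UNIV" using assms by auto
  ultimately show False using infinite_UNIV_char_0[where 'a = complex] by simp
qed

lemma poly_eq_off_0:
  assumes "\<And>z::complex. z \<noteq> 0 \<Longrightarrow> poly p z = poly q z" shows "p = q"
  using poly_eq_0_off_0[of "p - q"] assms by simp

text \<open>Cancellation in the domain of Laurent polynomials. That \<open>g\<close> is not the zero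
  element is witnessed by a single point \<open>w\<close>.\<close>

lemma lpoly_zero_divisor:
  assumes "lpoly f" "lpoly g" "\<And>z. z \<noteq> 0 \<Longrightarrow> f z * g z = 0" "w \<noteq> 0" "g w \<noteq> 0" "z \<noteq> 0"
  shows "f z = 0"
proof -
  obtain p k q l where
    *: "\<And>z. z \<noteq> 0 \<Longrightarrow> f z = poly p z / z ^ k" "\<And>z. z \<noteq> 0 \<Longrightarrow> g z = poly q z / z ^ l"
    using assms unfolding lpoly_def by blast
  have "poly (p * q) z = 0" if "z \<noteq> 0" for z
    using assms(3)[OF that] *[OF that] that by simp
  then have "p * q = 0" by (rule poly_eq_0_off_0)
  moreover have "q \<noteq> 0" using * assms by auto
  ultimately show ?thesis using * assms by simp
qed

lemma lpoly_root:
  assumes "lpoly f" "a \<noteq> 0" "f a = 0"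
  obtains g where "lpoly g" "\<And>z. z \<noteq> 0 \<Longrightarrow> f z = (z - a) * g z"
proof -
  obtain p k where f: "\<And>z. z \<noteq> 0 \<Longrightarrow> f z = poly p z / z ^ k"
    using assms unfolding lpoly_def by blast
  then have "poly p a = 0" using assms by auto
  then obtain q where p: "p = [:-a, 1:] * q" using poly_eq_0_iff_dvd by blast
  from this have "f z = (z - a) * (poly q z / z ^ k)" if "z \<noteq> 0" for z
    using f[OF that] by (simp only: p poly_mult) simp
  moreover have "lpoly (\<lambda>z. poly q z / z ^ k)" by (rule lpolyI) auto
  ultimately show ?thesis using that by blast
qed

text \<open>The zero of the numerator at 0 is moved into the exponent. Then \<open>degree p\<close>
  counts exactly the nonzero zeros with multiplicity, and the pair is unique; this degree is later
  the induction measure for removing zeros of a determinant.\<close>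

lemma lpoly_normal_form:
  assumes "lpoly f" "w \<noteq> 0" "f w \<noteq> 0"
  obtains p k where "poly p 0 \<noteq> 0" "\<And>z. z \<noteq> 0 \<Longrightarrow> f z = poly p z * z powi k"
proof -
  obtain p k where f: "\<And>z. z \<noteq> 0 \<Longrightarrow> f z = poly p z / z ^ k"
    using assms unfolding lpoly_def by blast
  have "p \<noteq> 0" using f assms by auto
  from order_decomp[OF this, of 0] obtain q where
    q: "p = [:-0, 1:] ^ order 0 p * q" "\<not> [:-0, 1:] dvd q" by blast
  show ?thesis
  proof (rule that[of q "int (order 0 p) - int k"])
    show "poly q 0 \<noteq> 0" using q(2) poly_eq_0_iff_dvd by blast
    fix z :: complex assume z: "z \<noteq> 0"
    have "poly p z = z ^ order 0 p * poly q z"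
      using arg_cong[OF q(1), of "\<lambda>p. poly p z"] by simp
    then show "f z = poly q z * z powi (int (order 0 p) - int k)"
      using z f[OF z] by (simp add: power_int_diff)
  qed
qed

lemma lpoly_normal_form_unique_aux:
  fixes p q :: "complex poly"
  assumes "poly p 0 \<noteq> 0"
    and eq: "\<And>z. z \<noteq> 0 \<Longrightarrow> poly p z * z powi k = poly q z * z powi l" and "k \<le> l"
  shows "k = l \<and> p = q"
proof -
  have *: "p = q * monom 1 (nat (l - k))"
  proof (intro poly_eq_off_0)
    fix z :: complex assume z: "z \<noteq> 0"
    have "poly p z = poly q z * (z powi l / z powi k)"
      using eq[OF z] z by (simp add: field_simps)
    also have "z powi l / z powi k = z ^ nat (l - k)"
      using z assms(3) power_int_diff[of z l k] by (simp add: power_int_def)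
    finally show "poly p z = poly (q * monom 1 (nat (l - k))) z" by (simp add: poly_monom)
  qed
  have "nat (l - k) = 0"
    using assms(1) * by (auto simp: poly_monom)
  then show ?thesis using * \<open>k \<le> l\<close> by simp
qed

lemma lpoly_normal_form_unique:
  fixes p q :: "complex poly"
  assumes "poly p 0 \<noteq> 0" "poly q 0 \<noteq> 0"
    and "\<And>z. z \<noteq> 0 \<Longrightarrow> poly p z * z powi k = poly q z * z powi l"
  shows "k = l" "p = q"
  using lpoly_normal_form_unique_aux[OF assms(1), of k q l]
    lpoly_normal_form_unique_aux[OF assms(2), of l p k] assms(3) by (metis linear)+

lemma lpoly_finite_zeros:
  assumes "lpoly f" "w \<noteq> 0" "f w \<noteq> 0"
  shows "finite {z. z \<noteq> 0 \<and> f z = 0}"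
proof -
  obtain p k where f: "poly p 0 \<noteq> 0" "\<And>z. z \<noteq> 0 \<Longrightarrow> f z = poly p z * z powi k"
    using lpoly_normal_form[OF assms] by blast
  have "{z. z \<noteq> 0 \<and> f z = 0} \<subseteq> {z. poly p z = 0}" using f(2) by auto
  moreover have "p \<noteq> 0" using f by auto
  ultimately show ?thesis using finite_subset poly_roots_finite by blast
qed

text \<open>The units of the Laurent ring are the monomials: in normal form the numerator has no
  root at all, so it is constant by the fundamental theorem of algebra.\<close>

lemma lpoly_nonvanishing:
  assumes "lpoly f" "\<And>z. z \<noteq> 0 \<Longrightarrow> f z \<noteq> 0"
  obtains c k where "c \<noteq> 0" "\<And>z. z \<noteq> 0 \<Longrightarrow> f z = c * z powi k"
proof -
  obtain p k where f: "poly p 0 \<noteq> 0" "\<And>z. z \<noteq> 0 \<Longrightarrow> f z = poly p z * z powi k"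
    using lpoly_normal_form[OF assms(1), of 1] assms(2) by auto
  have "poly p z \<noteq> 0" for z using f assms(2) by (cases "z = 0") force+
  then have "constant (poly p)" using fundamental_theorem_of_algebra by blast
  then have "poly p z = poly p 0" for z unfolding constant_def by blast
  then show ?thesis using that[of "poly p 0" k] f by auto
qed

text \<open>The star sends \<open>c * z powi k\<close> to \<open>cnj c * z powi (-k)\<close>;
  uniqueness of the normal form leaves only \<open>k = 0\<close> and real \<open>c\<close>.\<close>

lemma lpoly_selfadjoint_nonvanishing:
  assumes "lpoly f" "\<And>z. z \<noteq> 0 \<Longrightarrow> f z \<noteq> 0" "\<And>z. z \<noteq> 0 \<Longrightarrow> cnj (f (1 / cnj z)) = f z"
  obtains c :: real where "c \<noteq> 0" "\<And>z. z \<noteq> 0 \<Longrightarrow> f z = of_real c"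
proof -
  obtain c k where f: "c \<noteq> 0" "\<And>z. z \<noteq> 0 \<Longrightarrow> f z = c * z powi k"
    using lpoly_nonvanishing[OF assms(1,2)] by blast
  have "poly [:cnj c:] z * z powi (-k) = poly [:c:] z * z powi k" if "z \<noteq> 0" for z
    using assms(3)[OF that] f(2) that by (simp add: power_int_minus power_int_divide_distrib field_simps)
  from lpoly_normal_form_unique[OF _ _ this] f(1) have "-k = k" "cnj c = c" by auto
  then have "k = 0" "c = of_real (Re c)" by (auto simp: complex_eq_iff)
  then show ?thesis using that[of "Re c"] f by force
qed

text \<open>The way back to coefficient families. Since \<open>c\<close> vanishes outside its
  window, the entries of a matrix can later share one larger window.\<close>

lemma lpoly_coeffs:
  assumes "lpoly f"
  obtains c and N :: nat where "\<And>z. z \<noteq> 0 \<Longrightarrow> f z = (\<Sum>k\<in>{-int N..int N}. c k * z powi k)"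
    "\<And>k. \<bar>k\<bar> > int N \<Longrightarrow> c k = 0"
proof -
  obtain p k where f: "\<And>z. z \<noteq> 0 \<Longrightarrow> f z = poly p z / z ^ k"
    using assms unfolding lpoly_def by blast
  define c where "c m = (if - int k \<le> m \<and> m \<le> int (degree p) - int k then coeff p (nat (m + int k)) else 0)" for m
  define N where "N = degree p + k"
  show ?thesis
  proof (rule that[of c N])
    fix z :: complex assume z: "z \<noteq> 0"
    have "f z = (\<Sum>i\<le>degree p. coeff p i * z ^ i / z ^ k)"
      using f[OF z] by (simp add: poly_altdef sum_divide_distrib)
    also have "\<dots> = (\<Sum>i\<le>degree p. c (int i - int k) * z powi (int i - int k))"
      using z by (intro sum.cong) (auto simp: c_def power_int_diff)
    also have "\<dots> = (\<Sum>m\<in>(\<lambda>i. int i - int k) ` {..degree p}. c m * z powi m)"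
      by (subst sum.reindex) (auto simp: inj_on_def)
    also have "\<dots> = (\<Sum>m\<in>{-int N..int N}. c m * z powi m)"
    proof (rule sum.mono_neutral_left)
      show "\<forall>m\<in>{-int N..int N} - (\<lambda>i. int i - int k) ` {..degree p}. c m * z powi m = 0"
      proof
        fix m assume m: "m \<in> {-int N..int N} - (\<lambda>i. int i - int k) ` {..degree p}"
        have "\<not> (- int k \<le> m \<and> m \<le> int (degree p) - int k)"
        proof
          assume "- int k \<le> m \<and> m \<le> int (degree p) - int k"
          then have "m = int (nat (m + int k)) - int k" "nat (m + int k) \<in> {..degree p}" by auto
          then show False using m by blast
        qed
        then show "c m * z powi m = 0" by (auto simp: c_def)
      qed
    qed (auto simp: N_def)
    finally show "f z = (\<Sum>m\<in>{-int N..int N}. c m * z powi m)" .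
  next
    fix m assume "\<bar>m\<bar> > int N"
    then show "c m = 0" unfolding c_def N_def by auto
  qed
qed

section \<open>Hermitian matrices and inertia\<close>

lemma cadjoint_carrier [simp]: "A \<in> carrier_mat n m \<Longrightarrow> cadjoint A \<in> carrier_mat m n"
  by (auto simp: cadjoint_def)

lemma cadjoint_dim [simp]: "dim_row (cadjoint A) = dim_col A" "dim_col (cadjoint A) = dim_row A"
  by (auto simp: cadjoint_def)

lemma cadjoint_index [simp]:
  "i < dim_col A \<Longrightarrow> j < dim_row A \<Longrightarrow> cadjoint A $$ (i, j) = cnj (A $$ (j, i))"
  by (auto simp: cadjoint_def)

lemma cadjoint_cadjoint [simp]: "cadjoint (cadjoint A) = A"
  by (rule eq_matI) auto

lemma cadjoint_one [simp]: "cadjoint (1\<^sub>m n) = 1\<^sub>m n"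
  by (rule eq_matI) auto

lemma index_mult_mat_sum:
  "i < dim_row A \<Longrightarrow> j < dim_col B \<Longrightarrow> dim_col A = dim_row B \<Longrightarrow>
    (A * B) $$ (i, j) = (\<Sum>k<dim_row B. A $$ (i, k) * B $$ (k, j))"
  by (simp add: scalar_prod_def atLeast0LessThan)

lemma cadjoint_mult: "dim_col A = dim_row B \<Longrightarrow> cadjoint (A * B) = cadjoint B * cadjoint A"
  by (rule eq_matI) (auto simp: index_mult_mat_sum mult.commute simp del: index_mult_mat(1))

lemma mat_diag_dims [simp]: "dim_row (mat_diag n f) = n" "dim_col (mat_diag n f) = n"
  by (auto simp: mat_diag_def)

lemma mat_mult_assoc:
  "dim_col A = dim_row B \<Longrightarrow> dim_col B = dim_row C \<Longrightarrow> (A * B) * C = A * (B * C)"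
  using assoc_mult_mat[of A "dim_row A" "dim_row B" B "dim_row C" C "dim_col C"] by blast

lemma det_cadjoint: assumes "A \<in> carrier_mat n n" shows "det (cadjoint A) = cnj (det A)"
proof -
  interpret comm_ring_hom cnj by standard auto
  show ?thesis unfolding cadjoint_def using assms
    by (simp add: det_transpose[of _ n] hom_det)
qed

definition hform :: "nat set \<Rightarrow> complex mat \<Rightarrow> (nat \<Rightarrow> complex) \<Rightarrow> complex" where
  "hform S G x = (\<Sum>i\<in>S. \<Sum>j\<in>S. cnj (x i) * G $$ (i, j) * x j)"

text \<open>Index sets instead of subspaces turn dimensions into cardinalities. Applied to
  \<open>cadjoint Q * H * Q\<close>, it says that the columns of \<open>Q\<close> with index in
  \<open>S\<close> span a subspace of dimension \<open>card S\<close> on which \<open>H\<close> is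
  positive.\<close>

definition posdef_on :: "nat set \<Rightarrow> complex mat \<Rightarrow> bool" where
  "posdef_on S G \<longleftrightarrow> (\<forall>x. (\<exists>i\<in>S. x i \<noteq> 0) \<longrightarrow> Re (hform S G x) > 0)"

text \<open>The matrix is the Householder reflection exchanging the first unit vector and a multiple \<open>w\<close> of \<open>v\<close>;
  the phase of \<open>w\<close> is chosen with \<open>w 0 \<le> 0\<close> so that the two are distinct.\<close>

lemma unitary_completion:
  assumes v: "v \<in> carrier_vec n" "v \<noteq> 0\<^sub>v n"
  obtains W c where "W \<in> carrier_mat n n" "cadjoint W * W = 1\<^sub>m n"
    "\<And>i. i < n \<Longrightarrow> W $$ (i, 0) = c * v $ i"
proof -
  have "n > 0" using v by (cases n) auto
  define r where "r = (\<Sum>i<n. (cmod (v $ i))\<^sup>2)"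
  obtain i0 where "i0 < n" "v $ i0 \<noteq> 0" using v by (metis carrier_vecD eq_vecI index_zero_vec)
  then have r: "r > 0" unfolding r_def by (intro sum_pos2[of _ i0]) auto
  define c where "c = (if v $ 0 = 0 then 1 else - cnj (v $ 0) / cmod (v $ 0)) / of_real (sqrt r)"
  define w where "w i = c * v $ i" for i
  have "cmod c = 1 / sqrt r" using r by (auto simp: c_def norm_divide)
  then have "(cmod (w i))\<^sup>2 = (cmod (v $ i))\<^sup>2 / r" for i
    using r by (simp add: w_def norm_mult power_mult_distrib power_divide)
  then have w1: "(\<Sum>i<n. (cmod (w i))\<^sup>2) = 1"
    using r by (simp add: sum_divide_distrib[symmetric] r_def)
  define t where "t = - cmod (v $ 0) / sqrt r"
  have w0: "w 0 = of_real t"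
  proof (cases "v $ 0 = 0")
    case False
    have "cnj (v $ 0) * v $ 0 = of_real ((cmod (v $ 0))\<^sup>2)"
      by (metis complex_norm_square mult.commute)
    then show ?thesis using False r
      by (simp add: w_def c_def t_def power2_eq_square)
  qed (simp add: w_def t_def)
  have t: "t \<le> 0" using r by (simp add: t_def)
  define u where "u i = w i - (if i = 0 then 1 else 0)" for i
  \<comment> \<open>As \<open>w\<close> has norm 1 and \<open>w 0 = t\<close>, this is the squared
    length of \<open>u\<close>, and \<open>u 0 = - s / 2\<close>. Hence the reflection along
    \<open>u\<close> adds exactly \<open>u\<close> to the first unit vector, which gives
    \<open>w\<close>.\<close>
  define s where "s = 2 * (1 - t)"
  have s: "s > 0" using t by (simp add: s_def)
  have us: "(\<Sum>i<n. cnj (u i) * u i) = of_real s"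
  proof -
    have "cnj (u i) * u i = of_real ((cmod (w i))\<^sup>2) + (if i = 0 then of_real (1 - 2 * t) else 0)" for i
      using w0 complex_norm_square[of "w i"] by (auto simp: u_def algebra_simps)
    then have "(\<Sum>i<n. cnj (u i) * u i) = of_real (\<Sum>i<n. (cmod (w i))\<^sup>2) + of_real (1 - 2 * t)"
      using \<open>n > 0\<close> by (simp add: sum.distrib)
    then show ?thesis by (simp add: w1 s_def)
  qed
  define W where "W = mat n n (\<lambda>(i, j). (if i = j then 1 else 0) - of_real (2 / s) * u i * cnj (u j))"
  have Wc: "W \<in> carrier_mat n n" by (simp add: W_def)
  show ?thesis
  proof (rule that[of W c, OF Wc])
    show "cadjoint W * W = 1\<^sub>m n"
    proof (rule eq_matI)
      fix i j assume "i < dim_row (1\<^sub>m n)" "j < dim_col (1\<^sub>m n)"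
      then have ij: "i < n" "j < n" by auto
      let ?t = "complex_of_real (2 / s)"
      let ?d = "\<lambda>i j. if i = j then 1 else 0 :: complex"
      have "(cadjoint W * W) $$ (i, j) = (\<Sum>k<n. cnj (W $$ (k, i)) * W $$ (k, j))"
        using ij Wc by (subst index_mult_mat_sum) auto
      also have "\<dots> = (\<Sum>k<n. (?d k i * ?d k j - ?d k i * (?t * u i * cnj (u j)))
           - ?d k j * (?t * u i * cnj (u j)) + ?t * ?t * u i * cnj (u j) * (cnj (u k) * u k))"
        using ij by (intro sum.cong) (auto simp: W_def algebra_simps)
      also have "\<dots> = ?d i j - 2 * (?t * u i * cnj (u j)) + ?t * ?t * u i * cnj (u j) * of_real s"
      proof -
        have 1: "(\<Sum>k<n. ?d k i * ?d k j) = ?d i j"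
          using ij by (simp add: if_distrib[of "\<lambda>x. x * _"] cong: if_cong)
        have 2: "(\<Sum>k<n. ?d k m * X) = X" if "m < n" for m X
          using that by (simp add: if_distrib[of "\<lambda>x. x * _"] cong: if_cong)
        show ?thesis
          unfolding sum.distrib sum_subtractf sum_distrib_left[symmetric] us 1 2[OF ij(1)] 2[OF ij(2)]
          by simp
      qed
      also have "?t * ?t * u i * cnj (u j) * of_real s = 2 * (?t * u i * cnj (u j))"
        using s by simp
      finally show "(cadjoint W * W) $$ (i, j) = 1\<^sub>m n $$ (i, j)" using ij by simp
    qed (use Wc in auto)
    fix i assume i: "i < n"
    have "u 0 = of_real (- s / 2)" by (simp add: u_def w0 s_def)
    then have "W $$ (i, 0) = (if i = 0 then 1 else 0) + u i"
      using i \<open>n > 0\<close> s by (simp add: W_def)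
    then show "W $$ (i, 0) = c * v $ i" by (simp add: u_def w_def)
  qed
qed

section \<open>Eigenvalue multiplicities and the spectral theorem\<close>

lemma order_prod_linear:
  fixes a :: "'b \<Rightarrow> 'a :: idom"
  assumes "finite I"
  shows "order r (\<Prod>i\<in>I. [:- a i, 1:]) = card {i\<in>I. a i = r}"
  using assms
proof (induction I)
  case (insert i I)
  have "(\<Prod>i\<in>I. [:- a i, 1:]) \<noteq> 0" using insert by (subst prod_zero_iff) auto
  then have *: "[:- a i, 1:] * (\<Prod>i\<in>I. [:- a i, 1:]) \<noteq> 0"
    by (subst mult_eq_0_iff) auto
  have "order r [:- a i, 1:] = (if a i = r then 1 else 0)"
    using order_power_n_n[of r 1] by (auto intro: order_0I)
  moreover have "{j \<in> insert i I. a j = r} = (if a i = r then insert i {j \<in> I. a j = r} else {j \<in> I. a j = r})"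
    by auto
  ultimately show ?case using insert by (simp add: order_mult[OF *] del: mult_pCons_left)
qed auto

lemma spectral_char_poly:
  assumes Q: "Q \<in> carrier_mat n n" "cadjoint Q * Q = 1\<^sub>m n"
    and H: "H = Q * mat_diag n d * cadjoint Q"
  shows "char_poly H = (\<Prod>i<n. [:- d i, 1:])"
proof -
  have D: "mat_diag n d \<in> carrier_mat n n" by simp
  have "Q * cadjoint Q = 1\<^sub>m n"
    using Q mat_mult_left_right_inverse[of "cadjoint Q" n Q] by auto
  then have "similar_mat H (mat_diag n d)"
    using Q D H by (intro similar_matI[of _ _ Q "cadjoint Q" n]) auto
  then have "char_poly H = char_poly (mat_diag n d)" by (rule char_poly_similar)
  also have "\<dots> = (\<Prod>a\<leftarrow>diag_mat (mat_diag n d). [:- a, 1:])"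
    by (rule char_poly_upper_triangular[OF D]) (auto simp: mat_diag_def)
  also have "\<dots> = (\<Prod>i<n. [:- d i, 1:])"
    using prod.distinct_set_conv_list[of "[0..<n]" "\<lambda>i. [:- d i, 1:]"]
    by (auto simp: diag_mat_def mat_diag_def atLeast0LessThan comp_def intro!: arg_cong[where f = prod_list])
  finally show ?thesis .
qed

text \<open>Grouping the indices by the value of \<open>d\<close> turns root multiplicities into a
  count of diagonal entries. \<open>P\<close> is left open so that one computation serves both
  signs.\<close>

lemma sum_order_spectral:
  fixes d :: "nat \<Rightarrow> real"
  assumes "Q \<in> carrier_mat n n" "cadjoint Q * Q = 1\<^sub>m n" "H = Q * mat_diag n (\<lambda>i. of_real (d i)) * cadjoint Q"
  shows "(\<Sum>r\<in>{r. Im r = 0 \<and> P (Re r) \<and> poly (char_poly H) r = 0}. order r (char_poly H)) = card {i. i < n \<and> P (d i)}"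
proof -
  let ?f = "\<lambda>i. complex_of_real (d i)"
  let ?R = "{r. Im r = 0 \<and> P (Re r) \<and> poly (char_poly H) r = 0}"
  have cp: "char_poly H = (\<Prod>i<n. [:- ?f i, 1:])" by (rule spectral_char_poly[OF assms])
  have R: "?R = ?f ` {i. i < n \<and> P (d i)}"
  proof -
    have "poly (char_poly H) r = 0 \<longleftrightarrow> (\<exists>i<n. r = ?f i)" for r
      unfolding cp by (auto simp: poly_prod)
    then show ?thesis by (auto simp: complex_eq_iff)
  qed
  have "(\<Sum>r\<in>?R. order r (char_poly H)) = (\<Sum>r\<in>?R. card {i\<in>{..<n}. ?f i = r})"
    unfolding cp by (intro sum.cong refl order_prod_linear) simp
  also have "\<dots> = (\<Sum>r\<in>?R. \<Sum>i\<in>{i \<in> {i. i < n \<and> P (d i)}. ?f i = r}. 1)"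
    by (intro sum.cong refl) (auto intro!: arg_cong[where f = card])
  also have "\<dots> = (\<Sum>i\<in>{i. i < n \<and> P (d i)}. 1)"
    by (rule sum.group) (auto simp: R)
  finally show ?thesis by simp
qed

text \<open>Deflation: an eigenvector is completed to a unitary \<open>W\<close>. The first column
  of \<open>cadjoint W * H * W\<close> is then a multiple of the first unit vector, by symmetry so
  is the first row, and the remaining block is diagonalized by induction.\<close>

lemma hermitian_spectral:
  assumes "H \<in> carrier_mat n n" "cadjoint H = H"
  shows "\<exists>Q (d :: nat \<Rightarrow> real). Q \<in> carrier_mat n n \<and> cadjoint Q * Q = 1\<^sub>m n
    \<and> H = Q * mat_diag n (\<lambda>i. of_real (d i)) * cadjoint Q"
  using assms
proof (induction n arbitrary: H)
  case 0
  then show ?case by (intro exI[of _ "1\<^sub>m 0"]) (auto intro!: eq_matI)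
next
  case (Suc n)
  note H = Suc.prems
  obtain as where as: "char_poly H = (\<Prod>a\<leftarrow>as. [:- a, 1:])" "length as = Suc n"
    using char_poly_factorized[OF H(1)] by blast
  then obtain l as' where "as = l # as'" by (cases as) auto
  then have "poly (char_poly H) l = 0" using as by simp
  then obtain v where "eigenvector H v l" using eigenvalue_root_char_poly[OF H(1)] unfolding eigenvalue_def by blast
  then have v: "v \<in> carrier_vec (Suc n)" "v \<noteq> 0\<^sub>v (Suc n)" "H *\<^sub>v v = l \<cdot>\<^sub>v v"
    using H unfolding eigenvector_def by auto
  obtain W c where W: "W \<in> carrier_mat (Suc n) (Suc n)" "cadjoint W * W = 1\<^sub>m (Suc n)"
    and W0: "\<And>i. i < Suc n \<Longrightarrow> W $$ (i, 0) = c * v $ i"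
    using unitary_completion[OF v(1,2)] by metis
  have WW: "W * cadjoint W = 1\<^sub>m (Suc n)"
    using W mat_mult_left_right_inverse[of "cadjoint W" "Suc n" W] by auto
  define H' where "H' = cadjoint W * (H * W)"
  have H': "H' \<in> carrier_mat (Suc n) (Suc n)" using W H unfolding H'_def by auto
  have HW0: "(H * W) $$ (i, 0) = l * W $$ (i, 0)" if i: "i < Suc n" for i
  proof -
    have "(H * W) $$ (i, 0) = (\<Sum>k<Suc n. H $$ (i, k) * W $$ (k, 0))"
      using i H W by (subst index_mult_mat_sum) auto
    also have "\<dots> = c * (\<Sum>k<Suc n. H $$ (i, k) * v $ k)"
      unfolding sum_distrib_left by (intro sum.cong) (auto simp: W0)
    also have "(\<Sum>k<Suc n. H $$ (i, k) * v $ k) = (H *\<^sub>v v) $ i"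
      using i H v(1) by (simp add: scalar_prod_def atLeast0LessThan del: sum.lessThan_Suc)
    finally show ?thesis using i v W0 by simp
  qed
  have H'0: "H' $$ (i, 0) = (if i = 0 then l else 0)" if i: "i < Suc n" for i
  proof -
    have "H' $$ (i, 0) = (\<Sum>k<Suc n. cadjoint W $$ (i, k) * (H * W) $$ (k, 0))"
      unfolding H'_def using i H W by (subst index_mult_mat_sum) (auto simp del: index_mult_mat(1))
    also have "\<dots> = l * (\<Sum>k<Suc n. cadjoint W $$ (i, k) * W $$ (k, 0))"
      unfolding sum_distrib_left using HW0 by (intro sum.cong) auto
    also have "(\<Sum>k<Suc n. cadjoint W $$ (i, k) * W $$ (k, 0)) = (cadjoint W * W) $$ (i, 0)"
      using i W by (subst index_mult_mat_sum) auto
    finally show ?thesis using i W by simp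
  qed
  have H'h: "cadjoint H' = H'"
    unfolding H'_def using H W by (simp add: cadjoint_mult mat_mult_assoc)
  have H'sym: "H' $$ (i, j) = cnj (H' $$ (j, i))" if "i < Suc n" "j < Suc n" for i j
    using arg_cong[OF H'h, of "\<lambda>M. M $$ (i, j)"] that H' by auto
  \<comment> \<open>The eigenvalue is a diagonal entry of a Hermitian matrix, hence real.\<close>
  have l: "of_real (Re l) = l" using H'sym[of 0 0] H'0[of 0] by (auto simp: complex_eq_iff)
  define H1 where "H1 = mat n n (\<lambda>(i, j). H' $$ (Suc i, Suc j))"
  have H1: "H1 \<in> carrier_mat n n" "cadjoint H1 = H1"
  proof -
    show "cadjoint H1 = H1"
    proof (rule eq_matI)
      fix i j assume "i < dim_row H1" "j < dim_col H1"
      then show "cadjoint H1 $$ (i, j) = H1 $$ (i, j)"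
        using H'sym[of "Suc i" "Suc j"] by (simp add: H1_def)
    qed (auto simp: H1_def)
  qed (simp add: H1_def)
  obtain Q1 d1 where Q1: "Q1 \<in> carrier_mat n n" "cadjoint Q1 * Q1 = 1\<^sub>m n"
      "H1 = Q1 * mat_diag n (\<lambda>i. of_real (d1 i)) * cadjoint Q1"
    using Suc.IH[OF H1] by blast
  define d where "d i = (case i of 0 \<Rightarrow> Re l | Suc i \<Rightarrow> d1 i)" for i
  define Q2 where "Q2 = four_block_mat (1\<^sub>m 1) (0\<^sub>m 1 n) (0\<^sub>m n 1) Q1"
  have Q2: "Q2 \<in> carrier_mat (Suc n) (Suc n)" using Q1 by (auto simp: Q2_def)
  have aQ2: "cadjoint Q2 = four_block_mat (1\<^sub>m 1) (0\<^sub>m 1 n) (0\<^sub>m n 1) (cadjoint Q1)"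
    using Q1 by (intro eq_matI) (auto simp: Q2_def)
  have D: "mat_diag (Suc n) (\<lambda>i. of_real (d i)) =
      four_block_mat (mat 1 1 (\<lambda>_. l)) (0\<^sub>m 1 n) (0\<^sub>m n 1) (mat_diag n (\<lambda>i. of_real (d1 i)))"
    using l by (intro eq_matI) (auto simp: d_def mat_diag_def split: nat.splits)
  have Q2u: "cadjoint Q2 * Q2 = 1\<^sub>m (Suc n)"
    unfolding aQ2 unfolding Q2_def using Q1
    by (subst mult_four_block_mat[of _ 1 1 _ n _ n _ _ 1 _ n]) (auto intro!: eq_matI)
  have H'4: "H' = four_block_mat (mat 1 1 (\<lambda>_. l)) (0\<^sub>m 1 n) (0\<^sub>m n 1) H1"
  proof (rule eq_matI)
    fix i j assume "i < dim_row (four_block_mat (mat 1 1 (\<lambda>_. l)) (0\<^sub>m 1 n) (0\<^sub>m n 1) H1)"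
      "j < dim_col (four_block_mat (mat 1 1 (\<lambda>_. l)) (0\<^sub>m 1 n) (0\<^sub>m n 1) H1)"
    then have ij: "i < Suc n" "j < Suc n" using H1 by auto
    have "H' $$ (0, j) = (if j = 0 then l else 0)"
      using H'sym[of 0 j] H'0[OF ij(2)] l ij by (auto simp: complex_eq_iff)
    then show "H' $$ (i, j) = four_block_mat (mat 1 1 (\<lambda>_. l)) (0\<^sub>m 1 n) (0\<^sub>m n 1) H1 $$ (i, j)"
      using H'0[OF ij(1)] ij by (cases i; cases j) (auto simp: H1_def)
  qed (use H' H1 in auto)
  have "Q1 * mat_diag n (\<lambda>i. of_real (d1 i)) * cadjoint Q1 \<in> carrier_mat n n"
    by (intro mult_carrier_mat[of _ n n] Q1(1) mat_diag_dim cadjoint_carrier)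
  note zero_add = left_add_zero_mat[OF this]
  have H'Q: "H' = Q2 * mat_diag (Suc n) (\<lambda>i. of_real (d i)) * cadjoint Q2"
    unfolding aQ2 D H'4 Q1(3) unfolding Q2_def using Q1
    by (simp add: mult_four_block_mat[of _ 1 1 _ n _ n _ _ 1 _ n] left_mult_zero_mat[of _ n n] zero_add)
  have WH': "H = W * H' * cadjoint W"
  proof -
    have "W * H' * cadjoint W = (W * cadjoint W) * H * (W * cadjoint W)"
      unfolding H'_def using H(1) W(1) by (simp add: mat_mult_assoc)
    then show ?thesis using H(1) unfolding WW by simp
  qed
  show ?case
  proof (intro exI[of _ "W * Q2"] exI[of _ d] conjI)
    show "W * Q2 \<in> carrier_mat (Suc n) (Suc n)" using W Q2 by auto
    have "cadjoint (W * Q2) * (W * Q2) = cadjoint Q2 * (cadjoint W * W) * Q2"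
      using W(1) Q2 by (simp add: cadjoint_mult mat_mult_assoc)
    then show "cadjoint (W * Q2) * (W * Q2) = 1\<^sub>m (Suc n)" using W Q2 Q2u by simp
    show "H = W * Q2 * mat_diag (Suc n) (\<lambda>i. of_real (d i)) * cadjoint (W * Q2)"
      unfolding WH' unfolding H'Q using W(1) Q2
      by (simp add: cadjoint_mult mat_mult_assoc)
  qed
qed

section \<open>Sylvester's law of inertia as a bound on definite index sets\<close>

lemma unitary_left_inverse:
  "Q \<in> carrier_mat n n \<Longrightarrow> cadjoint Q * Q = 1\<^sub>m n \<Longrightarrow> Q * cadjoint Q = 1\<^sub>m n"
  using mat_mult_left_right_inverse[of "cadjoint Q" n Q] by auto

lemma hform_gram:
  assumes M: "M \<in> carrier_mat n n" and S: "S \<subseteq> {..<n}"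
  shows "hform S (cadjoint M * mat_diag n (\<lambda>i. of_real (d i)) * M) x =
    of_real (\<Sum>k<n. d k * (cmod (\<Sum>j\<in>S. M $$ (k, j) * x j))\<^sup>2)"
proof -
  have e: "(cadjoint M * mat_diag n (\<lambda>i. of_real (d i)) * M) $$ (i, j)
      = (\<Sum>k<n. of_real (d k) * cnj (M $$ (k, i)) * M $$ (k, j))" if "i < n" "j < n" for i j
    using that M mat_diag_mult_right[of "cadjoint M" n n "\<lambda>i. complex_of_real (d i)"]
    by (subst index_mult_mat_sum) (auto simp: mult_ac intro!: sum.cong)
  have "hform S (cadjoint M * mat_diag n (\<lambda>i. of_real (d i)) * M) x
      = (\<Sum>i\<in>S. \<Sum>j\<in>S. \<Sum>k<n. of_real (d k) * (cnj (M $$ (k, i) * x i) * (M $$ (k, j) * x j)))"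
    unfolding hform_def using S
    by (intro sum.cong refl) (auto simp: e subset_iff sum_distrib_left sum_distrib_right mult_ac intro!: sum.cong)
  also have "\<dots> = (\<Sum>k<n. \<Sum>i\<in>S. \<Sum>j\<in>S. of_real (d k) * (cnj (M $$ (k, i) * x i) * (M $$ (k, j) * x j)))"
    by (rule trans[OF sum.cong[OF refl sum.swap] sum.swap])
  also have "\<dots> = (\<Sum>k<n. of_real (d k) * (cnj (\<Sum>i\<in>S. M $$ (k, i) * x i) * (\<Sum>j\<in>S. M $$ (k, j) * x j)))"
    by (simp only: sum_distrib_left sum_distrib_right cnj_sum) (intro sum.cong refl sum.swap)
  also have "\<dots> = of_real (\<Sum>k<n. d k * (cmod (\<Sum>j\<in>S. M $$ (k, j) * x j))\<^sup>2)"
    unfolding of_real_sum of_real_mult complex_norm_square by (simp only: mult_ac)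
  finally show ?thesis .
qed

text \<open>Equations are added one at a time. For the smaller system there is a solution
  \<open>x\<close> and, as one unknown can be spared, a second one \<open>y\<close> that is 0 at an
  index where \<open>x\<close> is not. They are independent, so a nontrivial combination satisfies
  the new equation as well.\<close>

lemma underdetermined_system:
  fixes a :: "'b \<Rightarrow> 'c \<Rightarrow> 'a :: field"
  assumes "finite P" "finite S" "card P < card S"
  shows "\<exists>x. (\<exists>j\<in>S. x j \<noteq> 0) \<and> (\<forall>j. j \<notin> S \<longrightarrow> x j = 0) \<and> (\<forall>i\<in>P. (\<Sum>j\<in>S. a i j * x j) = 0)"
  using assms
proof (induction P arbitrary: S rule: finite_induct)
  case empty
  then obtain j where "j \<in> S" by fastforce
  then show ?case by (intro exI[of _ "\<lambda>k. if k = j then 1 else 0"]) auto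
next
  case (insert p P)
  obtain x where x: "\<exists>j\<in>S. x j \<noteq> 0" "\<forall>j. j \<notin> S \<longrightarrow> x j = 0" "\<forall>i\<in>P. (\<Sum>j\<in>S. a i j * x j) = 0"
    using insert.IH[of S] insert.prems insert.hyps by auto
  obtain j0 where j0: "j0 \<in> S" "x j0 \<noteq> 0" using x(1) by blast
  have "card P < card (S - {j0})" using insert.prems insert.hyps j0 by simp
  then obtain y where y: "\<exists>j\<in>S - {j0}. y j \<noteq> 0" "\<forall>j. j \<notin> S - {j0} \<longrightarrow> y j = 0"
      "\<forall>i\<in>P. (\<Sum>j\<in>S - {j0}. a i j * y j) = 0"
    using insert.IH[of "S - {j0}"] insert.prems by auto
  have y': "(\<Sum>j\<in>S. a i j * y j) = (\<Sum>j\<in>S - {j0}. a i j * y j)" for i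
    using insert.prems(1) y(2) by (intro sum.mono_neutral_right) auto
  define s where "s = (\<Sum>j\<in>S. a p j * x j)"
  define t where "t = (\<Sum>j\<in>S. a p j * y j)"
  show ?case
  proof (cases "t = 0")
    case True
    then show ?thesis using y y' by (intro exI[of _ y]) (auto simp: t_def)
  next
    case False
    have *: "(\<Sum>j\<in>S. a i j * (t * x j - s * y j)) = t * (\<Sum>j\<in>S. a i j * x j) - s * (\<Sum>j\<in>S. a i j * y j)" for i
      by (simp add: sum_distrib_left sum_subtractf[symmetric] algebra_simps)
    show ?thesis
    proof (intro exI[of _ "\<lambda>j. t * x j - s * y j"] conjI)
      show "\<exists>j\<in>S. t * x j - s * y j \<noteq> 0"
        using j0 y(2) False by (intro bexI[of _ j0]) auto
    qed (use * x y y' in \<open>auto simp: s_def t_def\<close>)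
  qed
qed

text \<open>If \<open>S\<close> were larger than the set of positive \<open>d\<close>, some vector
  supported on \<open>S\<close> and nonzero there would have all its positive coordinates equal to
  0, and the weighted sum of squares would be nonpositive.\<close>

lemma inertia_bound:
  fixes d :: "nat \<Rightarrow> real"
  assumes R: "R \<in> carrier_mat n n" and Q: "Q \<in> carrier_mat n n" and S: "S \<subseteq> {..<n}"
    and H: "H = R * mat_diag n (\<lambda>i. of_real (d i)) * cadjoint R"
    and pd: "posdef_on S (cadjoint Q * H * Q)"
  shows "card S \<le> card {i. i < n \<and> d i > 0}"
proof (rule ccontr)
  let ?P = "{i. i < n \<and> d i > 0}"
  define M where "M = cadjoint R * Q"
  have M: "M \<in> carrier_mat n n" using R Q by (auto simp: M_def)
  assume "\<not> card S \<le> card ?P"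
  moreover have "finite S" using S finite_subset by blast
  ultimately obtain x where x: "\<exists>j\<in>S. x j \<noteq> 0" "\<forall>i\<in>?P. (\<Sum>j\<in>S. M $$ (i, j) * x j) = 0"
    using underdetermined_system[of ?P S "\<lambda>i j. M $$ (i, j)"] by auto
  have "cadjoint Q * H * Q = cadjoint M * mat_diag n (\<lambda>i. of_real (d i)) * M"
    unfolding M_def H using R Q
    by (simp add: cadjoint_mult mat_mult_assoc)
  then have "hform S (cadjoint Q * H * Q) x = of_real (\<Sum>k<n. d k * (cmod (\<Sum>j\<in>S. M $$ (k, j) * x j))\<^sup>2)"
    using hform_gram[OF M S] by simp
  moreover have "(\<Sum>k<n. d k * (cmod (\<Sum>j\<in>S. M $$ (k, j) * x j))\<^sup>2) \<le> 0"
  proof (rule sum_nonpos)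
    fix k assume "k \<in> {..<n}"
    then show "d k * (cmod (\<Sum>j\<in>S. M $$ (k, j) * x j))\<^sup>2 \<le> 0"
      using x(2) by (cases "d k > 0") (auto intro: mult_nonpos_nonneg)
  qed
  ultimately show False using pd x(1) unfolding posdef_on_def by fastforce
qed

lemma uminus_mat_diag_conj:
  assumes "R \<in> carrier_mat n n"
  shows "- (R * mat_diag n (\<lambda>i. complex_of_real (d i)) * cadjoint R) = R * mat_diag n (\<lambda>i. of_real (- d i)) * cadjoint R"
proof -
  have "mat_diag n (\<lambda>i. complex_of_real (- d i)) = - mat_diag n (\<lambda>i. of_real (d i))"
    by (auto simp: mat_diag_def intro!: eq_matI)
  then show ?thesis using assms
    by (simp add: uminus_mult_left_mat uminus_mult_right_mat)
qed

text \<open>The bridge from eigenvalue counts to definite index sets; the later arguments speak of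
  inertia only through these three bounds.\<close>

lemma nu_bounds:
  assumes H: "H \<in> carrier_mat n n" "cadjoint H = H"
  shows "\<And>Q S. Q \<in> carrier_mat n n \<Longrightarrow> S \<subseteq> {..<n} \<Longrightarrow> posdef_on S (cadjoint Q * H * Q) \<Longrightarrow> card S \<le> nu_plus H"
    and "\<And>Q S. Q \<in> carrier_mat n n \<Longrightarrow> S \<subseteq> {..<n} \<Longrightarrow> posdef_on S (cadjoint Q * (- H) * Q) \<Longrightarrow> card S \<le> nu_minus H"
    and "nu_plus H + nu_minus H \<le> n"
proof -
  obtain R and d :: "nat \<Rightarrow> real" where R: "R \<in> carrier_mat n n" "cadjoint R * R = 1\<^sub>m n"
      "H = R * mat_diag n (\<lambda>i. of_real (d i)) * cadjoint R"
    using hermitian_spectral[OF H] by blast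
  have p: "nu_plus H = card {i. i < n \<and> d i > 0}"
    unfolding nu_plus_def using sum_order_spectral[OF R, of "\<lambda>x. x > 0"] by simp
  have m: "nu_minus H = card {i. i < n \<and> d i < 0}"
    unfolding nu_minus_def using sum_order_spectral[OF R, of "\<lambda>x. x < 0"] by simp
  show "card S \<le> nu_plus H" if "Q \<in> carrier_mat n n" "S \<subseteq> {..<n}" "posdef_on S (cadjoint Q * H * Q)" for Q S
    unfolding p by (rule inertia_bound[OF R(1) that(1,2) R(3) that(3)])
  have "- H = R * mat_diag n (\<lambda>i. of_real (- d i)) * cadjoint R"
    unfolding R(3) by (rule uminus_mat_diag_conj[OF R(1)])
  from inertia_bound[OF R(1) _ _ this]
  show "card S \<le> nu_minus H" if "Q \<in> carrier_mat n n" "S \<subseteq> {..<n}" "posdef_on S (cadjoint Q * (- H) * Q)" for Q S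
    unfolding m using that by simp
  have "card {i. i < n \<and> d i > 0} + card {i. i < n \<and> d i < 0} = card ({i. i < n \<and> d i > 0} \<union> {i. i < n \<and> d i < 0})"
    by (subst card_Un_disjoint) auto
  also have "\<dots> \<le> card {..<n}" by (intro card_mono) auto
  finally show "nu_plus H + nu_minus H \<le> n" using p m by simp
qed

text \<open>The constant is governed by the smallest eigenvalue: each \<open>d k\<close> is the
  value of the form at a column of \<open>R\<close>, hence positive, and the unitary change of
  coordinates preserves the norm.\<close>

lemma posdef_lower_bound:
  assumes G: "G \<in> carrier_mat n n" "cadjoint G = G" and pd: "posdef_on {..<n} G"
  obtains m where "m > 0" "\<And>x. Re (hform {..<n} G x) \<ge> m * (\<Sum>i<n. (cmod (x i))\<^sup>2)"
proof -
  obtain R and d :: "nat \<Rightarrow> real" where R: "R \<in> carrier_mat n n" "cadjoint R * R = 1\<^sub>m n"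
      "G = R * mat_diag n (\<lambda>i. of_real (d i)) * cadjoint R"
    using hermitian_spectral[OF G] by blast
  let ?M = "cadjoint R"
  have M: "?M \<in> carrier_mat n n" using R by simp
  have h: "Re (hform {..<n} G x) = (\<Sum>k<n. d k * (cmod (\<Sum>j<n. ?M $$ (k, j) * x j))\<^sup>2)" for x
    using hform_gram[OF M, of "{..<n}" d x] R(3) by simp
  have norm: "(\<Sum>k<n. (cmod (\<Sum>j<n. ?M $$ (k, j) * x j))\<^sup>2) = (\<Sum>i<n. (cmod (x i))\<^sup>2)" for x
  proof -
    have "R * mat_diag n (\<lambda>i. of_real 1) * cadjoint R = 1\<^sub>m n"
      using R unitary_left_inverse[OF R(1,2)] by simp
    then have "complex_of_real (\<Sum>k<n. 1 * (cmod (\<Sum>j<n. ?M $$ (k, j) * x j))\<^sup>2) = hform {..<n} (1\<^sub>m n) x"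
      using hform_gram[OF M, of "{..<n}" "\<lambda>_. 1" x] by simp
    also have "\<dots> = (\<Sum>i<n. cnj (x i) * x i)"
      unfolding hform_def by (intro sum.cong refl) (simp add: if_distrib[of "\<lambda>x. _ * x * _"] cong: if_cong)
    also have "\<dots> = of_real (\<Sum>i<n. (cmod (x i))\<^sup>2)"
      unfolding of_real_sum complex_norm_square by (simp only: mult.commute)
    finally show ?thesis unfolding of_real_eq_iff by simp
  qed
  have dpos: "d k > 0" if k: "k < n" for k
  proof -
    have e: "(\<Sum>j<n. ?M $$ (l, j) * R $$ (j, k)) = (if l = k then 1 else 0)" if "l < n" for l
    proof -
      have "(\<Sum>j<n. ?M $$ (l, j) * R $$ (j, k)) = (?M * R) $$ (l, k)"
        using that k R(1) by (subst index_mult_mat_sum) auto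
      then show ?thesis using R(2) that k by simp
    qed
    have "\<exists>j\<in>{..<n}. R $$ (j, k) \<noteq> 0"
    proof (rule ccontr)
      assume "\<not> ?thesis"
      then have "(\<Sum>j<n. ?M $$ (k, j) * R $$ (j, k)) = 0" by (intro sum.neutral) auto
      then show False using e[OF k] by simp
    qed
    then have "0 < Re (hform {..<n} G (\<lambda>j. R $$ (j, k)))"
      by (rule pd[unfolded posdef_on_def, rule_format])
    also have "\<dots> = (\<Sum>l<n. if l = k then d l else 0)"
      unfolding h by (rule sum.cong[OF refl], subst e) simp_all
    finally show ?thesis using k by simp
  qed
  \<comment> \<open>The extra element 1 keeps the set nonempty when \<open>n = 0\<close>.\<close>
  define m where "m = Min (insert 1 (d ` {..<n}))"
  have "m > 0" unfolding m_def using dpos by (subst Min_gr_iff) auto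
  moreover have "m * (\<Sum>i<n. (cmod (x i))\<^sup>2) \<le> Re (hform {..<n} G x)" for x
    unfolding h norm[of x, symmetric] sum_distrib_left
    by (intro sum_mono mult_right_mono) (auto simp: m_def)
  ultimately show ?thesis using that by blast
qed

section \<open>Matrices of Laurent polynomials\<close>

lemma lpoly_if: "lpoly f \<Longrightarrow> lpoly g \<Longrightarrow> lpoly (\<lambda>z. if b then f z else g z)"
  by (cases b) simp_all

text \<open>Dimensions are fixed at every \<open>z\<close>, including 0, so that rules about
  carriers need no side condition; the entries are constrained only off 0.\<close>

definition lmat :: "nat \<Rightarrow> (complex \<Rightarrow> complex mat) \<Rightarrow> bool" where
  "lmat n F \<longleftrightarrow> (\<forall>z. F z \<in> carrier_mat n n) \<and> (\<forall>i<n. \<forall>j<n. lpoly (\<lambda>z. F z $$ (i, j)))"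

text \<open>On the circle \<open>1 / cnj z = z\<close>, so there this is the pointwise adjoint.\<close>

definition fstar :: "(complex \<Rightarrow> complex mat) \<Rightarrow> complex \<Rightarrow> complex mat" where
  "fstar F z = cadjoint (F (1 / cnj z))"

definition lhermitian :: "nat \<Rightarrow> (complex \<Rightarrow> complex mat) \<Rightarrow> bool" where
  "lhermitian n F \<longleftrightarrow> lmat n F \<and> (\<forall>z. z \<noteq> 0 \<longrightarrow> fstar F z = F z)"

text \<open>\<open>W\<close> may be singular at some points, so the relation is directed: the
  determinant of \<open>F\<close> may have zeros that \<open>G\<close> lacks, and this is how zeros
  are removed.\<close>

definition lcong :: "nat \<Rightarrow> (complex \<Rightarrow> complex mat) \<Rightarrow> (complex \<Rightarrow> complex mat) \<Rightarrow> bool" where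
  "lcong n F G \<longleftrightarrow> (\<exists>W. lmat n W \<and> (\<forall>z. z \<noteq> 0 \<longrightarrow> F z = fstar W z * G z * W z))"

lemma lmat_carrier: "lmat n F \<Longrightarrow> F z \<in> carrier_mat n n"
  by (simp add: lmat_def)

lemma lmat_dim: assumes "lmat n F" shows "dim_row (F z) = n" "dim_col (F z) = n"
  using lmat_carrier[OF assms, of z] by auto

lemma lmat_index: "lmat n F \<Longrightarrow> i < n \<Longrightarrow> j < n \<Longrightarrow> lpoly (\<lambda>z. F z $$ (i, j))"
  by (simp add: lmat_def)

lemma lmat_const: "A \<in> carrier_mat n n \<Longrightarrow> lmat n (\<lambda>z. A)"
  by (simp add: lmat_def lpoly_const)

lemma lmat_matI:
  "(\<And>i j. i < n \<Longrightarrow> j < n \<Longrightarrow> lpoly (f i j)) \<Longrightarrow> lmat n (\<lambda>z. mat n n (\<lambda>(i, j). f i j z))"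
  by (simp add: lmat_def)

lemma lmat_mat_diag: "(\<And>i. i < n \<Longrightarrow> lpoly (f i)) \<Longrightarrow> lmat n (\<lambda>z. mat_diag n (\<lambda>i. f i z))"
  unfolding mat_diag_def by (intro lmat_matI lpoly_if lpoly_const)

lemma lmat_mult: assumes "lmat n F" "lmat n G" shows "lmat n (\<lambda>z. F z * G z)"
proof -
  have "(F z * G z) $$ (i, j) = (\<Sum>k<n. F z $$ (i, k) * G z $$ (k, j))" if "i < n" "j < n" for i j z
    using that lmat_dim[OF assms(1)] lmat_dim[OF assms(2)] by (subst index_mult_mat_sum) auto
  then show ?thesis using assms
    by (auto simp: lmat_def intro!: lpoly_sum lpoly_mult mult_carrier_mat[of _ n n] simp del: index_mult_mat(1))
qed

lemma lmat_fstar: assumes "lmat n F" shows "lmat n (fstar F)"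
  using assms lmat_dim[OF assms]
  by (auto simp: lmat_def fstar_def intro: lpoly_star)

lemma fstar_index: "lmat n F \<Longrightarrow> i < n \<Longrightarrow> j < n \<Longrightarrow> fstar F z $$ (i, j) = cnj (F (1 / cnj z) $$ (j, i))"
  using lmat_dim[of n F] by (simp add: fstar_def)

lemma fstar_mult: "lmat n F \<Longrightarrow> lmat n G \<Longrightarrow> fstar (\<lambda>z. F z * G z) z = fstar G z * fstar F z"
  unfolding fstar_def by (rule cadjoint_mult) (simp add: lmat_dim)

lemma fstar_fstar: "fstar (fstar F) z = F z"
  by (simp add: fstar_def)

lemma fstar_circle: assumes "cmod z = 1" shows "fstar F z = cadjoint (F z)"
proof -
  have "z * cnj z = 1" using assms complex_norm_square[of z] by simp
  then have "1 / cnj z = z" by (metis nonzero_mult_div_cancel_right mult_zero_right zero_neq_one)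
  then show ?thesis by (simp add: fstar_def)
qed

lemma lpoly_det: assumes "lmat n F" shows "lpoly (\<lambda>z. det (F z))"
proof -
  have "det (F z) = (\<Sum>p \<in> {p. p permutes {0..<n}}. signof p * (\<Prod>i = 0..<n. F z $$ (i, p i)))" for z
    by (rule det_def'[OF lmat_carrier[OF assms]])
  then show ?thesis
    by (simp, intro lpoly_sum lpoly_mult lpoly_const lpoly_prod lmat_index[OF assms])
      (auto dest: permutes_in_image)
qed

lemma lhermitianD:
  assumes "lhermitian n F"
  shows "lmat n F" "z \<noteq> 0 \<Longrightarrow> fstar F z = F z"
    "z \<noteq> 0 \<Longrightarrow> i < n \<Longrightarrow> j < n \<Longrightarrow> cnj (F (1 / cnj z) $$ (i, j)) = F z $$ (j, i)"
  using assms fstar_index[of n F j i z] by (auto simp: lhermitian_def)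

lemma lhermitianI:
  assumes "lmat n F" "\<And>z i j. z \<noteq> 0 \<Longrightarrow> i < n \<Longrightarrow> j < n \<Longrightarrow> cnj (F (1 / cnj z) $$ (i, j)) = F z $$ (j, i)"
  shows "lhermitian n F"
  using assms lmat_dim[OF assms(1)] lmat_dim[OF lmat_fstar[OF assms(1)]]
  by (auto simp: lhermitian_def fstar_index intro!: eq_matI)

lemma lhermitian_congruence:
  assumes "lhermitian n F" "lmat n W" shows "lhermitian n (\<lambda>z. fstar W z * F z * W z)"
proof -
  note [simp] = lmat_dim[OF lhermitianD(1)[OF assms(1)]] lmat_dim[OF assms(2)] lmat_dim[OF lmat_fstar[OF assms(2)]]
  have l: "lmat n (\<lambda>z. fstar W z * F z * W z)"
    using assms lhermitianD(1) by (intro lmat_mult lmat_fstar) auto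
  moreover have "fstar (\<lambda>z. fstar W z * F z * W z) z = fstar W z * F z * W z" if "z \<noteq> 0" for z
    using that lhermitianD(2)[OF assms(1) that] fstar_fstar[of W z]
    by (simp add: fstar_def cadjoint_mult mat_mult_assoc)
  ultimately show ?thesis by (simp add: lhermitian_def)
qed

lemma lhermitian_det: "lhermitian n F \<Longrightarrow> z \<noteq> 0 \<Longrightarrow> cnj (det (F (1 / cnj z))) = det (F z)"
  using lhermitianD(2)[of n F z] det_cadjoint[OF lmat_carrier[OF lhermitianD(1)], of n F "1 / cnj z"]
  by (simp add: fstar_def)

lemma lcong_refl: assumes "lmat n F" shows "lcong n F F"
  unfolding lcong_def
  by (intro exI[of _ "\<lambda>z. 1\<^sub>m n"])
    (use left_mult_one_mat[OF lmat_carrier[OF assms]] right_mult_one_mat[OF lmat_carrier[OF assms]]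
      in \<open>auto simp: lmat_const fstar_def\<close>)

lemma lcong_trans:
  assumes "lcong n F G" "lcong n G H" "lmat n H" shows "lcong n F H"
proof -
  obtain V W where V: "lmat n V" "\<And>z. z \<noteq> 0 \<Longrightarrow> F z = fstar V z * G z * V z"
    and W: "lmat n W" "\<And>z. z \<noteq> 0 \<Longrightarrow> G z = fstar W z * H z * W z"
    using assms(1,2) unfolding lcong_def by blast
  have "F z = fstar (\<lambda>z. W z * V z) z * H z * (W z * V z)" if "z \<noteq> 0" for z
    unfolding V(2)[OF that] W(2)[OF that] fstar_mult[OF W(1) V(1)]
    using lmat_dim[OF V(1)] lmat_dim[OF W(1)] lmat_dim[OF assms(3)]
      lmat_dim[OF lmat_fstar[OF V(1)]] lmat_dim[OF lmat_fstar[OF W(1)]]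
    by (simp add: mat_mult_assoc)
  moreover have "lmat n (\<lambda>z. W z * V z)" by (rule lmat_mult[OF W(1) V(1)])
  ultimately show ?thesis unfolding lcong_def by (intro exI[of _ "\<lambda>z. W z * V z"]) auto
qed

section \<open>Splitting a pair of zeros off the determinant\<close>

lemma det_mat_diag: "det (mat_diag n f) = (\<Prod>i<n. f i)" for f :: "nat \<Rightarrow> 'a :: comm_ring_1"
proof -
  have "det (mat_diag n f) = prod_list (diag_mat (mat_diag n f))"
    by (rule det_upper_triangular[of _ n]) (auto simp: mat_diag_def)
  then show ?thesis by (simp add: prod_list_diag_prod mat_diag_def atLeast0LessThan)
qed

text \<open>Makes a given vector a coordinate direction by a constant invertible matrix, so that
  determinants change only by a nonzero constant.\<close>

lemma replace_column_identity:
  fixes v :: "'a :: field vec"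
  assumes "v \<in> carrier_vec n" "j < n" "v $ j \<noteq> 0"
  obtains Q P where "Q \<in> carrier_mat n n" "P \<in> carrier_mat n n" "Q * P = 1\<^sub>m n"
    "\<And>i. i < n \<Longrightarrow> Q $$ (i, j) = v $ i"
proof -
  define Q where "Q = mat n n (\<lambda>(i, k). if k = j then v $ i else if i = k then 1 else 0)"
  define P where "P = mat n n (\<lambda>(i, k). if k = j then (if i = j then 1 / v $ j else - v $ i / v $ j) else if i = k then 1 else 0)"
  show ?thesis
  proof (rule that[of Q P])
    show "Q * P = 1\<^sub>m n"
    proof (rule eq_matI)
      fix i k assume "i < dim_row (1\<^sub>m n :: 'a mat)" "k < dim_col (1\<^sub>m n :: 'a mat)"
      then have ik: "i < n" "k < n" by auto
      have "(Q * P) $$ (i, k) = (\<Sum>l<n. Q $$ (i, l) * P $$ (l, k))"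
        using ik by (subst index_mult_mat_sum) (auto simp: Q_def P_def)
      also have "\<dots> = (\<Sum>l<n. (if l = j then v $ i * P $$ (j, k) else 0) + (if l = i then (if i = j then 0 else P $$ (i, k)) else 0))"
        using ik by (intro sum.cong) (auto simp: Q_def)
      also have "\<dots> = v $ i * P $$ (j, k) + (if i = j then 0 else P $$ (i, k))"
        using ik assms by (simp add: sum.distrib)
      also have "\<dots> = 1\<^sub>m n $$ (i, k)"
        using ik assms by (auto simp: P_def)
      finally show "(Q * P) $$ (i, k) = 1\<^sub>m n $$ (i, k)" .
    qed (auto simp: Q_def P_def)
  qed (use assms in \<open>auto simp: Q_def P_def\<close>)
qed

text \<open>The left and right matrices may differ because the star of a matrix function is
  evaluated at \<open>1 / cnj z\<close> and the function itself at \<open>z\<close>.\<close>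

lemma index_sandwich_mat:
  assumes "Q' \<in> carrier_mat n n" "Q \<in> carrier_mat n n" "A \<in> carrier_mat n n" "i < n" "k < n"
  shows "(cadjoint Q' * A * Q) $$ (i, k) = (\<Sum>l<n. \<Sum>m<n. cnj (Q' $$ (l, i)) * A $$ (l, m) * Q $$ (m, k))"
proof -
  have "(cadjoint Q' * A * Q) $$ (i, k) = (\<Sum>m<n. \<Sum>l<n. cnj (Q' $$ (l, i)) * A $$ (l, m) * Q $$ (m, k))"
    using assms by (subst index_mult_mat_sum, simp_all del: index_mult_mat(1))
      (intro sum.cong refl, subst index_mult_mat_sum, simp_all add: sum_distrib_right)
  then show ?thesis by (subst sum.swap)
qed

text \<open>With \<open>v\<close> as column \<open>j\<close> of a constant \<open>Q\<close>, column
  \<open>j\<close> of \<open>G\<close> vanishes at \<open>a\<close> and is divisible by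
  \<open>z - a\<close>; by symmetry row \<open>j\<close> is divisible by
  \<open>1 / z - cnj a\<close>. The entry where they cross contains both factors by the assumption
  on \<open>g\<close>. Dividing them out gives \<open>F'\<close>.\<close>

lemma divide_kernel_vector:
  assumes F: "lhermitian n F" and a: "a \<noteq> 0"
    and v: "v \<in> carrier_vec n" "v \<noteq> 0\<^sub>v n" and ker: "F a *\<^sub>v v = 0\<^sub>v n"
    and g: "lpoly g" "\<And>z. z \<noteq> 0 \<Longrightarrow> (\<Sum>l<n. \<Sum>m<n. cnj (v $ l) * F z $$ (l, m) * v $ m) = (z - a) * (1 / z - cnj a) * g z"
  obtains F' c where "lhermitian n F'" "lcong n F F'" "c \<noteq> 0"
    "\<And>z. z \<noteq> 0 \<Longrightarrow> det (F z) = c * (z - a) * (1 / z - cnj a) * det (F' z)"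
proof -
  note Fl = lhermitianD(1)[OF F]
  obtain j where j: "j < n" "v $ j \<noteq> 0" using v by (metis carrier_vecD eq_vecI index_zero_vec)
  obtain Q P where Q: "Q \<in> carrier_mat n n" "P \<in> carrier_mat n n" "Q * P = 1\<^sub>m n"
    and Qj: "\<And>i. i < n \<Longrightarrow> Q $$ (i, j) = v $ i"
    using replace_column_identity[OF v(1) j] by metis
  define G where "G z = cadjoint Q * F z * Q" for z
  have Gh: "lhermitian n G"
    using lhermitian_congruence[OF F lmat_const[OF Q(1)]] by (simp add: G_def[abs_def] fstar_def)
  note Gl = lhermitianD(1)[OF Gh]
  have Gi: "G z $$ (i, k) = (\<Sum>l<n. \<Sum>m<n. cnj (Q $$ (l, i)) * F z $$ (l, m) * Q $$ (m, k))"
    if "i < n" "k < n" for z i k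
    unfolding G_def by (rule index_sandwich_mat[OF Q(1) Q(1) lmat_carrier[OF Fl] that])
  have kerl: "(\<Sum>m<n. F a $$ (l, m) * v $ m) = 0" if "l < n" for l
    using arg_cong[OF ker, of "\<lambda>w. w $ l"] that v(1) lmat_dim[OF Fl]
    by (simp add: scalar_prod_def atLeast0LessThan)
  have Gja: "G a $$ (i, j) = 0" if i: "i < n" for i
  proof -
    have "G a $$ (i, j) = (\<Sum>l<n. cnj (Q $$ (l, i)) * (\<Sum>m<n. F a $$ (l, m) * v $ m))"
      unfolding Gi[OF i j(1)] sum_distrib_left by (intro sum.cong refl) (simp add: Qj mult.assoc)
    then show ?thesis using kerl by simp
  qed
  have "\<exists>h. lpoly h \<and> (\<forall>z. z \<noteq> 0 \<longrightarrow> G z $$ (i, j) = (z - a) * h z)" if i: "i < n" for i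
    using lpoly_root[OF lmat_index[OF Gl i j(1)] a Gja[OF i]] by metis
  then obtain h where h: "\<And>i. i < n \<Longrightarrow> lpoly (h i)"
    "\<And>i z. i < n \<Longrightarrow> z \<noteq> 0 \<Longrightarrow> G z $$ (i, j) = (z - a) * h i z" by metis
  have Gjj: "G z $$ (j, j) = (z - a) * (1 / z - cnj a) * g z" if "z \<noteq> 0" for z
    unfolding Gi[OF j(1) j(1)] g(2)[OF that, symmetric] by (simp add: Qj)
  \<comment> \<open>The quotient matrix has \<open>g\<close> on its diagonal, so \<open>g\<close>
    has to be self-adjoint. The product of the two factors is its own star and can be
    cancelled.\<close>
  have gself: "cnj (g (1 / cnj z)) = g z" if z: "z \<noteq> 0" for z
  proof -
    let ?d = "\<lambda>z. cnj (g (1 / cnj z)) - g z" and ?e = "\<lambda>z. (z - a) * (1 / z - cnj a)"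
    have "?d z * ?e z = 0" if z: "z \<noteq> 0" for z
    proof -
      have "cnj (G (1 / cnj z) $$ (j, j)) = ?e z * cnj (g (1 / cnj z))"
        using z by (simp add: Gjj)
      then have "?e z * cnj (g (1 / cnj z)) = ?e z * g z"
        using lhermitianD(3)[OF Gh z j(1) j(1)] Gjj[OF z] by metis
      then show ?thesis by (metis left_diff_distrib mult.commute right_minus_eq)
    qed
    moreover have "\<exists>w. w \<noteq> 0 \<and> ?e w \<noteq> 0"
    proof -
      have "infinite (UNIV - {0, a, 1 / cnj a})" by (simp add: infinite_UNIV_char_0)
      then obtain w where w: "w \<notin> {0, a, 1 / cnj a}" by (metis Diff_iff finite.emptyI ex_in_conv)
      then have "1 / w \<noteq> cnj a" by (metis divide_divide_eq_right div_by_1 insertCI mult_1)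
      then show ?thesis using w by auto
    qed
    moreover have "lpoly ?d" "lpoly ?e" using g(1) by (auto intro!: lpoly_intros)
    ultimately show ?thesis using lpoly_zero_divisor[of ?d ?e _ z] z by auto
  qed
  define F' where "F' z = mat n n (\<lambda>(i, k). if i = j \<and> k = j then g z else if k = j then h i z
     else if i = j then cnj (h k (1 / cnj z)) else G z $$ (i, k))" for z
  have F'l: "lmat n F'"
    unfolding F'_def using g(1) h(1) lmat_index[OF Gl]
    by (intro lmat_matI lpoly_if) (auto intro: lpoly_star)
  have F'h: "lhermitian n F'"
    using lhermitianD(3)[OF Gh] gself by (intro lhermitianI[OF F'l]) (auto simp: F'_def)
  define C where "C z = mat_diag n (\<lambda>i. if i = j then z - a else 1)" for z
  have Cl: "lmat n C" unfolding C_def by (intro lmat_mat_diag lpoly_if lpoly_diff lpoly_id lpoly_const)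
  note dims = lmat_dim[OF Cl] lmat_dim[OF lmat_fstar[OF Cl]] lmat_dim[OF F'l] lmat_dim[OF Gl] lmat_dim[OF Fl]
  have fC: "fstar C z = mat_diag n (\<lambda>i. if i = j then 1 / z - cnj a else 1)" for z
    by (rule eq_matI) (auto simp: fstar_def C_def mat_diag_def)
  have GF': "G z = fstar C z * F' z * C z" if z: "z \<noteq> 0" for z
  proof (rule eq_matI)
    fix i k assume "i < dim_row (fstar C z * F' z * C z)" "k < dim_col (fstar C z * F' z * C z)"
    then have ik: "i < n" "k < n" by (auto simp: dims)
    have "(fstar C z * F' z * C z) $$ (i, k) =
       (if i = j then 1 / z - cnj a else 1) * F' z $$ (i, k) * (if k = j then z - a else 1)"
      unfolding fC unfolding C_def
      using ik lmat_carrier[OF F'l, of z]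
      by (subst mat_diag_mult_left[of _ n n], simp, subst mat_diag_mult_right[of _ n n]) auto
    moreover have "G z $$ (j, k) = (1 / z - cnj a) * cnj (h k (1 / cnj z))"
      using lhermitianD(3)[OF Gh z ik(2) j(1)] z ik by (simp add: h(2))
    ultimately show "G z $$ (i, k) = (fstar C z * F' z * C z) $$ (i, k)"
      using ik z j(1) Gjj[OF z] by (cases "i = j \<and> k = j") (auto simp: F'_def h(2) simp del: mult_eq_0_iff mult_cancel_right mult_cancel_left)
  qed (auto simp: dims)
  \<comment> \<open>\<open>G\<close> is the congruence of \<open>F'\<close> by \<open>C\<close>, and
    \<open>P\<close>, the inverse of \<open>Q\<close>, carries \<open>G\<close> back to
    \<open>F\<close>.\<close>
  define W where "W z = C z * P" for z
  have Wl: "lmat n W" unfolding W_def by (rule lmat_mult[OF Cl lmat_const[OF Q(2)]])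
  have fW: "fstar W z = cadjoint P * fstar C z" for z
    unfolding W_def fstar_mult[OF Cl lmat_const[OF Q(2)]] by (simp add: fstar_def)
  have FW: "F z = fstar W z * F' z * W z" if z: "z \<noteq> 0" for z
  proof -
    have "cadjoint P * G z * P = cadjoint (Q * P) * F z * (Q * P)"
      unfolding G_def using Q(1,2) dims by (simp add: cadjoint_mult mat_mult_assoc)
    also have "\<dots> = F z" unfolding Q(3) using lmat_carrier[OF Fl, of z] by simp
    finally have "F z = cadjoint P * (fstar C z * F' z * C z) * P" by (simp add: GF'[OF z])
    then show ?thesis unfolding fW unfolding W_def using dims Q(1,2) by (simp add: mat_mult_assoc)
  qed
  have "det Q * det P = 1" using det_mult[OF Q(1,2)] Q(3) by simp
  then have P0: "det P \<noteq> 0" by auto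
  show ?thesis
  proof (rule that[OF F'h, of "cnj (det P) * det P"])
    show "lcong n F F'" unfolding lcong_def using Wl FW by blast
    show "cnj (det P) * det P \<noteq> 0" using P0 by simp
    fix z :: complex assume z: "z \<noteq> 0"
    have dC: "det (C z) = z - a" "det (fstar C z) = 1 / z - cnj a"
      unfolding fC unfolding C_def det_mat_diag using j(1) by (simp_all add: prod.delta)
    have "det (F z) = det (fstar W z) * det (F' z) * det (W z)"
      unfolding FW[OF z] using lmat_carrier[OF F'l, of z] lmat_carrier[OF Wl, of z] lmat_carrier[OF lmat_fstar[OF Wl], of z]
      by (simp add: det_mult[of _ n])
    also have "\<dots> = (cnj (det P) * (1 / z - cnj a)) * det (F' z) * ((z - a) * det P)"
      unfolding fW unfolding W_def using Q lmat_carrier[OF Cl, of z] lmat_carrier[OF lmat_fstar[OF Cl], of z]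
      by (simp add: det_mult[of _ n] det_cadjoint dC)
    finally show "det (F z) = cnj (det P) * det P * (z - a) * (1 / z - cnj a) * det (F' z)" by (simp add: mult_ac)
  qed
qed

section \<open>Kernel vectors on the unit circle\<close>

text \<open>Scaling the coordinates in the kernel of \<open>diag d\<close> by \<open>1 / sqrt t\<close> turns \<open>G t\<close> into a matrix converging to
  a positive definite one, namely \<open>E\<close> on the kernel and \<open>diag d\<close> elsewhere.\<close>

lemma posdef_eventually:
  fixes G :: "real \<Rightarrow> complex mat" and d :: "nat \<Rightarrow> real" and E :: "complex mat"
  assumes S: "S \<subseteq> {..<n}"
    and lim: "\<And>i j. i \<in> S \<Longrightarrow> j \<in> S \<Longrightarrow>
      ((\<lambda>t. (G t $$ (i, j) - (if i = j then of_real (d i) else 0)) / of_real t) \<longlongrightarrow> E $$ (i, j)) (at_right 0)"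
    and d: "\<And>i. i \<in> S \<Longrightarrow> d i \<ge> 0"
    and Eh: "\<And>i j. i \<in> S \<Longrightarrow> j \<in> S \<Longrightarrow> cnj (E $$ (i, j)) = E $$ (j, i)"
    and pd: "posdef_on {i\<in>S. d i = 0} E"
  shows "\<forall>\<^sub>F t in at_right 0. posdef_on S (G t)"
proof -
  let ?Z = "{i\<in>S. d i = 0}"
  have finS: "finite S" using S finite_subset by blast
  \<comment> \<open>The expected limit, extended by the identity outside \<open>S\<close>, so that
    it is positive definite on all of \<open>{..<n}\<close> and has a uniform lower bound
    \<open>m\<close>.\<close>
  define G0 where "G0 = mat n n (\<lambda>(i, j). if i \<in> ?Z \<and> j \<in> ?Z then E $$ (i, j)
    else if i = j then (if i \<in> S then of_real (d i) else 1) else 0)"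
  have G0c: "G0 \<in> carrier_mat n n" by (simp add: G0_def)
  have G0h: "cadjoint G0 = G0"
    by (rule eq_matI) (use Eh in \<open>auto simp: G0_def\<close>)
  define r where "r i = (if i \<in> ?Z then 0 else if i \<in> S then d i else 1)" for i
  have h0: "hform {..<n} G0 x = hform ?Z E x + of_real (\<Sum>i<n. r i * (cmod (x i))\<^sup>2)" for x
  proof -
    have "hform {..<n} G0 x = (\<Sum>i<n. \<Sum>j<n. (if i \<in> ?Z \<and> j \<in> ?Z then cnj (x i) * E $$ (i, j) * x j else 0)
        + (if i = j then of_real (r i) * (x i * cnj (x i)) else 0))"
      unfolding hform_def by (intro sum.cong refl) (auto simp: G0_def r_def mult_ac)
    also have "\<dots> = (\<Sum>i<n. \<Sum>j<n. if i \<in> ?Z \<and> j \<in> ?Z then cnj (x i) * E $$ (i, j) * x j else 0)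
        + (\<Sum>i<n. of_real (r i) * (x i * cnj (x i)))"
      unfolding sum.distrib by simp
    also have "(\<Sum>i<n. \<Sum>j<n. if i \<in> ?Z \<and> j \<in> ?Z then cnj (x i) * E $$ (i, j) * x j else 0)
       = (\<Sum>i<n. if i \<in> ?Z then (\<Sum>j<n. if j \<in> ?Z then cnj (x i) * E $$ (i, j) * x j else 0) else 0)"
      by (intro sum.cong refl) auto
    also have "\<dots> = (\<Sum>i\<in>{..<n} \<inter> ?Z. \<Sum>j\<in>{..<n} \<inter> ?Z. cnj (x i) * E $$ (i, j) * x j)"
      by (simp only: sum.inter_restrict[OF finite_lessThan])
    also have "{..<n} \<inter> ?Z = ?Z" using S by auto
    finally show ?thesis unfolding hform_def of_real_sum of_real_mult complex_norm_square .
  qed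
  have r0: "r i \<ge> 0" for i using d by (auto simp: r_def)
  have pd0: "posdef_on {..<n} G0"
    unfolding posdef_on_def
  proof (intro allI impI)
    fix x :: "nat \<Rightarrow> complex" assume x: "\<exists>i\<in>{..<n}. x i \<noteq> 0"
    have nn: "(\<Sum>i<n. r i * (cmod (x i))\<^sup>2) \<ge> 0" using r0 by (intro sum_nonneg) auto
    show "0 < Re (hform {..<n} G0 x)"
    proof (cases "\<exists>i\<in>?Z. x i \<noteq> 0")
      case True
      then have "Re (hform ?Z E x) > 0" by (rule pd[unfolded posdef_on_def, rule_format])
      then show ?thesis using nn by (simp add: h0)
    next
      case False
      then have "hform ?Z E x = 0" unfolding hform_def by (intro sum.neutral ballI) auto
      moreover obtain i where i: "i < n" "x i \<noteq> 0" using x by auto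
      then have "i \<notin> ?Z" using False by blast
      then have "r i * (cmod (x i))\<^sup>2 > 0" using i d[of i] by (auto simp: r_def less_le)
      then have "(\<Sum>i<n. r i * (cmod (x i))\<^sup>2) > 0" using i(1) r0 by (intro sum_pos2[of _ i]) auto
      ultimately show ?thesis by (simp add: h0)
    qed
  qed
  obtain m where m: "m > 0" "\<And>x. Re (hform {..<n} G0 x) \<ge> m * (\<Sum>i<n. (cmod (x i))\<^sup>2)"
    using posdef_lower_bound[OF G0c G0h pd0] by blast
  define e where "e t i = (if i \<in> ?Z then 1 / sqrt t else 1)" for t i
  define K where "K t i j = of_real (e t i * e t j) * G t $$ (i, j)" for t i j
  have Klim: "((\<lambda>t. K t i j) \<longlongrightarrow> G0 $$ (i, j)) (at_right 0)" if ij: "i \<in> S" "j \<in> S" for i j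
  proof -
    let ?q = "\<lambda>t. (G t $$ (i, j) - (if i = j then of_real (d i) else 0)) / of_real t"
    have q: "(?q \<longlongrightarrow> E $$ (i, j)) (at_right 0)" by (rule lim[OF ij])
    have n: "i < n" "j < n" using ij S by auto
    have pos: "\<forall>\<^sub>F t::real in at_right 0. t > 0" by (simp add: eventually_at_filter)
    have t0: "((\<lambda>t. complex_of_real t) \<longlongrightarrow> 0) (at_right 0)"
      using tendsto_of_real[OF tendsto_ident_at[of "0::real" "{0<..}"]] by simp
    have s0: "((\<lambda>t. complex_of_real (sqrt t)) \<longlongrightarrow> 0) (at_right 0)"
      using tendsto_of_real[OF tendsto_real_sqrt[OF tendsto_ident_at[of "0::real" "{0<..}"]]] by simp
    \<comment> \<open>The scaling factor is \<open>1 / t\<close> if both indices lie in the kernel,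
      1 if neither does, and \<open>1 / sqrt t\<close> in the mixed case. There the entry is off the
      diagonal and of order \<open>t\<close>, so the scaled entry tends to 0.\<close>
    consider "i \<in> ?Z" "j \<in> ?Z" | "i \<notin> ?Z" "j \<notin> ?Z" | "i \<in> ?Z \<longleftrightarrow> j \<notin> ?Z" by blast
    then show ?thesis
    proof cases
      case 1
      have "\<forall>\<^sub>F t in at_right 0. K t i j = ?q t"
        using pos by eventually_elim (use 1 in \<open>auto simp: K_def e_def simp flip: of_real_mult\<close>)
      then show ?thesis using q 1 n by (simp add: G0_def tendsto_cong)
    next
      case 2
      have "(if i = j then of_real (d i) else 0) + E $$ (i, j) * 0 = G0 $$ (i, j)"
        using 2 n ij by (auto simp: G0_def)
      then have "((\<lambda>t. (if i = j then of_real (d i) else 0) + ?q t * of_real t) \<longlongrightarrow> G0 $$ (i, j)) (at_right 0)"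
        using tendsto_add[OF tendsto_const tendsto_mult[OF q t0], of "if i = j then of_real (d i) else 0"]
        by (simp only:)
      moreover have "\<forall>\<^sub>F t in at_right 0. K t i j = (if i = j then of_real (d i) else 0) + ?q t * of_real t"
        using pos by eventually_elim (use 2 in \<open>auto simp: K_def e_def\<close>)
      ultimately show ?thesis by (simp only: tendsto_cong)
    next
      case 3
      have "((\<lambda>t. ?q t * of_real (sqrt t)) \<longlongrightarrow> 0) (at_right 0)"
        using tendsto_mult[OF q s0] by simp
      moreover have "\<forall>\<^sub>F t in at_right 0. K t i j = ?q t * of_real (sqrt t)"
        using pos
      proof eventually_elim
        case (elim t)
        have "e t i * e t j = 1 / sqrt t" and ne: "i \<noteq> j" using 3 by (auto simp: e_def)
        then have "K t i j = of_real (1 / sqrt t) * G t $$ (i, j)" by (simp only: K_def)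
        moreover have "complex_of_real t = of_real (sqrt t) * of_real (sqrt t)"
          using elim by (simp flip: of_real_mult)
        ultimately show ?case using elim ne by (simp add: field_simps)
      qed
      moreover have "G0 $$ (i, j) = 0" using 3 n by (auto simp: G0_def)
      ultimately show ?thesis by (simp add: tendsto_cong)
    qed
  qed
  \<comment> \<open>Entrywise errors below this bound change the form by at most \<open>n\<close>
    times the bound times the squared norm, which is less than the lower bound \<open>m\<close>
    allows. The summand 1 avoids division by 0.\<close>
  define \<epsilon> where "\<epsilon> = m / (2 * real (n + 1))"
  have \<epsilon>: "\<epsilon> > 0" "real n * \<epsilon> < m" using m(1) by (auto simp: \<epsilon>_def field_simps intro!: add_nonneg_pos)
  have "\<forall>\<^sub>F t in at_right 0. \<forall>i\<in>S. \<forall>j\<in>S. dist (K t i j) (G0 $$ (i, j)) < \<epsilon>"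
    using finS tendstoD[OF Klim \<epsilon>(1)] by (intro eventually_ball_finite ballI) auto
  moreover have "\<forall>\<^sub>F t::real in at_right 0. t > 0" by (simp add: eventually_at_filter)
  ultimately show ?thesis
  proof eventually_elim
    case (elim t)
    show ?case unfolding posdef_on_def
    proof (intro allI impI)
      fix x :: "nat \<Rightarrow> complex" assume x: "\<exists>i\<in>S. x i \<noteq> 0"
      have ep: "e t i > 0" for i using elim by (simp add: e_def)
      define y where "y i = (if i \<in> S then x i / of_real (e t i) else 0)" for i
      have xy: "x i = of_real (e t i) * y i" if "i \<in> S" for i
        using that ep[of i] by (simp add: y_def)
      define N where "N = (\<Sum>i\<in>S. (cmod (y i))\<^sup>2)"
      have N: "N > 0"
      proof -
        obtain i where i: "i \<in> S" "x i \<noteq> 0" using x by blast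
        then have "y i \<noteq> 0" using ep[of i] by (simp add: y_def)
        then show ?thesis unfolding N_def using i finS by (intro sum_pos2[of _ i]) auto
      qed
      have "hform S (G t) x = (\<Sum>i\<in>S. \<Sum>j\<in>S. cnj (y i) * K t i j * y j)"
        unfolding hform_def by (intro sum.cong refl) (simp add: xy K_def mult_ac)
      also have "\<dots> = (\<Sum>i\<in>S. \<Sum>j\<in>S. cnj (y i) * G0 $$ (i, j) * y j)
          + (\<Sum>i\<in>S. \<Sum>j\<in>S. cnj (y i) * (K t i j - G0 $$ (i, j)) * y j)"
        unfolding sum.distrib[symmetric] by (intro sum.cong refl) (simp add: algebra_simps)
      also have "(\<Sum>i\<in>S. \<Sum>j\<in>S. cnj (y i) * G0 $$ (i, j) * y j) = hform {..<n} G0 y"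
      proof -
        have "hform {..<n} G0 y = (\<Sum>i\<in>S. \<Sum>j<n. cnj (y i) * G0 $$ (i, j) * y j)"
          unfolding hform_def using S by (intro sum.mono_neutral_right) (auto simp: y_def)
        also have "\<dots> = (\<Sum>i\<in>S. \<Sum>j\<in>S. cnj (y i) * G0 $$ (i, j) * y j)"
          using S by (intro sum.cong refl sum.mono_neutral_right) (auto simp: y_def)
        finally show ?thesis by simp
      qed
      finally have "Re (hform S (G t) x) = Re (hform {..<n} G0 y)
          + Re (\<Sum>i\<in>S. \<Sum>j\<in>S. cnj (y i) * (K t i j - G0 $$ (i, j)) * y j)" by simp
      moreover have "(\<Sum>i<n. (cmod (y i))\<^sup>2) = N"
        unfolding N_def using S by (intro sum.mono_neutral_right) (auto simp: y_def)
      then have "Re (hform {..<n} G0 y) \<ge> m * N" using m(2)[of y] by simp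
      moreover have "cmod (\<Sum>i\<in>S. \<Sum>j\<in>S. cnj (y i) * (K t i j - G0 $$ (i, j)) * y j) \<le> real n * \<epsilon> * N"
      proof -
        have "cmod (\<Sum>i\<in>S. \<Sum>j\<in>S. cnj (y i) * (K t i j - G0 $$ (i, j)) * y j)
            \<le> (\<Sum>i\<in>S. \<Sum>j\<in>S. cmod (cnj (y i) * (K t i j - G0 $$ (i, j)) * y j))"
          by (rule order_trans[OF norm_sum sum_mono[OF norm_sum]])
        also have "\<dots> \<le> (\<Sum>i\<in>S. \<Sum>j\<in>S. \<epsilon> * (((cmod (y i))\<^sup>2 + (cmod (y j))\<^sup>2) / 2))"
        proof (intro sum_mono)
          fix i j assume ij: "i \<in> S" "j \<in> S"
          have "cmod (K t i j - G0 $$ (i, j)) \<le> \<epsilon>" using elim(1) ij by (force simp: dist_norm)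
          then have "cmod (K t i j - G0 $$ (i, j)) * (cmod (y i) * cmod (y j)) \<le> \<epsilon> * (cmod (y i) * cmod (y j))"
            by (intro mult_right_mono) auto
          also have "\<dots> \<le> \<epsilon> * (((cmod (y i))\<^sup>2 + (cmod (y j))\<^sup>2) / 2)"
            using sum_squares_bound[of "cmod (y i)" "cmod (y j)"] \<epsilon>(1) by (intro mult_left_mono) auto
          finally show "cmod (cnj (y i) * (K t i j - G0 $$ (i, j)) * y j) \<le> \<epsilon> * (((cmod (y i))\<^sup>2 + (cmod (y j))\<^sup>2) / 2)"
            by (simp add: norm_mult mult_ac)
        qed
        also have "\<dots> = \<epsilon> * (real (card S) * N)"
          by (simp add: sum_distrib_left[symmetric] sum.distrib sum_divide_distrib[symmetric] N_def[symmetric])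
        also have "\<dots> \<le> \<epsilon> * (real n * N)"
          using card_mono[OF finite_lessThan S] N \<epsilon>(1) by (intro mult_left_mono mult_right_mono) auto
        finally show ?thesis by (simp add: mult_ac)
      qed
      moreover have "real n * \<epsilon> * N < m * N" using \<epsilon>(2) N by simp
      ultimately show "0 < Re (hform S (G t) x)"
        using abs_Re_le_cmod[of "\<Sum>i\<in>S. \<Sum>j\<in>S. cnj (y i) * (K t i j - G0 $$ (i, j)) * y j"] by linarith
    qed
  qed
qed

lemma hform_real:
  assumes "\<And>i j. i \<in> S \<Longrightarrow> j \<in> S \<Longrightarrow> cnj (E $$ (i, j)) = E $$ (j, i)"
  shows "of_real (Re (hform S E x)) = hform S E x"
proof -
  have "cnj (hform S E x) = (\<Sum>i\<in>S. \<Sum>j\<in>S. cnj (x j) * E $$ (j, i) * x i)"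
    unfolding hform_def cnj_sum by (intro sum.cong refl) (simp add: assms mult_ac)
  also have "\<dots> = hform S E x" unfolding hform_def by (rule sum.swap)
  finally show ?thesis by (simp add: complex_eq_iff)
qed

text \<open>If both signs occurred, at \<open>x\<close> and at \<open>y\<close>, the intermediate
  value theorem would give a zero of the form on the segment between them. Anisotropy makes that
  point the zero vector on \<open>S\<close>, so \<open>x\<close> and \<open>y\<close> are related by
  real factors and their values cannot have opposite signs.\<close>

lemma anisotropic_definite:
  assumes S: "finite S" and Eh: "\<And>i j. i \<in> S \<Longrightarrow> j \<in> S \<Longrightarrow> cnj (E $$ (i, j)) = E $$ (j, i)"
    and E: "E \<in> carrier_mat n n" "S \<subseteq> {..<n}"
    and an: "\<And>x. \<exists>i\<in>S. x i \<noteq> 0 \<Longrightarrow> hform S E x \<noteq> 0"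
  shows "posdef_on S E \<or> posdef_on S (- E)"
proof (rule ccontr)
  have hr: "of_real (Re (hform S E x)) = hform S E x" for x by (rule hform_real[OF Eh])
  assume "\<not> ?thesis"
  then obtain x y where xy: "\<exists>i\<in>S. x i \<noteq> 0" "Re (hform S E x) \<le> 0" "\<exists>i\<in>S. y i \<noteq> 0" "Re (hform S (- E) y) \<le> 0"
    unfolding posdef_on_def by (auto simp: not_less)
  have "hform S (- E) y = - hform S E y"
    unfolding hform_def sum_negf[symmetric] using E by (intro sum.cong refl) (auto simp: subset_iff)
  then have y: "Re (hform S E y) > 0" using xy(3,4) an[of y] hr[of y]
    by (simp add: complex_eq_iff less_le)
  have x: "Re (hform S E x) < 0" using xy(1,2) an[of x] hr[of x]
    by (auto simp: complex_eq_iff less_le)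
  define w where "w t i = of_real (1 - t) * x i + of_real t * y i" for t :: real and i
  have "continuous_on {0..1} (\<lambda>t. Re (hform S E (w t)))"
    unfolding hform_def w_def by (intro continuous_intros)
  moreover have "w 0 = x" "w 1 = y" by (auto simp: w_def)
  ultimately obtain t where t: "0 \<le> t" "t \<le> 1" "Re (hform S E (w t)) = 0"
    using IVT'[of "\<lambda>t. Re (hform S E (w t))" 0 0 1] x y by auto
  then have "hform S E (w t) = 0" using hr[of "w t"] by simp
  then have w0: "w t i = 0" if "i \<in> S" for i using an[of "w t"] that by blast
  have h: "hform S E (\<lambda>i. of_real c * u i) = of_real (c * c) * hform S E u" for c u
    unfolding hform_def sum_distrib_left by (intro sum.cong refl) (simp add: mult_ac)
  have "hform S E (\<lambda>i. of_real (1 - t) * x i) = hform S E (\<lambda>i. of_real (- t) * y i)"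
    unfolding hform_def
  proof (intro sum.cong refl)
    fix i j assume "i \<in> S" "j \<in> S"
    then have "of_real (1 - t) * x i = of_real (- t) * y i" "of_real (1 - t) * x j = of_real (- t) * y j"
      using w0 by (simp_all add: w_def add_eq_0_iff)
    then show "cnj (of_real (1 - t) * x i) * E $$ (i, j) * (of_real (1 - t) * x j) =
      cnj (of_real (- t) * y i) * E $$ (i, j) * (of_real (- t) * y j)" by simp
  qed
  from arg_cong[OF this[unfolded h], of Re]
  have "(1 - t) * (1 - t) * Re (hform S E x) = t * t * Re (hform S E y)" by simp
  moreover have "(1 - t) * (1 - t) * Re (hform S E x) \<le> 0" "t * t * Re (hform S E y) \<ge> 0"
    using x y by (auto simp: mult_nonneg_nonpos)
  ultimately have "t * t * Re (hform S E y) = 0" "(1 - t) * (1 - t) * Re (hform S E x) = 0" by auto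
  then show False using x y by auto
qed

text \<open>The finite set \<open>X\<close> absorbs the points where a congruence between two forms degenerates.\<close>

definition inertia_le :: "nat \<Rightarrow> (complex \<Rightarrow> complex mat) \<Rightarrow> nat \<Rightarrow> nat \<Rightarrow> bool" where
  "inertia_le n F p q \<longleftrightarrow> (\<exists>X. finite X \<and> (\<forall>z Q S. cmod z = 1 \<and> z \<notin> X \<and> Q \<in> carrier_mat n n \<and> S \<subseteq> {..<n} \<longrightarrow>
       (posdef_on S (cadjoint Q * F z * Q) \<longrightarrow> card S \<le> p) \<and>
       (posdef_on S (cadjoint Q * (- F z) * Q) \<longrightarrow> card S \<le> q)))"

lemma inertia_leE:
  assumes "inertia_le n F p q"
  obtains X where "finite X"
    "\<And>z Q S. cmod z = 1 \<Longrightarrow> z \<notin> X \<Longrightarrow> Q \<in> carrier_mat n n \<Longrightarrow> S \<subseteq> {..<n} \<Longrightarrow>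
       posdef_on S (cadjoint Q * F z * Q) \<Longrightarrow> card S \<le> p"
    "\<And>z Q S. cmod z = 1 \<Longrightarrow> z \<notin> X \<Longrightarrow> Q \<in> carrier_mat n n \<Longrightarrow> S \<subseteq> {..<n} \<Longrightarrow>
       posdef_on S (cadjoint Q * (- F z) * Q) \<Longrightarrow> card S \<le> q"
  using assms unfolding inertia_le_def by blast

lemma mat_inverse:
  fixes A :: "'a :: field mat"
  assumes "A \<in> carrier_mat n n" "det A \<noteq> 0"
  obtains B where "B \<in> carrier_mat n n" "A * B = 1\<^sub>m n" "B * A = 1\<^sub>m n"
proof -
  let ?B = "(1 / det A) \<cdot>\<^sub>m adj_mat A"
  have "?B \<in> carrier_mat n n" using adj_mat(1)[OF assms(1)] by simp
  moreover have "A * ?B = 1\<^sub>m n" "?B * A = 1\<^sub>m n"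
    using adj_mat[OF assms(1)] assms
    by (auto simp: mult_smult_distrib[of _ n n] mult_smult_assoc_mat[of _ n n] intro!: eq_matI)
  ultimately show ?thesis using that by blast
qed

lemma conj_uminus_mat:
  assumes "Q \<in> carrier_mat n n" "A \<in> carrier_mat n n"
  shows "cadjoint Q * (- A) * Q = - (cadjoint Q * A * Q)"
  using assms by simp

lemma det_conj_mat:
  assumes "W \<in> carrier_mat n n" "A \<in> carrier_mat n n"
  shows "det (cadjoint W * A * W) = cnj (det W) * det A * det W"
  using det_mult[OF mult_carrier_mat[OF cadjoint_carrier[OF assms(1)] assms(2)] assms(1)]
    det_mult[OF cadjoint_carrier[OF assms(1)] assms(2)] det_cadjoint[OF assms(1)] by simp

text \<open>Where \<open>det (F z)\<close> is nonzero, \<open>W z\<close> has an inverse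
  \<open>V\<close>, and testing \<open>G z\<close> with \<open>Q\<close> amounts to testing
  \<open>F z\<close> with \<open>V * Q\<close>. The finitely many zeros of the determinant join the
  exceptional set.\<close>

lemma inertia_le_lcong:
  assumes "inertia_le n F p q" "lcong n F G" "lmat n F" "lmat n G" "w \<noteq> 0" "det (F w) \<noteq> 0"
  shows "inertia_le n G p q"
proof -
  obtain X where X: "finite X"
    "\<And>z Q S. cmod z = 1 \<Longrightarrow> z \<notin> X \<Longrightarrow> Q \<in> carrier_mat n n \<Longrightarrow> S \<subseteq> {..<n} \<Longrightarrow>
       posdef_on S (cadjoint Q * F z * Q) \<Longrightarrow> card S \<le> p"
    "\<And>z Q S. cmod z = 1 \<Longrightarrow> z \<notin> X \<Longrightarrow> Q \<in> carrier_mat n n \<Longrightarrow> S \<subseteq> {..<n} \<Longrightarrow>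
       posdef_on S (cadjoint Q * (- F z) * Q) \<Longrightarrow> card S \<le> q"
    using inertia_leE[OF assms(1)] by blast
  obtain W where W: "lmat n W" "\<And>z. z \<noteq> 0 \<Longrightarrow> F z = fstar W z * G z * W z"
    using assms(2) unfolding lcong_def by blast
  let ?Y = "X \<union> {z. z \<noteq> 0 \<and> det (F z) = 0}"
  have "finite ?Y" using X(1) lpoly_finite_zeros[OF lpoly_det[OF assms(3)] assms(5,6)] by simp
  moreover have "(posdef_on S (cadjoint Q * G z * Q) \<longrightarrow> card S \<le> p) \<and>
       (posdef_on S (cadjoint Q * (- G z) * Q) \<longrightarrow> card S \<le> q)"
    if z: "cmod z = 1" "z \<notin> ?Y" and Q: "Q \<in> carrier_mat n n" and S: "S \<subseteq> {..<n}" for z Q S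
  proof -
    have z0: "z \<noteq> 0" using z by auto
    have Wc: "W z \<in> carrier_mat n n" and Gc: "G z \<in> carrier_mat n n"
      using lmat_carrier W(1) assms(4) by auto
    have FW: "F z = cadjoint (W z) * G z * W z" using W(2)[OF z0] fstar_circle[OF z(1), of W] by simp
    then have "det (F z) = cnj (det (W z)) * det (G z) * det (W z)"
      by (simp only: det_conj_mat[OF Wc Gc])
    then have "det (W z) \<noteq> 0" using z z0 by auto
    then obtain V where V: "V \<in> carrier_mat n n" "W z * V = 1\<^sub>m n" using mat_inverse[OF Wc] by blast
    have VQ: "V * Q \<in> carrier_mat n n" using V Q by simp
    have "cadjoint (V * Q) * F z * (V * Q) = cadjoint (W z * V * Q) * G z * (W z * V * Q)"
      unfolding FW using V(1) Q Wc Gc by (simp add: cadjoint_mult mat_mult_assoc)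
    then have e: "cadjoint (V * Q) * F z * (V * Q) = cadjoint Q * G z * Q"
      unfolding V(2) using Q by simp
    have "cadjoint (V * Q) * (- F z) * (V * Q) = cadjoint Q * (- G z) * Q"
      unfolding conj_uminus_mat[OF VQ lmat_carrier[OF assms(3)]] conj_uminus_mat[OF Q Gc] e ..
    then show ?thesis using X(2,3)[OF z(1) _ VQ S] e z(2) by auto
  qed
  ultimately show ?thesis unfolding inertia_le_def by (intro exI[of _ ?Y]) blast
qed

section \<open>Difference quotients along the unit circle\<close>

lemma lpoly_isCont: assumes "lpoly f" "a \<noteq> 0" shows "isCont f a"
proof -
  obtain p k where f: "\<And>z. z \<noteq> 0 \<Longrightarrow> f z = poly p z / z ^ k"
    using assms unfolding lpoly_def by blast
  have "isCont (\<lambda>z. poly p z / z ^ k) a" using assms(2) by (intro continuous_intros) auto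
  moreover have "\<forall>\<^sub>F z in nhds a. f z = poly p z / z ^ k"
    using t1_space_nhds[OF assms(2)] by eventually_elim (rule f)
  ultimately show ?thesis using isCont_cong by fastforce
qed

text \<open>The sign \<open>s\<close> selects the side from which the rotated point approaches
  \<open>a\<close>; the velocity there is \<open>s\<close> times \<open>\<i> * a\<close>.\<close>

lemma circle_path_limits:
  fixes a :: complex and s :: real
  assumes "a \<noteq> 0" "s = 1 \<or> s = -1"
  shows "filterlim (\<lambda>t. a * cis (s * t)) (at a) (at_right 0)"
    and "((\<lambda>t. (a * cis (s * t) - a) / of_real t) \<longlongrightarrow> of_real s * (\<i> * a)) (at_right 0)"
proof -
  have "((\<lambda>t. a * cis (s * t)) \<longlongrightarrow> a * cis (s * 0)) (at_right 0)"
    by (intro tendsto_intros)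
  moreover have "\<forall>\<^sub>F t in at_right 0. t \<in> {0<..<pi}" by (rule eventually_at_right_real) simp
  then have "\<forall>\<^sub>F t in at_right 0. a * cis (s * t) \<noteq> a"
  proof eventually_elim
    case (elim t)
    then have "sin t > 0" by (intro sin_gt_zero) auto
    then have "sin (s * t) \<noteq> 0" using assms(2) by auto
    then have "cis (s * t) \<noteq> 1" by (auto simp: complex_eq_iff)
    then show ?case using assms(1) by simp
  qed
  ultimately show "filterlim (\<lambda>t. a * cis (s * t)) (at a) (at_right 0)"
    by (simp add: filterlim_at)
  have "((\<lambda>t::real. (cos t - 1) / t) \<longlongrightarrow> 0) (at 0)" "((\<lambda>t::real. sin t / t) \<longlongrightarrow> 1) (at 0)"
    using DERIV_cos[of 0] DERIV_sin[of 0] by (simp_all add: DERIV_def)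
  then have "((\<lambda>t. Complex ((cos t - 1) / t) (s * (sin t / t))) \<longlongrightarrow> Complex 0 (s * 1)) (at_right 0)"
    by (intro tendsto_Complex tendsto_mult tendsto_const) (auto intro: filterlim_at_split[THEN iffD1, THEN conjunct2])
  then have *: "((\<lambda>t. a * Complex ((cos t - 1) / t) (s * (sin t / t))) \<longlongrightarrow> a * Complex 0 (s * 1)) (at_right 0)"
    by (intro tendsto_mult tendsto_const)
  have "a * Complex 0 (s * 1) = of_real s * (\<i> * a)" by (simp add: complex_eq_iff)
  moreover have "(a * cis (s * t) - a) / of_real t = a * Complex ((cos t - 1) / t) (s * (sin t / t))" for t
  proof -
    have "cis (s * t) - 1 = Complex (cos t - 1) (s * sin t)" using assms(2) by (auto simp: complex_eq_iff)
    then have "(cis (s * t) - 1) / of_real t = Complex ((cos t - 1) / t) (s * (sin t / t))"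
      by (simp add: complex_eq_iff Re_divide_of_real Im_divide_of_real)
    moreover have "(a * cis (s * t) - a) / of_real t = a * ((cis (s * t) - 1) / of_real t)"
      by (simp add: algebra_simps)
    ultimately show ?thesis by simp
  qed
  ultimately show "((\<lambda>t. (a * cis (s * t) - a) / of_real t) \<longlongrightarrow> of_real s * (\<i> * a)) (at_right 0)"
    using * by (simp only:)
qed

text \<open>A first-order expansion whose remainder is again a Laurent polynomial;
  \<open>h a\<close> is the derivative of \<open>f\<close> at \<open>a\<close>.\<close>

lemma lpoly_root_factor:
  assumes "lpoly f" "a \<noteq> 0"
  obtains h where "lpoly h" "\<And>z. z \<noteq> 0 \<Longrightarrow> f z = f a + (z - a) * h z"
proof -
  have "lpoly (\<lambda>z. f z - f a)" by (intro lpoly_diff lpoly_const assms(1))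
  from lpoly_root[OF this assms(2)] obtain h where "lpoly h" "\<And>z. z \<noteq> 0 \<Longrightarrow> f z - f a = (z - a) * h z"
    by auto
  then show ?thesis using that[of h] by (simp add: algebra_simps) 
qed

lemma lpoly_circle_quotient:
  assumes "lpoly h" "a \<noteq> 0" "s = 1 \<or> s = -1" and f: "\<And>z. z \<noteq> 0 \<Longrightarrow> f z = f a + (z - a) * h z"
  shows "((\<lambda>t. (f (a * cis (s * t)) - f a) / of_real t) \<longlongrightarrow> of_real s * (\<i> * a * h a)) (at_right 0)"
proof -
  have "((\<lambda>t. h (a * cis (s * t))) \<longlongrightarrow> h a) (at_right 0)"
    using filterlim_compose[OF lpoly_isCont[OF assms(1,2), unfolded isCont_def] circle_path_limits(1)[OF assms(2,3)]] .
  from tendsto_mult[OF circle_path_limits(2)[OF assms(2,3)] this]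
  show ?thesis using f[of "a * cis (s * t)" for t] assms(2) by (simp add: mult_ac)
qed

text \<open>With \<open>a = 1\<close> this also provides a point of the unit circle outside a finite
  set.\<close>

lemma eventually_circle_path_avoids:
  assumes "finite X" "a \<noteq> 0" "s = 1 \<or> s = -1"
  shows "\<forall>\<^sub>F t in at_right 0. a * cis (s * t) \<notin> X"
proof -
  have "\<forall>\<^sub>F z in at a. \<forall>x\<in>X. z \<noteq> x"
    using assms(1) by (intro eventually_ball_finite ballI) (auto simp: eventually_neq_at_within)
  then have "\<forall>\<^sub>F t in at_right 0. \<forall>x\<in>X. a * cis (s * t) \<noteq> x"
    using circle_path_limits(1)[OF assms(2,3)] unfolding filterlim_iff by blast
  then show ?thesis by eventually_elim blast
qed

text \<open>Write \<open>P\<close> and \<open>N\<close> for the sets of nonnegative and nonpositive eigenvalues of \<open>F a\<close>.  If the derivative is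
  definite on the kernel, the form is positive on \<open>P\<close> on one side of \<open>a\<close> and negative on \<open>N\<close> on the other,
  so \<open>card P + card N \<le> p + q \<le> n\<close> and the kernel is trivial.\<close>

lemma isotropic_kernel_vector:
  assumes F: "lhermitian n F" and a: "cmod a = 1" and det0: "det (F a) = 0"
    and inert: "inertia_le n F p q" "p + q \<le> n"
  obtains v g where "v \<in> carrier_vec n" "v \<noteq> 0\<^sub>v n" "F a *\<^sub>v v = 0\<^sub>v n" "lpoly g"
    "\<And>z. z \<noteq> 0 \<Longrightarrow> (\<Sum>l<n. \<Sum>m<n. cnj (v $ l) * F z $$ (l, m) * v $ m) = (z - a) * (1 / z - cnj a) * g z"
proof (rule ccontr)
  note found = that
  assume no: "\<not> thesis"
  note Fl = lhermitianD(1)[OF F]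
  have a0: "a \<noteq> 0" using a by auto
  have aa: "a * cnj a = 1" using a complex_norm_square[of a] by simp
  have Fa: "F a \<in> carrier_mat n n" "cadjoint (F a) = F a"
    using lmat_carrier[OF Fl] lhermitianD(2)[OF F a0] fstar_circle[OF a, of F] by auto
  obtain R and d :: "nat \<Rightarrow> real" where R: "R \<in> carrier_mat n n" "cadjoint R * R = 1\<^sub>m n"
      and FR: "F a = R * mat_diag n (\<lambda>i. of_real (d i)) * cadjoint R"
    using hermitian_spectral[OF Fa] by blast
  define G where "G z = cadjoint R * F z * R" for z
  have Gh: "lhermitian n G"
    using lhermitian_congruence[OF F lmat_const[OF R(1)]] by (simp add: G_def[abs_def] fstar_def)
  note Gl = lhermitianD(1)[OF Gh]
  have Gi: "G z $$ (i, k) = (\<Sum>l<n. \<Sum>m<n. cnj (R $$ (l, i)) * F z $$ (l, m) * R $$ (m, k))"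
    if "i < n" "k < n" for z i k
    unfolding G_def by (rule index_sandwich_mat[OF R(1) R(1) lmat_carrier[OF Fl] that])
  have Ga: "G a = mat_diag n (\<lambda>i. of_real (d i))"
  proof -
    have "G a = (cadjoint R * R) * mat_diag n (\<lambda>i. of_real (d i)) * (cadjoint R * R)"
      unfolding G_def FR using R(1) by (simp add: mat_mult_assoc)
    then show ?thesis unfolding R(2) by (simp add: right_mult_one_mat[OF mat_diag_dim] left_mult_one_mat[OF mat_diag_dim])
  qed
  have "\<exists>h. lpoly h \<and> (\<forall>z. z \<noteq> 0 \<longrightarrow> G z $$ (i, k) = G a $$ (i, k) + (z - a) * h z)" if "i < n" "k < n" for i k
    using lpoly_root_factor[OF lmat_index[OF Gl that] a0] by metis
  then obtain h where h: "\<And>i k. i < n \<Longrightarrow> k < n \<Longrightarrow> lpoly (h i k)"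
    "\<And>i k z. i < n \<Longrightarrow> k < n \<Longrightarrow> z \<noteq> 0 \<Longrightarrow> G z $$ (i, k) = G a $$ (i, k) + (z - a) * h i k z" by metis
  \<comment> \<open>The derivative of \<open>G\<close> at \<open>a\<close> with respect to the
    angle, in an eigenbasis of \<open>F a\<close>. It is Hermitian as a limit of Hermitian
    difference quotients along the circle.\<close>
  define E where "E = mat n n (\<lambda>(i, k). \<i> * a * h i k a)"
  have Ec: "E \<in> carrier_mat n n" by (simp add: E_def)
  have quot: "((\<lambda>t. (G (a * cis (s * t)) $$ (i, k) - G a $$ (i, k)) / of_real t) \<longlongrightarrow> of_real s * E $$ (i, k)) (at_right 0)"
    if "i < n" "k < n" "s = 1 \<or> s = -1" for s i k
    using lpoly_circle_quotient[OF h(1)[OF that(1,2)] a0 that(3), of "\<lambda>z. G z $$ (i, k)"] h(2)[OF that(1,2)] that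
    by (simp add: E_def)
  have Eh: "cnj (E $$ (i, k)) = E $$ (k, i)" if "i < n" "k < n" for i k
  proof -
    have "((\<lambda>t. cnj ((G (a * cis (1 * t)) $$ (i, k) - G a $$ (i, k)) / of_real t)) \<longlongrightarrow> cnj (of_real 1 * E $$ (i, k))) (at_right 0)"
      by (rule tendsto_cnj[OF quot[OF that]]) simp
    moreover have "cnj (G (a * cis (1 * t)) $$ (i, k)) = G (a * cis (1 * t)) $$ (k, i)" "cnj (G a $$ (i, k)) = G a $$ (k, i)" for t
    proof -
      have *: "cnj (G z $$ (i, k)) = G z $$ (k, i)" if "cmod z = 1" for z
      proof -
        have "z * cnj z = 1" using that complex_norm_square[of z] by simp
        then have "1 / cnj z = z" "z \<noteq> 0" by (metis nonzero_mult_div_cancel_right mult_zero_right zero_neq_one, auto)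
        then show ?thesis using lhermitianD(3)[OF Gh _ \<open>i < n\<close> \<open>k < n\<close>, of z] by simp
      qed
      show "cnj (G (a * cis (1 * t)) $$ (i, k)) = G (a * cis (1 * t)) $$ (k, i)" "cnj (G a $$ (i, k)) = G a $$ (k, i)"
        by (rule *, simp add: norm_mult a)+
    qed
    ultimately have "((\<lambda>t. (G (a * cis (1 * t)) $$ (k, i) - G a $$ (k, i)) / of_real t) \<longlongrightarrow> cnj (E $$ (i, k))) (at_right 0)"
      by simp
    from tendsto_unique[OF _ this quot[OF that(2,1), of 1]] show ?thesis by simp
  qed
  define Z where "Z = {i. i < n \<and> d i = 0}"
  have Zn: "Z \<subseteq> {..<n}" "finite Z" by (auto simp: Z_def)
  \<comment> \<open>A kernel vector isotropic for \<open>E\<close> would give the \<open>v\<close>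
    and \<open>g\<close> whose existence is being denied.\<close>
  have an: "hform Z E x \<noteq> 0" if x: "\<exists>i\<in>Z. x i \<noteq> 0" for x
  proof
    assume h0: "hform Z E x = 0"
    define y where "y i = (if i \<in> Z then x i else 0)" for i
    define v where "v = vec n (\<lambda>l. \<Sum>i<n. R $$ (l, i) * y i)"
    have v: "v \<in> carrier_vec n" by (simp add: v_def)
    have form: "(\<Sum>l<n. \<Sum>m<n. cnj (v $ l) * F z $$ (l, m) * v $ m) = (\<Sum>i<n. \<Sum>k<n. cnj (y i) * G z $$ (i, k) * y k)" for z
    proof -
      have "(\<Sum>l<n. \<Sum>m<n. cnj (v $ l) * F z $$ (l, m) * v $ m)
        = (\<Sum>l<n. \<Sum>m<n. \<Sum>i<n. \<Sum>k<n. cnj (y i) * (cnj (R $$ (l, i)) * F z $$ (l, m) * R $$ (m, k)) * y k)"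
      proof (intro sum.cong refl)
        fix l m assume lm: "l \<in> {..<n}" "m \<in> {..<n}"
        have "cnj (v $ l) * F z $$ (l, m) * v $ m = (\<Sum>i<n. cnj (R $$ (l, i) * y i)) * (\<Sum>k<n. F z $$ (l, m) * (R $$ (m, k) * y k))"
          using lm by (simp add: v_def sum_distrib_left[symmetric] mult.assoc)
        also have "\<dots> = (\<Sum>i<n. \<Sum>k<n. cnj (y i) * (cnj (R $$ (l, i)) * F z $$ (l, m) * R $$ (m, k)) * y k)"
          unfolding sum_product by (intro sum.cong refl) (simp add: mult_ac)
        finally show "cnj (v $ l) * F z $$ (l, m) * v $ m =
          (\<Sum>i<n. \<Sum>k<n. cnj (y i) * (cnj (R $$ (l, i)) * F z $$ (l, m) * R $$ (m, k)) * y k)" .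
      qed
      also have "\<dots> = (\<Sum>l<n. \<Sum>i<n. \<Sum>k<n. \<Sum>m<n. cnj (y i) * (cnj (R $$ (l, i)) * F z $$ (l, m) * R $$ (m, k)) * y k)"
        by (rule sum.cong[OF refl], rule trans[OF sum.swap], rule sum.cong[OF refl], rule sum.swap)
      also have "\<dots> = (\<Sum>i<n. \<Sum>k<n. \<Sum>l<n. \<Sum>m<n. cnj (y i) * (cnj (R $$ (l, i)) * F z $$ (l, m) * R $$ (m, k)) * y k)"
        by (rule trans[OF sum.swap], rule sum.cong[OF refl], rule sum.swap)
      also have "\<dots> = (\<Sum>i<n. \<Sum>k<n. cnj (y i) * G z $$ (i, k) * y k)"
        by (intro sum.cong refl) (simp add: Gi sum_distrib_left sum_distrib_right)
      finally show ?thesis .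
    qed
    have cy: "(\<Sum>l<n. cnj (R $$ (l, i)) * v $ l) = y i" if "i < n" for i
    proof -
      have "(\<Sum>l<n. cnj (R $$ (l, i)) * v $ l) = (\<Sum>l<n. \<Sum>k<n. cnj (R $$ (l, i)) * R $$ (l, k) * y k)"
        by (intro sum.cong refl) (simp add: v_def sum_distrib_left mult_ac)
      also have "\<dots> = (\<Sum>k<n. (\<Sum>l<n. cnj (R $$ (l, i)) * R $$ (l, k)) * y k)"
        by (subst sum.swap) (simp add: sum_distrib_right)
      also have "\<dots> = (\<Sum>k<n. (if k = i then y k else 0))"
      proof (rule sum.cong[OF refl])
        fix k assume k: "k \<in> {..<n}"
        have "(\<Sum>l<n. cnj (R $$ (l, i)) * R $$ (l, k)) = (cadjoint R * R) $$ (i, k)"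
          using that k R(1) by (subst index_mult_mat_sum) auto
        then show "(\<Sum>l<n. cnj (R $$ (l, i)) * R $$ (l, k)) * y k = (if k = i then y k else 0)"
          using that k unfolding R(2) by simp
      qed
      also have "\<dots> = y i" using that by simp
      finally show ?thesis .
    qed
    have v0: "v \<noteq> 0\<^sub>v n"
    proof
      assume "v = 0\<^sub>v n"
      then have y0: "y i = 0" if "i < n" for i using cy[OF that] by simp
      obtain i where "i \<in> Z" "x i \<noteq> 0" using x by blast
      then show False using y0[of i] Zn by (auto simp: y_def)
    qed
    have ker: "F a *\<^sub>v v = 0\<^sub>v n"
    proof (rule eq_vecI)
      fix l assume "l < dim_vec (0\<^sub>v n)"
      then have l: "l < n" by simp
      have "F a $$ (l, m) = (\<Sum>i<n. R $$ (l, i) * of_real (d i) * cnj (R $$ (m, i)))" if "m < n" for m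
        unfolding FR using l that R(1)
        by (subst index_mult_mat_sum) (auto simp: mat_diag_mult_right[OF R(1)] intro!: sum.cong)
      then have "(F a *\<^sub>v v) $ l = (\<Sum>m<n. \<Sum>i<n. R $$ (l, i) * of_real (d i) * (cnj (R $$ (m, i)) * v $ m))"
        using l v lmat_dim[OF Fl] by (simp add: scalar_prod_def atLeast0LessThan sum_distrib_left sum_distrib_right mult_ac)
      also have "\<dots> = (\<Sum>i<n. R $$ (l, i) * of_real (d i) * y i)"
        by (subst sum.swap) (intro sum.cong refl, simp add: cy flip: sum_distrib_left)
      also have "\<dots> = 0" by (intro sum.neutral ballI) (auto simp: y_def Z_def)
      finally show "(F a *\<^sub>v v) $ l = 0\<^sub>v n $ l" using l by simp
    qed (use lmat_dim[OF Fl] in auto)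
    \<comment> \<open>\<open>G a\<close> contributes nothing on its kernel, so the form of
      \<open>v\<close> is \<open>(z - a) * k z\<close>. Up to the factor \<open>\<i> * a\<close>,
      the value \<open>k a\<close> is the derivative form at \<open>x\<close>; isotropy therefore
      gives the second zero at \<open>a\<close>.\<close>
    define k where "k z = (\<Sum>i<n. \<Sum>j<n. cnj (y i) * h i j z * y j)" for z
    have kl: "lpoly k" unfolding k_def by (intro lpoly_sum lpoly_mult lpoly_const h(1)) auto
    have ka: "k a = 0"
    proof -
      have "\<i> * a * k a = (\<Sum>i<n. \<Sum>j<n. cnj (y i) * E $$ (i, j) * y j)"
        unfolding k_def sum_distrib_left by (intro sum.cong refl) (simp add: E_def mult_ac)
      also have "\<dots> = (\<Sum>i\<in>Z. \<Sum>j<n. cnj (y i) * E $$ (i, j) * y j)"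
        using Zn by (intro sum.mono_neutral_right) (auto simp: y_def)
      also have "\<dots> = (\<Sum>i\<in>Z. \<Sum>j\<in>Z. cnj (y i) * E $$ (i, j) * y j)"
        using Zn by (intro sum.cong refl sum.mono_neutral_right) (auto simp: y_def)
      also have "\<dots> = hform Z E x" unfolding hform_def by (intro sum.cong refl) (auto simp: y_def)
      finally show ?thesis using h0 a0 by simp
    qed
    obtain g where g: "lpoly g" "\<And>z. z \<noteq> 0 \<Longrightarrow> k z = (z - a) * g z"
      using lpoly_root[OF kl a0 ka] by blast
    have "(\<Sum>l<n. \<Sum>m<n. cnj (v $ l) * F z $$ (l, m) * v $ m) = (z - a) * (1 / z - cnj a) * (- (a * z) * g z)"
      if z: "z \<noteq> 0" for z
    proof -
      have "(\<Sum>i<n. \<Sum>j<n. cnj (y i) * G z $$ (i, j) * y j) =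
          (\<Sum>i<n. \<Sum>j<n. (z - a) * (cnj (y i) * h i j z * y j))"
        by (intro sum.cong refl) (auto simp: h(2)[OF _ _ z] Ga mat_diag_def y_def Z_def mult_ac)
      also have "\<dots> = (z - a) * ((z - a) * g z)"
        by (simp only: sum_distrib_left[symmetric] k_def[symmetric] g(2)[OF z])
      \<comment> \<open>On the circle \<open>a * cnj a = 1\<close>, so \<open>z - a\<close> and its
        star differ by the unit \<open>- (a * z)\<close>; the double zero becomes the required
        product.\<close>
      also have "\<dots> = (z - a) * (- (a * z) * (1 / z - cnj a) * g z)"
      proof -
        have "- (a * z) * (1 / z - cnj a) = - a * (z * (1 / z)) + z * (a * cnj a)" by (simp add: algebra_simps)
        then have "- (a * z) * (1 / z - cnj a) = z - a" using z aa by simp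
        then show ?thesis by (simp only:)
      qed
      finally show ?thesis unfolding form by (simp only: mult_ac)
    qed
    moreover have "lpoly (\<lambda>z. - (a * z) * g z)" using g(1) by (intro lpoly_intros) auto
    ultimately have thesis by (intro found[OF v v0 ker, of "\<lambda>z. - (a * z) * g z"])
    then show False using no by contradiction
  qed
  have EhZ: "cnj (E $$ (i, j)) = E $$ (j, i)" if "i \<in> Z" "j \<in> Z" for i j using Eh that Zn by auto
  \<comment> \<open>\<open>s\<close> is the direction along the circle in which the form increases
    on the kernel.\<close>
  obtain s :: real where s: "s = 1 \<or> s = -1" and pd: "posdef_on Z (of_real s \<cdot>\<^sub>m E)"
  proof -
    have "1 \<cdot>\<^sub>m E = E" "(-1) \<cdot>\<^sub>m E = - E" by (auto intro!: eq_matI)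
    then show ?thesis
      using anisotropic_definite[OF Zn(2) EhZ Ec Zn(1) an] that[of 1] that[of "-1"] by auto
  qed
  let ?E = "of_real s \<cdot>\<^sub>m E"
  have ss: "-s = 1 \<or> -s = -1" using s by auto
  have eqG: "G a $$ (i, j) = (if i = j then of_real (d i) else 0)" if "i < n" "j < n" for i j
    using that by (simp add: Ga mat_diag_def)
  let ?P = "{i. i < n \<and> d i \<ge> 0}" and ?N = "{i. i < n \<and> d i \<le> 0}"
  have evP: "\<forall>\<^sub>F t in at_right 0. posdef_on ?P (G (a * cis (s * t)))"
  proof (rule posdef_eventually[where n = n and d = d and E = ?E])
    fix i j assume "i \<in> ?P" "j \<in> ?P"
    then show "((\<lambda>t. (G (a * cis (s * t)) $$ (i, j) - (if i = j then of_real (d i) else 0)) / of_real t) \<longlongrightarrow> ?E $$ (i, j)) (at_right 0)"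
      using quot[of i j s] s eqG[of i j] Ec by simp
  next
    have "{i \<in> ?P. d i = 0} = Z" by (auto simp: Z_def)
    then show "posdef_on {i \<in> ?P. d i = 0} ?E" using pd by simp
  qed (use Eh Ec in auto)
  \<comment> \<open>Moving the other way and negating the form reverse the sign twice, so the
    derivative is again \<open>s\<close> times \<open>E\<close>, now with \<open>- d\<close> on the
    diagonal.\<close>
  have evN: "\<forall>\<^sub>F t in at_right 0. posdef_on ?N (- G (a * cis (- s * t)))"
  proof (rule posdef_eventually[where n = n and d = "\<lambda>i. - d i" and E = ?E])
    fix i j assume ij: "i \<in> ?N" "j \<in> ?N"
    then have "((\<lambda>t. - ((G (a * cis (-s * t)) $$ (i, j) - G a $$ (i, j)) / of_real t)) \<longlongrightarrow> - (of_real (-s) * E $$ (i, j))) (at_right 0)"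
      by (intro tendsto_minus quot) (use ss in auto)
    moreover have "- ((G (a * cis (-s * t)) $$ (i, j) - G a $$ (i, j)) / of_real t)
        = ((- G (a * cis (- s * t))) $$ (i, j) - (if i = j then of_real (- d i) else 0)) / of_real t" for t
      using ij eqG[of i j] lmat_dim[OF Gl] by (simp add: minus_divide_left)
    ultimately show "((\<lambda>t. ((- G (a * cis (- s * t))) $$ (i, j) - (if i = j then of_real (- d i) else 0)) / of_real t) \<longlongrightarrow> ?E $$ (i, j)) (at_right 0)"
      using ij Ec by simp
  next
    have "{i \<in> ?N. - d i = 0} = Z" by (auto simp: Z_def)
    then show "posdef_on {i \<in> ?N. - d i = 0} ?E" using pd by simp
  qed (use Eh Ec in auto)
  obtain X where finX: "finite X"
    and X: "\<And>z Q S. cmod z = 1 \<Longrightarrow> z \<notin> X \<Longrightarrow> Q \<in> carrier_mat n n \<Longrightarrow> S \<subseteq> {..<n} \<Longrightarrow>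
       posdef_on S (cadjoint Q * F z * Q) \<Longrightarrow> card S \<le> p"
    "\<And>z Q S. cmod z = 1 \<Longrightarrow> z \<notin> X \<Longrightarrow> Q \<in> carrier_mat n n \<Longrightarrow> S \<subseteq> {..<n} \<Longrightarrow>
       posdef_on S (cadjoint Q * (- F z) * Q) \<Longrightarrow> card S \<le> q"
    using inertia_leE[OF inert(1)] by blast
  have "\<forall>\<^sub>F t in at_right 0. posdef_on ?P (G (a * cis (s * t))) \<and> posdef_on ?N (- G (a * cis (- s * t)))
      \<and> a * cis (s * t) \<notin> X \<and> a * cis (-s * t) \<notin> X"
    using evP evN eventually_circle_path_avoids[OF finX a0 s] eventually_circle_path_avoids[OF finX a0 ss]
    by (auto simp: eventually_conj_iff)
  then obtain t where t: "posdef_on ?P (G (a * cis (s * t)))" "posdef_on ?N (- G (a * cis (- s * t)))"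
      "a * cis (s * t) \<notin> X" "a * cis (-s * t) \<notin> X"
    using eventually_happens'[OF trivial_limit_at_right_real] by blast
  have c: "cmod (a * cis u) = 1" "a * cis u \<noteq> 0" for u using a by (auto simp: norm_mult)
  have "card ?P \<le> p"
    by (rule X(1)[OF c(1) _ R(1), of "s * t"]) (use t(1,3) c(2) in \<open>auto simp: G_def\<close>)
  moreover have "card ?N \<le> q"
    by (rule X(2)[OF c(1) _ R(1), of "- s * t"])
      (use t(2,4) c(2) conj_uminus_mat[OF R(1) lmat_carrier[OF Fl]] in \<open>auto simp: G_def\<close>)
  moreover have "card ?P + card ?N = card (?P \<union> ?N) + card (?P \<inter> ?N)"
    by (rule card_Un_Int) auto
  moreover have "?P \<union> ?N = {..<n}" "?P \<inter> ?N = Z" by (auto simp: Z_def)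
  ultimately have "card Z = 0" using inert(2) by simp
  then have "Z = {}" using Zn by simp
  then have "(\<Prod>i<n. complex_of_real (d i)) \<noteq> 0" by (auto simp: Z_def)
  moreover have "det R \<noteq> 0"
    using R det_mult[of "cadjoint R" n R] by (auto simp: det_cadjoint[OF R(1)])
  moreover have "det (F a) = det R * (\<Prod>i<n. complex_of_real (d i)) * cnj (det R)"
    unfolding FR using R(1) by (simp add: det_mult[of _ n] det_cadjoint[of _ n] det_mat_diag)
  ultimately show False using det0 by simp
qed

section \<open>Reduction to a constant determinant\<close>

text \<open>The form of a constant vector is self-adjoint, so its zero at \<open>a\<close> is
  accompanied by one at \<open>b = 1 / cnj a\<close>. Off the circle the two points differ, and both
  linear factors can be split off.\<close>

lemma off_circle_kernel_form:
  assumes F: "lhermitian n F" and a: "a \<noteq> 0" "cmod a \<noteq> 1"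
    and v: "v \<in> carrier_vec n" "F a *\<^sub>v v = 0\<^sub>v n"
  obtains g where "lpoly g"
    "\<And>z. z \<noteq> 0 \<Longrightarrow> (\<Sum>l<n. \<Sum>m<n. cnj (v $ l) * F z $$ (l, m) * v $ m) = (z - a) * (1 / z - cnj a) * g z"
proof -
  note Fl = lhermitianD(1)[OF F]
  define f where "f z = (\<Sum>l<n. \<Sum>m<n. cnj (v $ l) * F z $$ (l, m) * v $ m)" for z
  have fl: "lpoly f" unfolding f_def by (intro lpoly_sum lpoly_mult lpoly_const lmat_index[OF Fl]) auto
  have "(\<Sum>m<n. F a $$ (l, m) * v $ m) = 0" if "l < n" for l
    using arg_cong[OF v(2), of "\<lambda>w. w $ l"] that v(1) lmat_dim[OF Fl]
    by (simp add: scalar_prod_def atLeast0LessThan)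
  moreover have "f a = (\<Sum>l<n. cnj (v $ l) * (\<Sum>m<n. F a $$ (l, m) * v $ m))"
    by (simp add: f_def sum_distrib_left mult.assoc)
  ultimately have fa: "f a = 0" by simp
  have fs: "cnj (f (1 / cnj z)) = f z" if "z \<noteq> 0" for z
  proof -
    have "cnj (f (1 / cnj z)) = (\<Sum>l<n. \<Sum>m<n. cnj (v $ m) * F z $$ (m, l) * v $ l)"
      unfolding f_def cnj_sum using lhermitianD(3)[OF F that] by (intro sum.cong refl) (simp add: mult_ac)
    then show ?thesis unfolding f_def by (subst sum.swap)
  qed
  define b where "b = 1 / cnj a"
  have b0: "b \<noteq> 0" using a by (simp add: b_def)
  have ab: "b \<noteq> a"
  proof
    assume "b = a"
    then have "a * cnj a = 1" using a by (simp add: b_def field_simps)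
    then have "(cmod a)\<^sup>2 = 1" using complex_norm_square[of a] by (metis of_real_eq_1_iff)
    then show False using a(2) norm_ge_zero[of a] by (auto simp: power2_eq_1_iff simp del: norm_ge_zero)
  qed
  have fb: "f b = 0" using fs[OF b0] fa by (simp add: b_def)
  obtain h where h: "lpoly h" "\<And>z. z \<noteq> 0 \<Longrightarrow> f z = (z - a) * h z" using lpoly_root[OF fl a(1) fa] by blast
  have "h b = 0" using h(2)[OF b0] fb ab by simp
  then obtain g where g: "lpoly g" "\<And>z. z \<noteq> 0 \<Longrightarrow> h z = (z - b) * g z" using lpoly_root[OF h(1) b0] by blast
  show ?thesis
  \<comment> \<open>The unit \<open>- b * z\<close> turns \<open>1 / z - cnj a\<close> into
    \<open>z - b\<close>.\<close>
  proof (rule that[of "\<lambda>z. - b * z * g z"])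
    show "lpoly (\<lambda>z. - b * z * g z)" by (intro lpoly_mult lpoly_const lpoly_id g(1))
    fix z :: complex assume z: "z \<noteq> 0"
    have "(1 / z - cnj a) * (- b * z) = z - b" using z a by (simp add: b_def field_simps)
    then have "(z - a) * (1 / z - cnj a) * (- b * z * g z) = f z"
      unfolding h(2)[OF z] g(2)[OF z] by (metis mult.assoc)
    then show "(\<Sum>l<n. \<Sum>m<n. cnj (v $ l) * F z $$ (l, m) * v $ m) = (z - a) * (1 / z - cnj a) * (- b * z * g z)"
      by (simp add: f_def)
  qed
qed

text \<open>Induction on the degree of the numerator of the determinant in normal form; every
  division lowers it by two. The inertia bounds pass to the quotient, so zeros on the circle can be
  treated again. Without nonzero zeros, self-adjointness makes the determinant constant.\<close>

lemma reduce_to_unimodular: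
  assumes "lhermitian n F" "w \<noteq> 0" "det (F w) \<noteq> 0" "inertia_le n F p q" "p + q \<le> n"
  shows "\<exists>B c. lhermitian n B \<and> lcong n F B \<and> c \<noteq> 0 \<and> (\<forall>z. z \<noteq> 0 \<longrightarrow> det (B z) = c)"
proof -
  have "\<exists>B c. lhermitian n B \<and> lcong n F B \<and> c \<noteq> 0 \<and> (\<forall>z. z \<noteq> 0 \<longrightarrow> det (B z) = c)"
    if "lhermitian n F" "inertia_le n F p q" "poly P 0 \<noteq> 0" "\<And>z. z \<noteq> 0 \<Longrightarrow> det (F z) = poly P z * z powi k"
    for F P k
    using that
  proof (induction "degree P" arbitrary: F P k rule: less_induct)
    case less
    note F = less.prems(1) and nf = less.prems(4)
    note Fl = lhermitianD(1)[OF F]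
    show ?case
    proof (cases "\<exists>a. a \<noteq> 0 \<and> poly P a = 0")
      case False
      then have "det (F z) \<noteq> 0" if "z \<noteq> 0" for z using nf that by auto
      then obtain c :: real where "c \<noteq> 0" "\<And>z. z \<noteq> 0 \<Longrightarrow> det (F z) = of_real c"
        using lpoly_selfadjoint_nonvanishing[OF lpoly_det[OF Fl] _ lhermitian_det[OF F]] by blast
      then show ?thesis using F lcong_refl[OF Fl] by (intro exI[of _ F] exI[of _ "of_real c"]) auto
    next
      case True
      then obtain a where a: "a \<noteq> 0" "poly P a = 0" by blast
      then have det0: "det (F a) = 0" using nf by simp
      obtain v g where v: "v \<in> carrier_vec n" "v \<noteq> 0\<^sub>v n" "F a *\<^sub>v v = 0\<^sub>v n" and g: "lpoly g"
        "\<And>z. z \<noteq> 0 \<Longrightarrow> (\<Sum>l<n. \<Sum>m<n. cnj (v $ l) * F z $$ (l, m) * v $ m) = (z - a) * (1 / z - cnj a) * g z"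
      proof (cases "cmod a = 1")
        case True
        show ?thesis by (rule isotropic_kernel_vector[OF F True det0 less.prems(2) assms(5)]) (rule that)
      next
        case False
        obtain v where v: "v \<in> carrier_vec n" "v \<noteq> 0\<^sub>v n" "F a *\<^sub>v v = 0\<^sub>v n"
          using det_0_iff_vec_prod_zero[OF lmat_carrier[OF Fl]] det0 by blast
        obtain g where "lpoly g" "\<And>z. z \<noteq> 0 \<Longrightarrow> (\<Sum>l<n. \<Sum>m<n. cnj (v $ l) * F z $$ (l, m) * v $ m) = (z - a) * (1 / z - cnj a) * g z"
          by (rule off_circle_kernel_form[OF F a(1) False v(1,3)]) (rule that)
        then show ?thesis by (rule that[OF v])
      qed
      obtain F' c where F': "lhermitian n F'" "lcong n F F'" "c \<noteq> 0"
        "\<And>z. z \<noteq> 0 \<Longrightarrow> det (F z) = c * (z - a) * (1 / z - cnj a) * det (F' z)"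
        by (rule divide_kernel_vector[OF F a(1) v g(1)]) (rule g(2), assumption, rule that)
      note F'l = lhermitianD(1)[OF F'(1)]
      have "P \<noteq> 0" using less.prems(3) by auto
      then have "finite {z. poly P z = 0}" by (rule poly_roots_finite)
      then have "infinite (UNIV - insert 0 {z. poly P z = 0})" by (simp add: infinite_UNIV_char_0)
      then obtain u where "u \<notin> insert 0 {z. poly P z = 0}" by (metis Diff_iff finite.emptyI ex_in_conv)
      then have u: "u \<noteq> 0" "det (F u) \<noteq> 0" using nf by auto
      then have "det (F' u) \<noteq> 0" using F'(4)[OF u(1)] by auto
      then obtain P' k' where P': "poly P' 0 \<noteq> 0" "\<And>z. z \<noteq> 0 \<Longrightarrow> det (F' z) = poly P' z * z powi k'"
        using lpoly_normal_form[OF lpoly_det[OF F'l] u(1)] by blast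
      \<comment> \<open>The factor \<open>1 / z - cnj a\<close> is \<open>1 - cnj a * z\<close>
        divided by \<open>z\<close>, which explains the exponent \<open>k' - 1\<close>. As
        \<open>a\<close> is nonzero, both linear factors have degree one and do not vanish at 0, so
        uniqueness of the normal form applies.\<close>
      let ?R = "[:c:] * [:- a, 1:] * [:1, - cnj a:] * P'"
      have "poly P z * z powi k = poly ?R z * z powi (k' - 1)" if z: "z \<noteq> 0" for z
      proof -
        have "poly P z * z powi k = c * (z - a) * (1 / z - cnj a) * (poly P' z * z powi k')"
          using F'(4)[OF z] nf[OF z] P'(2)[OF z] by simp
        also have "z powi k' = z * z powi (k' - 1)" using z by (simp add: power_int_diff)
        also have "c * (z - a) * (1 / z - cnj a) * (poly P' z * (z * z powi (k' - 1)))
          = c * (z - a) * ((1 / z - cnj a) * z) * poly P' z * z powi (k' - 1)" by (simp only: mult_ac)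
        also have "(1 / z - cnj a) * z = 1 - cnj a * z" using z by (simp add: field_simps)
        finally show ?thesis by (simp add: algebra_simps)
      qed
      moreover have "poly ?R 0 \<noteq> 0" using a(1) F'(3) P'(1) by simp
      ultimately have PR: "P = ?R" using lpoly_normal_form_unique(2)[OF less.prems(3)] by blast
      have "P' \<noteq> 0" using P'(1) by auto
      then have "degree ?R = degree P' + 2" using F'(3) a(1)
        by (subst degree_mult_eq, simp, simp)+ simp
      then have deg: "degree P' < degree P" using PR by simp
      have "inertia_le n F' p q" by (rule inertia_le_lcong[OF less.prems(2) F'(2) Fl F'l u])
      from less.hyps[OF deg F'(1) this P'] obtain B e where B: "lhermitian n B" "lcong n F' B" "e \<noteq> 0"
        "\<forall>z. z \<noteq> 0 \<longrightarrow> det (B z) = e" by blast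
      then show ?thesis using lcong_trans[OF F'(2) B(2) lhermitianD(1)[OF B(1)]] by blast
    qed
  qed
  moreover obtain P k where "poly P 0 \<noteq> 0" "\<And>z. z \<noteq> 0 \<Longrightarrow> det (F z) = poly P z * z powi k"
    using lpoly_normal_form[OF lpoly_det[OF lhermitianD(1)[OF assms(1)]] assms(2,3)] by blast
  ultimately show ?thesis using assms(1,4) by blast
qed

section \<open>Hermitian matrices with constant determinant\<close>

lemma poly_det:
  fixes P :: "'a :: comm_ring_1 poly mat"
  assumes "P \<in> carrier_mat n n"
  shows "poly (det P) z = det (map_mat (\<lambda>p. poly p z) P)"
proof -
  have "poly (signof p) z = signof p" for p :: "nat \<Rightarrow> nat" by (simp add: sign_def)
  moreover have "(\<Prod>i = 0..<n. poly (P $$ (i, p i)) z) = (\<Prod>i = 0..<n. map_mat (\<lambda>p. poly p z) P $$ (i, p i))"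
    if "p permutes {0..<n}" for p
    using assms permutes_in_image[OF that] by (intro prod.cong) auto
  ultimately show ?thesis
    using assms by (simp add: det_def'[of _ n] poly_sum poly_prod)
qed

text \<open>In other words, the column module of \<open>P\<close> has codimension at most \<open>m\<close>.  The induction splits \<open>P Q = P' diag(1, .., x, .., 1)\<close>
  and uses two independent combinations in the image of \<open>P'\<close>, one further linear condition being left.\<close>

lemma combination_in_image:
  fixes P :: "complex poly mat" and y :: "'b \<Rightarrow> nat \<Rightarrow> complex poly"
  assumes "P \<in> carrier_mat n n" "det P = monom c m" "c \<noteq> 0" "finite J" "card J > m"
  shows "\<exists>a x. (\<exists>k\<in>J. a k \<noteq> 0) \<and> (\<forall>k. k \<notin> J \<longrightarrow> a k = 0) \<and>
    (\<forall>i<n. (\<Sum>k\<in>J. Polynomial.smult (a k) (y k i)) = (\<Sum>l<n. P $$ (i, l) * x l))"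
  using assms
proof (induction m arbitrary: P c J)
  \<comment> \<open>The determinant is a nonzero constant, so the adjugate gives a polynomial
    inverse and every vector lies in the image.\<close>
  case 0
  then obtain j where j: "j \<in> J" by fastforce
  let ?A = "adj_mat P"
  have A: "?A \<in> carrier_mat n n" "P * ?A = [:c:] \<cdot>\<^sub>m 1\<^sub>m n"
    using adj_mat[OF 0(1)] 0(2) by (simp_all add: monom_0)
  let ?x = "\<lambda>l. Polynomial.smult (1 / c) (\<Sum>k<n. ?A $$ (l, k) * y j k)"
  have "(\<Sum>l<n. P $$ (i, l) * ?x l) = y j i" if i: "i < n" for i
  proof -
    have "(\<Sum>l<n. P $$ (i, l) * ?x l) = Polynomial.smult (1 / c) (\<Sum>l<n. \<Sum>k<n. P $$ (i, l) * ?A $$ (l, k) * y j k)"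
      by (simp add: sum_distrib_left mult.assoc smult_sum2)
    also have "(\<Sum>l<n. \<Sum>k<n. P $$ (i, l) * ?A $$ (l, k) * y j k) = (\<Sum>k<n. (P * ?A) $$ (i, k) * y j k)"
      using i 0(1) A(1) by (subst sum.swap) (intro sum.cong refl, subst index_mult_mat_sum, auto simp: sum_distrib_right)
    also have "\<dots> = (\<Sum>k<n. if k = i then Polynomial.smult c (y j k) else 0)"
      unfolding A(2) using i by (intro sum.cong) auto
    finally show ?thesis using i 0(3) by simp
  qed
  moreover have "(\<Sum>k\<in>J. Polynomial.smult (if k = j then 1 else 0) (y k i)) = y j i" for i
  proof -
    have "(\<Sum>k\<in>J. Polynomial.smult (if k = j then 1 else 0) (y k i)) = (\<Sum>k\<in>J. if k = j then y k i else 0)"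
      by (intro sum.cong) auto
    then show ?thesis using j 0(4) by simp
  qed
  ultimately show ?case using j
    by (intro exI[of _ "\<lambda>k. if k = j then 1 else 0"] exI[of _ ?x]) auto
next
  case (Suc m)
  note P = Suc.prems(1)
  let ?P0 = "map_mat (\<lambda>p. poly p 0) P"
  have P0: "?P0 \<in> carrier_mat n n" using P by simp
  \<comment> \<open>The determinant vanishes at 0, so \<open>P\<close> has a constant kernel vector
    there. As column \<open>j\<close> of \<open>Q\<close> it makes column \<open>j\<close> of the
    product divisible by the variable.\<close>
  have "det ?P0 = 0" unfolding poly_det[OF P, symmetric] Suc.prems(2) by (simp add: poly_monom)
  then obtain u where u: "u \<in> carrier_vec n" "u \<noteq> 0\<^sub>v n" "?P0 *\<^sub>v u = 0\<^sub>v n"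
    using det_0_iff_vec_prod_zero[OF P0] by blast
  obtain j where j: "j < n" "u $ j \<noteq> 0" using u by (metis carrier_vecD eq_vecI index_zero_vec)
  obtain Q R where Q: "Q \<in> carrier_mat n n" "R \<in> carrier_mat n n" "Q * R = 1\<^sub>m n"
    and Qj: "\<And>i. i < n \<Longrightarrow> Q $$ (i, j) = u $ i"
    using replace_column_identity[OF u(1) j] by metis
  define q where "q i k = [:Q $$ (i, k):]" for i k
  define G where "G i k = (\<Sum>l<n. P $$ (i, l) * q l k)" for i k
  have "poly (G i j) 0 = 0" if i: "i < n" for i
  proof -
    have "poly (G i j) 0 = (\<Sum>l<n. poly (P $$ (i, l)) 0 * u $ l)"
      by (simp add: G_def q_def poly_sum Qj mult.commute)
    also have "\<dots> = (?P0 *\<^sub>v u) $ i"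
      using i P u(1) by (auto simp: scalar_prod_def atLeast0LessThan intro!: sum.cong)
    finally show ?thesis using u(3) i by simp
  qed
  then have "\<forall>i<n. \<exists>g. G i j = [:0, 1:] * g"
    using poly_eq_0_iff_dvd[of _ 0] by (auto simp: dvd_def)
  then obtain g where g: "\<And>i. i < n \<Longrightarrow> G i j = [:0, 1:] * g i" by metis
  define P' where "P' = mat n n (\<lambda>(i, k). if k = j then g i else G i k)"
  define f where "f k = (if k = j then [:0, 1:] else 1 :: complex poly)" for k
  have P': "P' \<in> carrier_mat n n" by (simp add: P'_def)
  have GP': "G i k = P' $$ (i, k) * f k" if "i < n" "k < n" for i k
    using that g by (simp add: P'_def f_def)
  define q' where "q' = mat n n (\<lambda>(i, k). q i k)"
  have q': "q' \<in> carrier_mat n n" by (simp add: q'_def)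
  have "P * q' = P' * mat_diag n f"
  proof (rule eq_matI)
    fix i k assume "i < dim_row (P' * mat_diag n f)" "k < dim_col (P' * mat_diag n f)"
    then have ik: "i < n" "k < n" using P' by auto
    have "(P * q') $$ (i, k) = G i k"
      using ik P by (subst index_mult_mat_sum) (auto simp: q'_def G_def)
    moreover have "(P' * mat_diag n f) $$ (i, k) = P' $$ (i, k) * f k"
      unfolding mat_diag_mult_right[OF P'] using ik by simp
    ultimately show "(P * q') $$ (i, k) = (P' * mat_diag n f) $$ (i, k)" by (simp add: GP'[OF ik])
  qed (use P P' q' in auto)
  from arg_cong[OF this, of det] have "det P * det q' = det P' * [:0, 1:]"
    using P P' q' j(1) by (simp add: det_mult[of _ n] det_mat_diag f_def prod.delta)
  moreover have "det q' = [:det Q:]"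
  proof -
    interpret comm_ring_hom "\<lambda>c :: complex. [:c:]" by standard auto
    have "q' = map_mat (\<lambda>c. [:c:]) Q" using Q by (auto simp: q'_def q_def)
    then show ?thesis by (simp add: hom_det)
  qed
  moreover have "[:0, 1:] = (monom 1 (Suc 0) :: complex poly)" by (simp add: monom_Suc monom_0)
  ultimately have "det P' * [:0, 1:] = monom (c * det Q) m * [:0, 1:]"
    unfolding Suc.prems(2) by (simp add: mult_monom monom_0[symmetric] del: mult_pCons_right)
  then have detP': "det P' = monom (c * det Q) m" by (metis mult_right_cancel pCons_eq_0_iff zero_neq_one)
  have "det Q * det R = 1" using det_mult[OF Q(1,2)] Q(3) by simp
  then have c': "c * det Q \<noteq> 0" using Suc.prems(3) by auto
  note IH = Suc.IH[OF P' detP' c']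
  obtain a x where a: "\<exists>k\<in>J. a k \<noteq> 0" "\<forall>k. k \<notin> J \<longrightarrow> a k = 0"
    "\<And>i. i < n \<Longrightarrow> (\<Sum>k\<in>J. Polynomial.smult (a k) (y k i)) = (\<Sum>l<n. P' $$ (i, l) * x l)"
    using IH[of J] Suc.prems(4,5) by auto
  obtain k0 where k0: "k0 \<in> J" "a k0 \<noteq> 0" using a(1) by blast
  \<comment> \<open>One index is given up to gain independence: \<open>b\<close> vanishes at
    \<open>k0\<close> whereas \<open>a\<close> does not, and \<open>J - {k0}\<close> still has more
    than \<open>m\<close> elements.\<close>
  obtain b x' where b: "\<exists>k\<in>J - {k0}. b k \<noteq> 0" "\<forall>k. k \<notin> J - {k0} \<longrightarrow> b k = 0"
    "\<And>i. i < n \<Longrightarrow> (\<Sum>k\<in>J - {k0}. Polynomial.smult (b k) (y k i)) = (\<Sum>l<n. P' $$ (i, l) * x' l)"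
  proof -
    have "finite (J - {k0})" "card (J - {k0}) > m" using Suc.prems(4,5) k0(1) by auto
    from IH[OF this] show ?thesis using that by blast
  qed
  have b': "(\<Sum>k\<in>J. Polynomial.smult (b k) (y k i)) = (\<Sum>l<n. P' $$ (i, l) * x' l)" if "i < n" for i
    unfolding b(3)[OF that, symmetric] using Suc.prems(4) b(2) by (intro sum.mono_neutral_right) auto
  \<comment> \<open>A combination of the two vectors lies in the image of \<open>P\<close> once
    coordinate \<open>j\<close> of its preimage under \<open>P'\<close> is divisible by the
    variable. This is one linear condition on two coefficients.\<close>
  have "\<exists>\<alpha> \<beta>. (\<alpha> \<noteq> 0 \<or> \<beta> \<noteq> 0) \<and> \<alpha> * poly (x j) 0 + \<beta> * poly (x' j) 0 = 0"
  proof (cases "poly (x' j) 0 = 0")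
    case True
    then show ?thesis by (intro exI[of _ 0] exI[of _ 1]) auto
  next
    case False
    then show ?thesis
      by (intro exI[of _ "poly (x' j) 0"] exI[of _ "- poly (x j) 0"]) auto
  qed
  then obtain \<alpha> \<beta> where ab: "\<alpha> \<noteq> 0 \<or> \<beta> \<noteq> 0" "\<alpha> * poly (x j) 0 + \<beta> * poly (x' j) 0 = 0" by blast
  define w where "w l = Polynomial.smult \<alpha> (x l) + Polynomial.smult \<beta> (x' l)" for l
  have "poly (w j) 0 = 0" using ab(2) by (simp add: w_def)
  then obtain wj where wj: "w j = [:0, 1:] * wj" using poly_eq_0_iff_dvd[of "w j" 0] by (auto simp: dvd_def)
  define w' where "w' l = (if l = j then wj else w l)" for l
  have ww': "w l = f l * w' l" for l using wj by (simp add: f_def w'_def)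
  define e where "e k = \<alpha> * a k + \<beta> * b k" for k
  define v where "v l = (\<Sum>k<n. q l k * w' k)" for l
  have "(\<Sum>k\<in>J. Polynomial.smult (e k) (y k i)) = (\<Sum>l<n. P $$ (i, l) * v l)" if i: "i < n" for i
  proof -
    have "(\<Sum>k\<in>J. Polynomial.smult (e k) (y k i)) = Polynomial.smult \<alpha> (\<Sum>k\<in>J. Polynomial.smult (a k) (y k i)) + Polynomial.smult \<beta> (\<Sum>k\<in>J. Polynomial.smult (b k) (y k i))"
      by (simp add: e_def smult_sum2 smult_add_left sum.distrib)
    also have "\<dots> = (\<Sum>l<n. P' $$ (i, l) * w l)"
      unfolding a(3)[OF i] b'[OF i] by (simp add: w_def smult_sum2 sum.distrib distrib_left)
    also have "\<dots> = (\<Sum>l<n. G i l * w' l)"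
      using i by (intro sum.cong refl) (simp add: GP' ww' mult.assoc)
    also have "\<dots> = (\<Sum>l<n. P $$ (i, l) * v l)"
      unfolding G_def v_def sum_distrib_left sum_distrib_right by (subst sum.swap) (simp add: mult.assoc)
    finally show ?thesis .
  qed
  moreover have "\<exists>k\<in>J. e k \<noteq> 0"
  proof (cases "\<alpha> = 0")
    case True
    then show ?thesis using b(1) ab(1) by (auto simp: e_def)
  next
    case False
    then show ?thesis using k0 b(2) by (intro bexI[of _ k0]) (auto simp: e_def)
  qed
  moreover have "\<forall>k. k \<notin> J \<longrightarrow> e k = 0" using a(2) b(2) by (auto simp: e_def)
  ultimately show ?case by (intro exI[of _ e] exI[of _ v]) blast
qed

text \<open>Euclid's algorithm on the entries by invertible row operations: \<open>T\<close> sends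
  \<open>v\<close> to a multiple \<open>g\<close> of the first unit vector. Hence \<open>v\<close>
  is \<open>g\<close> times the first column of \<open>T'\<close>, and that column is the primitive
  part of \<open>v\<close> when \<open>v\<close> is nonzero.\<close>

lemma unimodular_completion:
  fixes v :: "nat \<Rightarrow> complex poly"
  shows "\<exists>T T'. T \<in> carrier_mat n n \<and> T' \<in> carrier_mat n n \<and> T * T' = 1\<^sub>m n \<and> T' * T = 1\<^sub>m n \<and>
    (\<forall>i. 0 < i \<and> i < n \<longrightarrow> (\<Sum>j<n. T $$ (i, j) * v j) = 0)"
proof (induction "\<Sum>i<n. if v i = 0 then 0 else Suc (degree (v i))" arbitrary: v rule: less_induct)
  case less
  show ?case
  proof (cases "\<exists>i j. i < n \<and> j < n \<and> i \<noteq> j \<and> v i \<noteq> 0 \<and> v j \<noteq> 0")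
    case True
    then obtain i j where ij: "i < n" "j < n" "i \<noteq> j" "v i \<noteq> 0" "v j \<noteq> 0" "degree (v i) \<le> degree (v j)"
      by (metis linear)
    define d where "d = v j div v i"
    define v' where "v' = v(j := v j mod v i)"
    have v'j: "v' j = v j + (- d) * v i"
      using mult_div_mod_eq[of "v i" "v j"] by (simp add: v'_def d_def algebra_simps)
    \<comment> \<open>Zero weighs less than a nonzero constant, so a vanishing remainder also lowers
      the measure.\<close>
    let ?m = "\<lambda>p :: complex poly. if p = 0 then 0 else Suc (degree p)"
    have "(\<Sum>i<n. ?m (v' i)) < (\<Sum>i<n. ?m (v i))"
    proof (rule sum_strict_mono_ex1)
      have mj: "?m (v' j) < ?m (v j)"
        using degree_mod_less[of "v i" "v j"] ij by (auto simp: v'_def)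
      then show "\<exists>k\<in>{..<n}. ?m (v' k) < ?m (v k)" using ij(2) by blast
      show "\<forall>k\<in>{..<n}. ?m (v' k) \<le> ?m (v k)"
      proof
        fix k
        show "?m (v' k) \<le> ?m (v k)" using mj by (cases "k = j") (auto simp: v'_def)
      qed
    qed simp
    from less[OF this] obtain T T' where T: "T \<in> carrier_mat n n" "T' \<in> carrier_mat n n"
      "T * T' = 1\<^sub>m n" "T' * T = 1\<^sub>m n" "\<And>i. 0 < i \<Longrightarrow> i < n \<Longrightarrow> (\<Sum>j<n. T $$ (i, j) * v' j) = 0" by blast
    let ?E = "addrow_mat n (- d) j i" and ?E' = "addrow_mat n d j i"
    have E: "?E \<in> carrier_mat n n" "?E' \<in> carrier_mat n n" by auto
    have EE: "?E * ?E' = 1\<^sub>m n" "?E' * ?E = 1\<^sub>m n"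
      using addrow_mat_inv[of j n i d] addrow_mat_inv[of j n i "- d"] ij by auto
    have Ev: "(\<Sum>k<n. ?E $$ (l, k) * v k) = v' l" if l: "l < n" for l
    proof -
      have "(\<Sum>k<n. ?E $$ (l, k) * v k) = (\<Sum>k<n. (if k = l then v k else 0) + (if k = i then (if l = j then - d * v k else 0) else 0))"
        using l ij(3) by (intro sum.cong refl) auto
      then show ?thesis using l ij(1) v'j by (auto simp: sum.distrib v'_def)
    qed
    show ?thesis
    proof (rule exI[of _ "T * ?E"], rule exI[of _ "?E' * T'"], intro conjI allI impI)
      have "T * ?E * (?E' * T') = T * (?E * ?E') * T'" using T E by (simp add: mat_mult_assoc)
      then show "T * ?E * (?E' * T') = 1\<^sub>m n" unfolding EE using T by simp
      have "?E' * T' * (T * ?E) = ?E' * (T' * T) * ?E" using T(1,2) E by (simp add: mat_mult_assoc)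
      then show "?E' * T' * (T * ?E) = 1\<^sub>m n" unfolding T(4) using E EE by simp
      fix l assume l: "0 < l \<and> l < n"
      have "(\<Sum>k<n. (T * ?E) $$ (l, k) * v k) = (\<Sum>k<n. \<Sum>m<n. T $$ (l, m) * (?E $$ (m, k) * v k))"
        using l T(1) by (intro sum.cong refl, subst index_mult_mat_sum) (auto simp: sum_distrib_right mult.assoc)
      also have "\<dots> = (\<Sum>m<n. T $$ (l, m) * v' m)"
      proof (subst sum.swap, rule sum.cong[OF refl])
        fix m assume "m \<in> {..<n}"
        then have "T $$ (l, m) * v' m = T $$ (l, m) * (\<Sum>k<n. ?E $$ (m, k) * v k)"
          by (simp only: Ev lessThan_iff)
        then show "(\<Sum>k<n. T $$ (l, m) * (?E $$ (m, k) * v k)) = T $$ (l, m) * v' m"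
          by (simp only: sum_distrib_left)
      qed
      finally show "(\<Sum>k<n. (T * ?E) $$ (l, k) * v k) = 0" using T(5) l by simp
    qed (use T E in auto)
  next
    case False
    show ?thesis
    proof (cases "\<exists>j. 0 < j \<and> j < n \<and> v j \<noteq> 0")
      case True
      then obtain j where j: "0 < j" "j < n" "v j \<noteq> 0" by blast
      then have v0: "v k = 0" if "k < n" "k \<noteq> j" for k using False that by blast
      \<comment> \<open>Only one entry is nonzero, and position 0 is exempt from the claim.\<close>
      let ?T = "swaprows_mat n 0 j :: complex poly mat"
      have "?T * ?T = 1\<^sub>m n" using swaprows_mat_inv[of 0 n j] j by simp
      moreover have "(\<Sum>k<n. ?T $$ (i, k) * v k) = 0" if i: "0 < i" "i < n" for i
      proof (rule sum.neutral, rule ballI)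
        fix k assume k: "k \<in> {..<n}"
        then show "?T $$ (i, k) * v k = 0" using v0[of k] i j by (cases "k = j") auto
      qed
      ultimately show ?thesis by (intro exI[of _ ?T]) auto
    next
      case False
      have "(\<Sum>k<n. 1\<^sub>m n $$ (i, k) * v k) = 0" if i: "0 < i" "i < n" for i
      proof (rule sum.neutral, rule ballI)
        fix k assume k: "k \<in> {..<n}"
        then show "1\<^sub>m n $$ (i, k) * v k = 0" using False i by auto
      qed
      then show ?thesis by (intro exI[of _ "1\<^sub>m n"]) auto
    qed
  qed
qed

text \<open>Conjugated entries are evaluated at \<open>1 / cnj z\<close>, so for Laurent
  \<open>v\<close> and \<open>B\<close> the value is a Laurent polynomial, agreeing on the circle
  with the pointwise Hermitian form.\<close>

definition qform :: "nat \<Rightarrow> (complex \<Rightarrow> complex mat) \<Rightarrow> (nat \<Rightarrow> complex \<Rightarrow> complex) \<Rightarrow> complex \<Rightarrow> complex" where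
  "qform n B v z = (\<Sum>l<n. \<Sum>m<n. cnj (v l (1 / cnj z)) * B z $$ (l, m) * v m z)"

lemma qform_star:
  assumes "lhermitian n B" "z \<noteq> 0" shows "cnj (qform n B v (1 / cnj z)) = qform n B v z"
proof -
  have "cnj (qform n B v (1 / cnj z)) = (\<Sum>l<n. \<Sum>m<n. cnj (v m (1 / cnj z)) * B z $$ (m, l) * v l z)"
    unfolding qform_def cnj_sum using lhermitianD(3)[OF assms] by (intro sum.cong refl) (simp add: mult_ac)
  then show ?thesis unfolding qform_def by (subst sum.swap)
qed

lemma common_denominator:
  assumes "finite I" "\<And>i. i \<in> I \<Longrightarrow> lpoly (f i)"
  obtains N p where "\<And>i z. i \<in> I \<Longrightarrow> z \<noteq> 0 \<Longrightarrow> poly (p i) z = z ^ N * f i z"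
proof -
  have "\<forall>i\<in>I. \<exists>p k. \<forall>z. z \<noteq> 0 \<longrightarrow> f i z = poly p z / z ^ k"
    using assms(2) unfolding lpoly_def by blast
  then obtain p k where pk: "\<And>i z. i \<in> I \<Longrightarrow> z \<noteq> 0 \<Longrightarrow> f i z = poly (p i) z / z ^ k i"
    by metis
  show ?thesis
  proof (rule that[of "\<lambda>i. p i * monom 1 ((\<Sum>i\<in>I. k i) - k i)" "\<Sum>i\<in>I. k i"])
    fix i and z :: complex assume i: "i \<in> I" and z: "z \<noteq> 0"
    have "k i \<le> (\<Sum>i\<in>I. k i)" using assms(1) i by (intro member_le_sum) auto
    then have "z ^ (\<Sum>i\<in>I. k i) = z ^ k i * z ^ ((\<Sum>i\<in>I. k i) - k i)"
      by (simp flip: power_add)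
    then show "poly (p i * monom 1 ((\<Sum>i\<in>I. k i) - k i)) z = z ^ (\<Sum>i\<in>I. k i) * f i z"
      using pk[OF i z] z by (simp add: poly_monom)
  qed
qed

text \<open>Multiplication by the power \<open>degree R\<close> of the variable turns the right side
  into the reflected polynomial, whose degree is at most \<open>degree R\<close>; no degree is left
  for \<open>S\<close>.\<close>

lemma poly_eq_poly_inverse_imp_const:
  fixes R S :: "complex poly"
  assumes "\<And>z. z \<noteq> 0 \<Longrightarrow> poly S z = poly R (1 / z)"
  shows "poly S z = poly S 0"
proof -
  have "S * monom 1 (degree R) = reflect_poly R"
    by (rule poly_eq_off_0) (simp add: assms poly_monom poly_reflect_poly_nz divide_inverse mult.commute)
  then have "degree (S * monom 1 (degree R)) \<le> degree R" using degree_reflect_poly_le[of R] by simp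
  then have "degree S = 0"
    by (cases "S = 0") (auto simp: degree_mult_eq degree_monom_eq)
  then obtain c where "S = [:c:]" by (metis degree_eq_zeroE)
  then show ?thesis by simp
qed

text \<open>A nonvanishing determinant is easier to carry through congruences than a constant one;
  for Hermitian matrices it is automatically a nonzero real constant.\<close>

definition unimod :: "nat \<Rightarrow> (complex \<Rightarrow> complex mat) \<Rightarrow> bool" where
  "unimod n B \<longleftrightarrow> lhermitian n B \<and> (\<forall>z. z \<noteq> 0 \<longrightarrow> det (B z) \<noteq> 0)"

lemma unimod_det:
  assumes "unimod n B"
  obtains c :: real where "c \<noteq> 0" "\<And>z. z \<noteq> 0 \<Longrightarrow> det (B z) = of_real c"
proof -
  have B: "lhermitian n B" and nz: "\<And>z. z \<noteq> 0 \<Longrightarrow> det (B z) \<noteq> 0" using assms by (auto simp: unimod_def)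
  show ?thesis
    by (rule lpoly_selfadjoint_nonvanishing[OF lpoly_det[OF lhermitianD(1)[OF B]] nz lhermitian_det[OF B]])
      (auto intro: that)
qed

text \<open>If \<open>P = z ^ N * B\<close> has polynomial entries, its determinant is a constant
  times \<open>z ^ (N * n)\<close>, so its image has codimension at most \<open>N * n\<close>. The
  vectors of degree at most \<open>N\<close> have dimension \<open>n * (N + 1)\<close>, which is
  larger, so some nonzero one of them is \<open>P\<close> applied to a polynomial vector
  \<open>x\<close>, and \<open>B\<close> applied to \<open>x\<close> has no positive powers.\<close>

lemma constant_form_vector:
  assumes B: "unimod n B" and n: "n > 0"
  obtains v :: "nat \<Rightarrow> complex poly" and \<kappa> where "\<exists>l<n. v l \<noteq> 0"
    "\<And>z. z \<noteq> 0 \<Longrightarrow> qform n B (\<lambda>l. poly (v l)) z = \<kappa>"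
proof -
  have Bh: "lhermitian n B" using B by (simp add: unimod_def)
  note Bl = lhermitianD(1)[OF Bh]
  obtain c :: real where c: "c \<noteq> 0" "\<And>z. z \<noteq> 0 \<Longrightarrow> det (B z) = of_real c" using unimod_det[OF B] by blast
  obtain N p where p: "\<And>i z. i \<in> {..<n} \<times> {..<n} \<Longrightarrow> z \<noteq> 0 \<Longrightarrow> poly (p i) z = z ^ N * B z $$ i"
    by (rule common_denominator[of "{..<n} \<times> {..<n}" "\<lambda>i z. B z $$ i"]) (auto intro: lmat_index[OF Bl])
  define P where "P = mat n n p"
  have P: "P \<in> carrier_mat n n" by (simp add: P_def)
  have Pz: "poly (P $$ (l, m)) z = z ^ N * B z $$ (l, m)" if "l < n" "m < n" "z \<noteq> 0" for l m z
    using p[of "(l, m)" z] that by (simp add: P_def)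
  have detP: "det P = monom (of_real c) (N * n)"
  proof (rule poly_eq_off_0)
    fix z :: complex assume z: "z \<noteq> 0"
    have "map_mat (\<lambda>p. poly p z) P = z ^ N \<cdot>\<^sub>m B z"
      using lmat_dim[OF Bl] P by (intro eq_matI) (auto simp: Pz z)
    then show "poly (det P) z = poly (monom (of_real c) (N * n)) z"
      unfolding poly_det[OF P] using lmat_dim[OF Bl] c(2)[OF z]
      by (simp add: poly_monom power_mult)
  qed
  \<comment> \<open>For an index \<open>(l, d)\<close> this is the vector with \<open>z ^ d\<close>
    at position \<open>l\<close>; together they form a basis of the vectors of degree at most
    \<open>N\<close>.\<close>
  define y where "y k l = (if l = fst k then monom 1 (snd k) else 0 :: complex poly)" for k :: "nat \<times> nat" and l
  let ?J = "{..<n} \<times> {..N}"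
  have "card ?J > N * n" using n by simp
  then obtain a x where a: "\<exists>k\<in>?J. a k \<noteq> 0"
    and ax: "\<And>l. l < n \<Longrightarrow> (\<Sum>k\<in>?J. Polynomial.smult (a k) (y k l)) = (\<Sum>m<n. P $$ (l, m) * x m)"
    using combination_in_image[OF P detP _ _, of ?J y] c(1) by auto
  define q where "q l = (\<Sum>d\<le>N. monom (a (l, d)) d)" for l
  have qx: "q l = (\<Sum>m<n. P $$ (l, m) * x m)" if l: "l < n" for l
  proof -
    have "(\<Sum>k\<in>?J. Polynomial.smult (a k) (y k l)) = (\<Sum>i<n. \<Sum>d\<le>N. Polynomial.smult (a (i, d)) (y (i, d) l))"
      by (simp add: sum.cartesian_product)
    also have "\<dots> = (\<Sum>i<n. if i = l then q l else 0)"
      by (intro sum.cong refl) (auto simp: y_def q_def smult_monom intro!: sum.cong)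
    finally show ?thesis using ax[OF l] l by simp
  qed
  have xn: "\<exists>l<n. x l \<noteq> 0"
  proof (rule ccontr)
    assume "\<not> ?thesis"
    then have q0: "q l = 0" if "l < n" for l using qx[OF that] by simp
    obtain l d where ld: "l < n" "d \<le> N" "a (l, d) \<noteq> 0" using a by auto
    have "coeff (q l) d = (\<Sum>e\<le>N. if e = d then a (l, e) else 0)"
      unfolding q_def coeff_sum by (intro sum.cong refl) auto
    then show False using ld q0[OF ld(1)] by simp
  qed
  \<comment> \<open>\<open>q\<close> with its exponents reversed, so that dividing \<open>q\<close>
    by \<open>z ^ N\<close> gives \<open>r\<close> at \<open>1 / z\<close>.\<close>
  define r where "r l = (\<Sum>d\<le>N. monom (a (l, d)) (N - d))" for l
  define R where "R = (\<Sum>l<n. map_poly cnj (x l) * r l)"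
  have rz: "(\<Sum>m<n. B z $$ (l, m) * poly (x m) z) = poly (r l) (1 / z)" if l: "l < n" and z: "z \<noteq> 0" for l z
  proof -
    have "z ^ N * (\<Sum>m<n. B z $$ (l, m) * poly (x m) z) = poly (q l) z"
      unfolding qx[OF l] sum_distrib_left poly_sum using l z by (intro sum.cong refl) (simp add: Pz mult.assoc)
    also have "\<dots> = z ^ N * poly (r l) (1 / z)"
      unfolding q_def r_def poly_sum sum_distrib_left
    proof (intro sum.cong refl)
      fix d assume "d \<in> {..N}"
      then have "z ^ N = z ^ d * z ^ (N - d)" by (simp flip: power_add)
      then show "poly (monom (a (l, d)) d) z = z ^ N * poly (monom (a (l, d)) (N - d)) (1 / z)"
        using z by (simp add: poly_monom power_one_over)
    qed
    finally show ?thesis using z by simp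
  qed
  have fR: "qform n B (\<lambda>l. poly (x l)) z = poly R (1 / z)" if z: "z \<noteq> 0" for z
  proof -
    have "qform n B (\<lambda>l. poly (x l)) z = (\<Sum>l<n. cnj (poly (x l) (1 / cnj z)) * (\<Sum>m<n. B z $$ (l, m) * poly (x m) z))"
      unfolding qform_def sum_distrib_left by (simp only: mult.assoc)
    also have "\<dots> = (\<Sum>l<n. poly (map_poly cnj (x l)) (1 / z) * poly (r l) (1 / z))"
    proof (intro sum.cong refl)
      fix l assume "l \<in> {..<n}"
      then show "cnj (poly (x l) (1 / cnj z)) * (\<Sum>m<n. B z $$ (l, m) * poly (x m) z)
          = poly (map_poly cnj (x l)) (1 / z) * poly (r l) (1 / z)"
        using rz[OF _ z, of l] unfolding poly_cnj by simp
    qed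
    finally show ?thesis by (simp add: R_def poly_sum)
  qed
  \<comment> \<open>The form is a polynomial in \<open>1 / z\<close>, so its star is a polynomial in
    \<open>z\<close>; self-adjointness equates the two.\<close>
  have S: "poly (map_poly cnj R) z = poly R (1 / z)" if z: "z \<noteq> 0" for z
  proof -
    have "cnj (poly R (cnj z)) = poly R (1 / z)"
      using qform_star[OF Bh z, of "\<lambda>l. poly (x l)"] fR[OF z] fR[of "1 / cnj z"] z by simp
    then show ?thesis by (simp only: poly_cnj complex_cnj_cnj)
  qed
  show ?thesis
  proof (rule that[OF xn, of "poly (map_poly cnj R) 0"])
    fix z :: complex assume z: "z \<noteq> 0"
    then show "qform n B (\<lambda>l. poly (x l)) z = poly (map_poly cnj R) 0"
      using fR[OF z] S[OF z] poly_eq_poly_inverse_imp_const[OF S, of z] by simp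
  qed
qed

section \<open>Making the corner entry constant and splitting it off\<close>

lemma map_mat_poly_mult:
  fixes A B :: "complex poly mat"
  assumes "A \<in> carrier_mat n n" "B \<in> carrier_mat n n"
  shows "map_mat (\<lambda>p. poly p z) (A * B) = map_mat (\<lambda>p. poly p z) A * map_mat (\<lambda>p. poly p z) B"
proof (rule eq_matI)
  fix i j assume "i < dim_row (map_mat (\<lambda>p. poly p z) A * map_mat (\<lambda>p. poly p z) B)"
    "j < dim_col (map_mat (\<lambda>p. poly p z) A * map_mat (\<lambda>p. poly p z) B)"
  then have ij: "i < n" "j < n" using assms by auto
  have "map_mat (\<lambda>p. poly p z) (A * B) $$ (i, j) = poly ((A * B) $$ (i, j)) z" using ij assms by simp
  also have "(A * B) $$ (i, j) = (\<Sum>k<n. A $$ (i, k) * B $$ (k, j))"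
    using ij assms by (subst index_mult_mat_sum) auto
  also have "poly \<dots> z = (map_mat (\<lambda>p. poly p z) A * map_mat (\<lambda>p. poly p z) B) $$ (i, j)"
    using ij assms by (subst index_mult_mat_sum) (auto simp: poly_sum)
  finally show "map_mat (\<lambda>p. poly p z) (A * B) $$ (i, j) = (map_mat (\<lambda>p. poly p z) A * map_mat (\<lambda>p. poly p z) B) $$ (i, j)" .
qed (use assms in auto)

lemma lmat_map_mat_poly: "A \<in> carrier_mat n n \<Longrightarrow> lmat n (\<lambda>z. map_mat (\<lambda>p. poly p z) A)"
  by (auto simp: lmat_def lpoly_poly)

lemma poly_nonzero_point:
  assumes "g \<noteq> (0 :: complex poly)" obtains w where "w \<noteq> 0" "poly g w \<noteq> 0"
  using poly_eq_0_off_0 assms by blast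

text \<open>The vector \<open>v\<close> is \<open>g\<close> times the first column of
  \<open>T'\<close>, so the new corner entry multiplied by \<open>g\<close> and its star equals
  \<open>\<kappa>\<close>. If this is nonzero, the corner entry never vanishes and is a real
  constant by self-adjointness; if it is 0, the corner entry is 0 because \<open>g\<close> is
  not.\<close>

lemma unimod_normalize:
  fixes v :: "nat \<Rightarrow> complex poly"
  assumes B: "unimod n B" and n: "n > 0" and v: "\<exists>l<n. v l \<noteq> 0"
    and form: "\<And>z. z \<noteq> 0 \<Longrightarrow> qform n B (\<lambda>l. poly (v l)) z = \<kappa>"
  obtains B' and c :: real where "unimod n B'" "lcong n B B'" "\<And>z. z \<noteq> 0 \<Longrightarrow> B' z $$ (0, 0) = of_real c"
    "\<kappa> \<noteq> 0 \<Longrightarrow> c \<noteq> 0"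
proof -
  have Bh: "lhermitian n B" using B by (simp add: unimod_def)
  note Bl = lhermitianD(1)[OF Bh]
  obtain T T' where T: "T \<in> carrier_mat n n" "T' \<in> carrier_mat n n" "T * T' = 1\<^sub>m n" "T' * T = 1\<^sub>m n"
    and Tv: "\<And>i. 0 < i \<Longrightarrow> i < n \<Longrightarrow> (\<Sum>j<n. T $$ (i, j) * v j) = 0"
    using unimodular_completion[of n v] by blast
  define g where "g = (\<Sum>j<n. T $$ (0, j) * v j)"
  have vg: "v m = T' $$ (m, 0) * g" if m: "m < n" for m
  proof -
    have "v m = (\<Sum>j<n. (T' * T) $$ (m, j) * v j)"
      unfolding T(4) using m by (simp add: if_distrib[of "\<lambda>x. x * _"] cong: if_cong)
    also have "\<dots> = (\<Sum>j<n. \<Sum>k<n. T' $$ (m, k) * (T $$ (k, j) * v j))"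
      using m T(1,2) by (intro sum.cong refl, subst index_mult_mat_sum) (auto simp: sum_distrib_right mult.assoc)
    also have "\<dots> = (\<Sum>k<n. T' $$ (m, k) * (\<Sum>j<n. T $$ (k, j) * v j))"
      unfolding sum_distrib_left by (rule sum.swap)
    also have "\<dots> = (\<Sum>k<n. if k = 0 then T' $$ (m, 0) * g else 0)"
      using Tv by (intro sum.cong refl) (auto simp: g_def)
    finally show ?thesis using n by simp
  qed
  have g0: "g \<noteq> 0" using v vg by auto
  define V where "V z = map_mat (\<lambda>p. poly p z) T" for z
  define V' where "V' z = map_mat (\<lambda>p. poly p z) T'" for z
  have Vl: "lmat n V" "lmat n V'" unfolding V_def V'_def using T by (auto intro: lmat_map_mat_poly)
  have VV: "V' z * V z = 1\<^sub>m n" for z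
    unfolding V_def V'_def using T by (simp flip: map_mat_poly_mult) (auto intro!: eq_matI)
  define B' where "B' z = fstar V' z * B z * V' z" for z
  have B'h: "lhermitian n B'" unfolding B'_def by (rule lhermitian_congruence[OF Bh Vl(2)])
  note B'l = lhermitianD(1)[OF B'h]
  note dims = lmat_dim[OF Bl] lmat_dim[OF B'l] lmat_dim[OF Vl(1)] lmat_dim[OF Vl(2)]
  have BB': "B z = fstar V z * B' z * V z" if z: "z \<noteq> 0" for z
  proof -
    have "fstar V z * B' z * V z = cadjoint (V' (1 / cnj z) * V (1 / cnj z)) * B z * (V' z * V z)"
      unfolding B'_def fstar_def using dims by (simp add: cadjoint_mult mat_mult_assoc)
    then show ?thesis unfolding VV using lmat_carrier[OF Bl, of z] by simp
  qed
  have cong: "lcong n B B'" unfolding lcong_def using Vl(1) BB' by blast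
  have un: "unimod n B'" unfolding unimod_def
  proof (intro conjI allI impI B'h)
    fix z :: complex assume z: "z \<noteq> 0"
    have "det (B z) = det (fstar V z) * det (B' z) * det (V z)"
      unfolding BB'[OF z] using lmat_carrier[OF B'l, of z] lmat_carrier[OF Vl(1), of z] lmat_carrier[OF lmat_fstar[OF Vl(1)], of z]
      by (simp add: det_mult[of _ n])
    moreover have "det (B z) \<noteq> 0" using B z by (simp add: unimod_def)
    ultimately show "det (B' z) \<noteq> 0" by auto
  qed
  define gs where "gs z = cnj (poly g (1 / cnj z))" for z
  have gsl: "lpoly gs" unfolding gs_def by (rule lpoly_star[OF lpoly_poly])
  have B'00: "gs z * B' z $$ (0, 0) * poly g z = \<kappa>" if z: "z \<noteq> 0" for z
  proof -
    have "\<kappa> = (\<Sum>l<n. \<Sum>m<n. gs z * (cnj (V' (1 / cnj z) $$ (l, 0)) * B z $$ (l, m) * V' z $$ (m, 0)) * poly g z)"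
      unfolding form[OF z, symmetric] qform_def using n T(2)
      by (intro sum.cong refl) (simp add: vg V'_def gs_def mult_ac)
    also have "\<dots> = gs z * (\<Sum>l<n. \<Sum>m<n. cnj (V' (1 / cnj z) $$ (l, 0)) * B z $$ (l, m) * V' z $$ (m, 0)) * poly g z"
      by (simp only: sum_distrib_left sum_distrib_right)
    also have "(\<Sum>l<n. \<Sum>m<n. cnj (V' (1 / cnj z) $$ (l, 0)) * B z $$ (l, m) * V' z $$ (m, 0)) = B' z $$ (0, 0)"
      unfolding B'_def fstar_def
      by (rule index_sandwich_mat[symmetric, OF lmat_carrier[OF Vl(2)] lmat_carrier[OF Vl(2)] lmat_carrier[OF Bl] n n])
    finally show ?thesis by simp
  qed
  have B'00l: "lpoly (\<lambda>z. B' z $$ (0, 0))" by (rule lmat_index[OF B'l n n])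
  show ?thesis
  proof (cases "\<kappa> = 0")
    case True
    obtain w where w: "w \<noteq> 0" "poly g w \<noteq> 0" using poly_nonzero_point[OF g0] by blast
    \<comment> \<open>\<open>g\<close> and then its star are cancelled; they are nonzero at
      \<open>w\<close> and at \<open>1 / cnj w\<close> respectively.\<close>
    have "gs z * B' z $$ (0, 0) = 0" if "z \<noteq> 0" for z
      by (rule lpoly_zero_divisor[of "\<lambda>z. gs z * B' z $$ (0, 0)" "poly g" w])
        (use B'00 True w that in \<open>auto intro: lpoly_mult gsl B'00l lpoly_poly\<close>)
    then have "B' z $$ (0, 0) = 0" if "z \<noteq> 0" for z
      by (intro lpoly_zero_divisor[of "\<lambda>z. B' z $$ (0, 0)" gs "1 / cnj w"])
        (use w that in \<open>auto intro: gsl B'00l simp: gs_def mult.commute\<close>)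
    then show ?thesis by (intro that[OF un cong, of 0]) (use True in auto)
  next
    case False
    then have "B' z $$ (0, 0) \<noteq> 0" if "z \<noteq> 0" for z using B'00[OF that] by auto
    then obtain c :: real where "c \<noteq> 0" "\<And>z. z \<noteq> 0 \<Longrightarrow> B' z $$ (0, 0) = of_real c"
      using lpoly_selfadjoint_nonvanishing[OF B'00l] lhermitianD(3)[OF B'h _ n n] by blast
    then show ?thesis by (intro that[OF un cong]) auto
  qed
qed

lemma lmat_adj_mat: assumes "lmat n F" shows "lmat n (\<lambda>z. adj_mat (F z))"
proof -
  have l: "lpoly (\<lambda>z. det (mat_delete (F z) i j))" if "i < n" "j < n" for i j
  proof (rule lpoly_det[of "n - 1"])
    show "lmat (n - 1) (\<lambda>z. mat_delete (F z) i j)"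
      using lmat_dim[OF assms] lmat_index[OF assms] that
      by (auto simp: lmat_def mat_delete_def)
  qed
  show ?thesis unfolding lmat_def
  proof (intro conjI allI impI)
    fix z show "adj_mat (F z) \<in> carrier_mat n n" using adj_mat(1)[OF lmat_carrier[OF assms]] .
  next
    fix i j assume "i < n" "j < n"
    then show "lpoly (\<lambda>z. adj_mat (F z) $$ (i, j))"
      using lmat_dim[OF assms] l[of j i] by (auto simp: adj_mat_def cofactor_def intro: lpoly_mult lpoly_const)
  qed
qed

text \<open>The column \<open>M\<close> of the inverse satisfies \<open>B M = e\<^sub>0\<close>.  Since \<open>e\<^sub>0\<close> is isotropic, \<open>M + t e\<^sub>0\<close> has norm
  \<open>M\<^sub>0 + t + t\<^sup>*\<close>, and \<open>M\<^sub>0\<close> is self-adjoint, so \<open>t = (1 - M\<^sub>0) / 2\<close> gives norm \<open>1\<close>.\<close>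

lemma unit_norm_vector:
  assumes B: "unimod n B" and n: "n > 0" and B00: "\<And>z. z \<noteq> 0 \<Longrightarrow> B z $$ (0, 0) = 0"
  obtains v :: "nat \<Rightarrow> complex poly" where "\<exists>l<n. v l \<noteq> 0"
    "\<And>z. z \<noteq> 0 \<Longrightarrow> qform n B (\<lambda>l. poly (v l)) z = 1"
proof -
  have Bh: "lhermitian n B" using B by (simp add: unimod_def)
  note Bl = lhermitianD(1)[OF Bh]
  obtain c :: real where c: "c \<noteq> 0" "\<And>z. z \<noteq> 0 \<Longrightarrow> det (B z) = of_real c" using unimod_det[OF B] by blast
  define M where "M i z = (1 / of_real c) * adj_mat (B z) $$ (i, 0)" for i z
  have Ml: "lpoly (M i)" if "i < n" for i
    unfolding M_def using lmat_index[OF lmat_adj_mat[OF Bl] that n] by (intro lpoly_mult lpoly_const)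
  have BM: "(\<Sum>m<n. B z $$ (l, m) * M m z) = (if l = 0 then 1 else 0)" if l: "l < n" and z: "z \<noteq> 0" for l z
  proof -
    have "(\<Sum>m<n. B z $$ (l, m) * M m z) = (1 / of_real c) * (\<Sum>m<n. B z $$ (l, m) * adj_mat (B z) $$ (m, 0))"
      unfolding M_def sum_distrib_left by (intro sum.cong refl) (simp add: mult_ac)
    also have "(\<Sum>m<n. B z $$ (l, m) * adj_mat (B z) $$ (m, 0)) = (B z * adj_mat (B z)) $$ (l, 0)"
      using l n adj_mat(1)[OF lmat_carrier[OF Bl, of z]] lmat_dim[OF Bl]
      by (subst index_mult_mat_sum) auto
    finally show ?thesis unfolding adj_mat(2)[OF lmat_carrier[OF Bl]] c(2)[OF z] using l n c(1) by simp
  qed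
  define w where "w t i z = M i z + (if i = 0 then t z else 0)" for t :: "complex \<Rightarrow> complex" and i :: nat and z
  have Bw: "(\<Sum>m<n. B z $$ (l, m) * w t m z) = (if l = 0 then 1 else 0) + B z $$ (l, 0) * t z"
    if l: "l < n" and z: "z \<noteq> 0" for l z t
  proof -
    have "(\<Sum>m<n. B z $$ (l, m) * w t m z) = (\<Sum>m<n. B z $$ (l, m) * M m z + (if m = 0 then B z $$ (l, 0) * t z else 0))"
      by (intro sum.cong refl) (auto simp: w_def distrib_left)
    then show ?thesis using BM[OF l z] n by (simp add: sum.distrib)
  qed
  have fw: "qform n B (w t) z = cnj (M 0 (1 / cnj z)) + cnj (t (1 / cnj z)) + t z" if z: "z \<noteq> 0" for z t
  proof -
    have z': "1 / cnj z \<noteq> 0" using z by simp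
    have "qform n B (w t) z = (\<Sum>l<n. cnj (w t l (1 / cnj z)) * (\<Sum>m<n. B z $$ (l, m) * w t m z))"
      unfolding qform_def sum_distrib_left by (simp only: mult.assoc)
    also have "\<dots> = (\<Sum>l<n. (if l = 0 then cnj (w t 0 (1 / cnj z)) else 0) + t z * cnj (B (1 / cnj z) $$ (0, l) * w t l (1 / cnj z)))"
    proof (intro sum.cong refl)
      fix l assume "l \<in> {..<n}"
      then have l: "l < n" by simp
      show "cnj (w t l (1 / cnj z)) * (\<Sum>m<n. B z $$ (l, m) * w t m z) =
        (if l = 0 then cnj (w t 0 (1 / cnj z)) else 0) + t z * cnj (B (1 / cnj z) $$ (0, l) * w t l (1 / cnj z))"
        unfolding Bw[OF l z] complex_cnj_mult lhermitianD(3)[OF Bh z n l] by (simp add: algebra_simps)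
    qed
    also have "\<dots> = cnj (w t 0 (1 / cnj z)) + t z * cnj (\<Sum>l<n. B (1 / cnj z) $$ (0, l) * w t l (1 / cnj z))"
      using n by (simp add: sum.distrib sum_distrib_left)
    also have "(\<Sum>l<n. B (1 / cnj z) $$ (0, l) * w t l (1 / cnj z)) = 1"
      unfolding Bw[OF n z'] B00[OF z'] by simp
    also have "cnj (w t 0 (1 / cnj z)) = cnj (M 0 (1 / cnj z)) + cnj (t (1 / cnj z))" by (simp add: w_def)
    finally show ?thesis by simp
  qed
  \<comment> \<open>For \<open>t = 0\<close> the form of \<open>M\<close> is the star of
    \<open>M 0\<close>, and every value of \<open>qform\<close> is self-adjoint.\<close>
  have Ms: "cnj (M 0 (1 / cnj z)) = M 0 z" if z: "z \<noteq> 0" for z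
    using qform_star[OF Bh z, of "w (\<lambda>_. 0)"] fw[OF z, of "\<lambda>_. 0"] fw[of "1 / cnj z" "\<lambda>_. 0"] z by simp
  define t where "t z = (1 - M 0 z) / 2" for z
  have f1: "qform n B (w t) z = 1" if z: "z \<noteq> 0" for z
    unfolding fw[OF z] using Ms[OF z] by (simp add: t_def field_simps)
  have wl: "lpoly (w t i)" if "i < n" for i
    unfolding w_def t_def divide_inverse by (intro lpoly_if lpoly_intros lpoly_add Ml that n)
  obtain N p where p: "\<And>i z. i \<in> {..<n} \<Longrightarrow> z \<noteq> 0 \<Longrightarrow> poly (p i) z = z ^ N * w t i z"
    by (rule common_denominator[of "{..<n}" "w t"]) (use wl in auto)
  have fp: "qform n B (\<lambda>l. poly (p l)) z = 1" if z: "z \<noteq> 0" for z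
  proof -
    \<comment> \<open>Clearing denominators does not change the form, since \<open>z ^ N\<close>
      times its star is 1.\<close>
    have "qform n B (\<lambda>l. poly (p l)) z = qform n B (w t) z"
      unfolding qform_def using z by (intro sum.cong refl) (simp add: p power_one_over)
    then show ?thesis using f1[OF z] by simp
  qed
  moreover have "\<exists>l<n. p l \<noteq> 0"
  proof (rule ccontr)
    assume "\<not> ?thesis"
    then have "qform n B (\<lambda>l. poly (p l)) 1 = 0" unfolding qform_def by (intro sum.neutral ballI) auto
    then show False using fp[of 1] by simp
  qed
  ultimately show ?thesis by (intro that)
qed

text \<open>If the first normalization yields 0, the first unit vector is isotropic. Then a vector
  of norm 1 exists, and a second normalization with it gives a nonzero constant.\<close>

lemma unimod_normalize_nonzero:
  assumes B: "unimod n B" and n: "n > 0"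
  obtains B' and c :: real where "unimod n B'" "lcong n B B'" "\<And>z. z \<noteq> 0 \<Longrightarrow> B' z $$ (0, 0) = of_real c" "c \<noteq> 0"
proof -
  obtain v :: "nat \<Rightarrow> complex poly" and \<kappa> where v: "\<exists>l<n. v l \<noteq> 0"
    "\<And>z. z \<noteq> 0 \<Longrightarrow> qform n B (\<lambda>l. poly (v l)) z = \<kappa>"
    by (rule constant_form_vector[OF B n]) (rule that)
  obtain B1 and c1 :: real where B1: "unimod n B1" "lcong n B B1" "\<And>z. z \<noteq> 0 \<Longrightarrow> B1 z $$ (0, 0) = of_real c1"
    using unimod_normalize[OF B n v(1), of \<kappa>] v(2) by metis
  show ?thesis
  proof (cases "c1 = 0")
    case False
    then show ?thesis using that B1 by blast
  next
    case True
    then have "B1 z $$ (0, 0) = 0" if "z \<noteq> 0" for z using B1(3)[OF that] by simp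
    then obtain u :: "nat \<Rightarrow> complex poly" where u: "\<exists>l<n. u l \<noteq> 0"
      "\<And>z. z \<noteq> 0 \<Longrightarrow> qform n B1 (\<lambda>l. poly (u l)) z = 1"
      using unit_norm_vector[OF B1(1) n] by metis
    obtain B2 and c2 :: real where B2: "unimod n B2" "lcong n B1 B2" "\<And>z. z \<noteq> 0 \<Longrightarrow> B2 z $$ (0, 0) = of_real c2"
      "c2 \<noteq> 0"
      using unimod_normalize[OF B1(1) n u(1), of 1] u(2) by (metis zero_neq_one)
    have "lmat n B2" using B2(1) lhermitianD(1) by (simp add: unimod_def)
    then show ?thesis using that[OF B2(1) _ B2(3,4)] lcong_trans[OF B1(2) B2(2)] by blast
  qed
qed

text \<open>The complement stays Laurent because only the constant \<open>c\<close> is divided by. A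
  kernel vector of \<open>S z\<close> extends to one of \<open>B z\<close> by choosing the first
  coordinate so that row 0 is annihilated, so no zero of the determinant can arise.\<close>

lemma unimod_schur_complement:
  assumes B: "unimod (Suc n) B" and c: "c \<noteq> 0" and B00: "\<And>z. z \<noteq> 0 \<Longrightarrow> B z $$ (0, 0) = of_real c"
  defines "S \<equiv> \<lambda>z. mat n n (\<lambda>(i, j). B z $$ (Suc i, Suc j) - B z $$ (Suc i, 0) * B z $$ (0, Suc j) / of_real c)"
  shows "unimod n S"
proof -
  have Bh: "lhermitian (Suc n) B" using B by (simp add: unimod_def)
  note Bl = lhermitianD(1)[OF Bh]
  have Sl: "lmat n S"
    unfolding S_def divide_inverse by (intro lmat_matI lpoly_diff lpoly_mult lpoly_const lmat_index[OF Bl]) auto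
  have "lhermitian n S"
    using lhermitianD(3)[OF Bh] by (intro lhermitianI[OF Sl]) (simp add: S_def)
  moreover have "det (S z) \<noteq> 0" if z: "z \<noteq> 0" for z
  proof
    assume "det (S z) = 0"
    then obtain u where u: "u \<in> carrier_vec n" "u \<noteq> 0\<^sub>v n" "S z *\<^sub>v u = 0\<^sub>v n"
      using det_0_iff_vec_prod_zero[OF lmat_carrier[OF Sl]] by blast
    define s where "s = (\<Sum>j<n. B z $$ (0, Suc j) * u $ j)"
    define w where "w = vec (Suc n) (\<lambda>i. case i of 0 \<Rightarrow> - s / of_real c | Suc i \<Rightarrow> u $ i)"
    have w: "w \<in> carrier_vec (Suc n)" by (simp add: w_def)
    have Bw: "(B z *\<^sub>v w) $ i = B z $$ (i, 0) * (- s / of_real c) + (\<Sum>j<n. B z $$ (i, Suc j) * u $ j)"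
      if "i < Suc n" for i
    proof -
      have "(B z *\<^sub>v w) $ i = (\<Sum>j<Suc n. B z $$ (i, j) * w $ j)"
        using that w lmat_dim[OF Bl] by (simp add: scalar_prod_def atLeast0LessThan del: sum.lessThan_Suc)
      also have "\<dots> = B z $$ (i, 0) * w $ 0 + (\<Sum>j<n. B z $$ (i, Suc j) * w $ Suc j)"
        by (rule sum.lessThan_Suc_shift)
      finally show ?thesis by (simp add: w_def)
    qed
    have "B z *\<^sub>v w = 0\<^sub>v (Suc n)"
    proof (rule eq_vecI)
      fix i assume "i < dim_vec (0\<^sub>v (Suc n))"
      then have i: "i < Suc n" by simp
      show "(B z *\<^sub>v w) $ i = 0\<^sub>v (Suc n) $ i"
      proof (cases i)
        case 0
        then show ?thesis using Bw[OF i] i c B00[OF z] by (simp add: s_def[symmetric])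
      next
        case (Suc k)
        then have k: "k < n" using i by simp
        have "0 = (S z *\<^sub>v u) $ k" using u(3) k by simp
        also have "\<dots> = (\<Sum>j<n. (B z $$ (i, Suc j) - B z $$ (i, 0) * B z $$ (0, Suc j) / of_real c) * u $ j)"
          using k u(1) Suc by (simp add: S_def scalar_prod_def atLeast0LessThan)
        also have "\<dots> = (\<Sum>j<n. B z $$ (i, Suc j) * u $ j) - B z $$ (i, 0) / of_real c * s"
          unfolding s_def sum_distrib_left sum_subtractf[symmetric] by (intro sum.cong refl) (simp add: algebra_simps)
        finally show ?thesis using Bw[OF i] i by simp
      qed
    qed (use lmat_dim[OF Bl] in auto)
    moreover have "w \<noteq> 0\<^sub>v (Suc n)"
    proof
      assume w0: "w = 0\<^sub>v (Suc n)"
      have "u $ i = 0" if "i < n" for i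
        using arg_cong[OF w0, of "\<lambda>w. w $ Suc i"] that by (simp add: w_def)
      then show False using u(1,2) by (metis carrier_vecD eq_vecI index_zero_vec)
    qed
    ultimately have "det (B z) = 0" using det_0_iff_vec_prod_zero[OF lmat_carrier[OF Bl]] w by blast
    then show False using B z by (simp add: unimod_def)
  qed
  ultimately show ?thesis by (simp add: unimod_def)
qed

lemma index_fstar_diag:
  assumes "lmat n W" "i < n" "j < n"
  shows "(fstar W z * mat_diag n d * W z) $$ (i, j) = (\<Sum>k<n. cnj (W (1 / cnj z) $$ (k, i)) * d k * W z $$ (k, j))"
proof -
  have c: "fstar W z \<in> carrier_mat n n" by (rule lmat_carrier[OF lmat_fstar[OF assms(1)]])
  show ?thesis
    unfolding mat_diag_mult_right[OF c] using assms lmat_dim[OF assms(1)]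
    by (subst index_mult_mat_sum) (auto simp: fstar_index intro!: sum.cong)
qed

text \<open>Completing the square: the constant corner entry splits off the product of the first
  column and the first row, and the Schur complement is diagonalized by induction.\<close>

lemma unimod_diagonalize:
  assumes "unimod n B"
  shows "\<exists>W (s :: nat \<Rightarrow> real). lmat n W \<and> (\<forall>i. s i = 1 \<or> s i = -1) \<and>
    (\<forall>z. z \<noteq> 0 \<longrightarrow> B z = fstar W z * mat_diag n (\<lambda>i. of_real (s i)) * W z)"
  using assms
proof (induction n arbitrary: B)
  case 0
  have Bl: "lmat 0 B" using 0 lhermitianD(1) by (simp add: unimod_def)
  have "B z = fstar B z * mat_diag 0 (\<lambda>i. of_real 1) * B z" for z
    using lmat_dim[OF Bl] lmat_dim[OF lmat_fstar[OF Bl]] by (intro eq_matI) auto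
  then show ?case using Bl by (intro exI[of _ B] exI[of _ "\<lambda>_. 1"]) auto
next
  case (Suc n)
  obtain B' and c :: real where B': "unimod (Suc n) B'" "lcong (Suc n) B B'"
    and c: "\<And>z. z \<noteq> 0 \<Longrightarrow> B' z $$ (0, 0) = of_real c" "c \<noteq> 0"
    using unimod_normalize_nonzero[OF Suc.prems] by (metis zero_less_Suc)
  have Bh: "lhermitian (Suc n) B'" using B' by (simp add: unimod_def)
  note Bl = lhermitianD(1)[OF Bh]
  define S where "S z = mat n n (\<lambda>(i, j). B' z $$ (Suc i, Suc j) - B' z $$ (Suc i, 0) * B' z $$ (0, Suc j) / of_real c)" for z
  have "unimod n S" unfolding S_def[abs_def] by (rule unimod_schur_complement[OF B'(1) c(2,1)])
  then obtain W s where W: "lmat n W" "\<And>i. s i = 1 \<or> s i = (-1::real)"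
    "\<And>z. z \<noteq> 0 \<Longrightarrow> S z = fstar W z * mat_diag n (\<lambda>i. of_real (s i)) * W z" using Suc.IH by blast
  \<comment> \<open>Chosen so that \<open>r * sgn c * r = 1 / c\<close>: with \<open>r\<close> times
    row 0 of \<open>B'\<close> as row 0 of \<open>V\<close>, the sign \<open>sgn c\<close>
    contributes exactly the rank-one part.\<close>
  define r where "r = sqrt \<bar>c\<bar> / c"
  define s' where "s' i = (case i of 0 \<Rightarrow> sgn c | Suc i \<Rightarrow> s i)" for i
  define w where "w i j z = (case i of 0 \<Rightarrow> of_real r * B' z $$ (0, j)
    | Suc i \<Rightarrow> (case j of 0 \<Rightarrow> 0 | Suc j \<Rightarrow> W z $$ (i, j)))" for i j z
  define V where "V z = mat (Suc n) (Suc n) (\<lambda>(i, j). w i j z)" for z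
  have Vl: "lmat (Suc n) V" unfolding V_def
  proof (rule lmat_matI)
    fix i j assume "i < Suc n" "j < Suc n"
    then show "lpoly (w i j)" unfolding w_def
      by (cases i; cases j) (auto intro: lpoly_mult lpoly_const lmat_index[OF Bl] lmat_index[OF W(1)])
  qed
  have rr: "of_real r * of_real (sgn c) * of_real r = (1 / of_real c :: complex)"
  proof -
    have "r * sgn c * r = 1 / c" using c(2) by (cases "c > 0") (auto simp: r_def field_simps)
    then show ?thesis by (metis of_real_1 of_real_divide of_real_mult)
  qed
  have BV: "B' z = fstar V z * mat_diag (Suc n) (\<lambda>i. of_real (s' i)) * V z" if z: "z \<noteq> 0" for z
  proof (rule eq_matI)
    fix i j assume "i < dim_row (fstar V z * mat_diag (Suc n) (\<lambda>i. of_real (s' i)) * V z)"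
      "j < dim_col (fstar V z * mat_diag (Suc n) (\<lambda>i. of_real (s' i)) * V z)"
    then have ij: "i < Suc n" "j < Suc n" using lmat_dim[OF Vl] lmat_dim[OF lmat_fstar[OF Vl]] by auto
    have "(fstar V z * mat_diag (Suc n) (\<lambda>i. of_real (s' i)) * V z) $$ (i, j)
      = (\<Sum>k<Suc n. cnj (w k i (1 / cnj z)) * of_real (s' k) * w k j z)"
      unfolding index_fstar_diag[OF Vl ij] using ij by (intro sum.cong refl) (auto simp: V_def)
    also have "\<dots> = cnj (w 0 i (1 / cnj z)) * of_real (s' 0) * w 0 j z
        + (\<Sum>k<n. cnj (w (Suc k) i (1 / cnj z)) * of_real (s' (Suc k)) * w (Suc k) j z)"
      by (rule sum.lessThan_Suc_shift)
    also have "cnj (w 0 i (1 / cnj z)) * of_real (s' 0) * w 0 j z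
        = (of_real r * of_real (sgn c) * of_real r) * (B' z $$ (i, 0) * B' z $$ (0, j))"
      using lhermitianD(3)[OF Bh z _ ij(1), of 0] by (simp add: w_def s'_def)
    also have "\<dots> = B' z $$ (i, 0) * B' z $$ (0, j) / of_real c" unfolding rr by simp
    also have "(\<Sum>k<n. cnj (w (Suc k) i (1 / cnj z)) * of_real (s' (Suc k)) * w (Suc k) j z)
        = (if i = 0 \<or> j = 0 then 0 else S z $$ (i - 1, j - 1))"
    proof (cases "i = 0 \<or> j = 0")
      case True
      then show ?thesis by (auto simp: w_def)
    next
      case False
      then obtain i' j' where i'j': "i = Suc i'" "j = Suc j'" by (metis not0_implies_Suc)
      then show ?thesis using ij
        by (simp add: w_def s'_def W(3)[OF z] index_fstar_diag[OF W(1)])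
    qed
    finally have *: "(fstar V z * mat_diag (Suc n) (\<lambda>i. of_real (s' i)) * V z) $$ (i, j) =
      B' z $$ (i, 0) * B' z $$ (0, j) / of_real c + (if i = 0 \<or> j = 0 then 0 else S z $$ (i - 1, j - 1))" .
    show "B' z $$ (i, j) = (fstar V z * mat_diag (Suc n) (\<lambda>i. of_real (s' i)) * V z) $$ (i, j)"
      unfolding * using ij c(2) c(1)[OF z] by (cases i; cases j) (auto simp: S_def)
  qed (use lmat_dim[OF Bl] lmat_dim[OF Vl] lmat_dim[OF lmat_fstar[OF Vl]] in auto)
  obtain U where U: "lmat (Suc n) U" "\<And>z. z \<noteq> 0 \<Longrightarrow> B z = fstar U z * B' z * U z"
    using B'(2) unfolding lcong_def by blast
  have "B z = fstar (\<lambda>z. V z * U z) z * mat_diag (Suc n) (\<lambda>i. of_real (s' i)) * (V z * U z)" if z: "z \<noteq> 0" for z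
    unfolding U(2)[OF z] BV[OF z] fstar_mult[OF Vl U(1)]
    using lmat_dim[OF Vl] lmat_dim[OF U(1)] lmat_dim[OF lmat_fstar[OF Vl]] lmat_dim[OF lmat_fstar[OF U(1)]]
    by (simp add: mat_mult_assoc)
  moreover have "s' i = 1 \<or> s' i = -1" for i
    using W(2) c(2) by (cases i) (auto simp: s'_def sgn_if)
  moreover have "lmat (Suc n) (\<lambda>z. V z * U z)" by (rule lmat_mult[OF Vl U(1)])
  ultimately show ?case by (intro exI[of _ "\<lambda>z. V z * U z"] exI[of _ s']) auto
qed

section \<open>The factorization\<close>

lemma lmat_leval: "laurent_mat n U \<Longrightarrow> lmat n (leval n U)"
  unfolding leval_def by (intro lmat_matI lpoly_sum lpoly_mult lpoly_powi lpoly_const)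

lemma leval_lstar:
  assumes "laurent_mat n U" "z \<noteq> 0" shows "leval n (lstar U) z = fstar (leval n U) z"
proof (rule eq_matI)
  have U: "U k \<in> carrier_mat n n" for k using assms by (simp add: laurent_mat_def)
  let ?K = "{k. U k \<noteq> 0\<^sub>m n n}"
  fix i j assume "i < dim_row (fstar (leval n U) z)" "j < dim_col (fstar (leval n U) z)"
  then have ij: "i < n" "j < n" by (auto simp: fstar_def leval_def)
  have iff: "lstar U k \<noteq> 0\<^sub>m n n \<longleftrightarrow> - k \<in> ?K" for k
  proof -
    have "cadjoint M = 0\<^sub>m n n \<longleftrightarrow> M = 0\<^sub>m n n" if "M \<in> carrier_mat n n" for M
    proof -
      have z: "cadjoint (0\<^sub>m n n) = 0\<^sub>m n n" by (rule eq_matI) auto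
      then show ?thesis by (metis cadjoint_cadjoint)
    qed
    then show ?thesis using U by (simp add: lstar_def)
  qed
  have "leval n (lstar U) z $$ (i, j) = (\<Sum>k\<in>{k. - k \<in> ?K}. z powi k * lstar U k $$ (i, j))"
    using ij by (simp add: leval_def iff)
  also have "\<dots> = (\<Sum>k\<in>?K. z powi (- k) * lstar U (- k) $$ (i, j))"
    by (rule sum.reindex_bij_witness[of _ uminus uminus]) auto
  also have "\<dots> = (\<Sum>k\<in>?K. cnj ((1 / cnj z) powi k * U k $$ (j, i)))"
    using ij U assms(2) carrier_matD[OF U]
    by (intro sum.cong refl) (auto simp: lstar_def power_int_minus power_int_divide_distrib divide_inverse power_int_inverse)
  also have "\<dots> = fstar (leval n U) z $$ (i, j)"
    using ij by (simp add: fstar_def leval_def)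
  finally show "leval n (lstar U) z $$ (i, j) = fstar (leval n U) z $$ (i, j)" .
qed (auto simp: fstar_def leval_def)

lemma laurent_mat_of_lmat:
  assumes "lmat n F"
  obtains U where "laurent_mat n U" "\<And>z. z \<noteq> 0 \<Longrightarrow> leval n U z = F z"
proof -
  define R where "R i j c N \<longleftrightarrow> (\<forall>z. z \<noteq> 0 \<longrightarrow> F z $$ (i, j) = (\<Sum>k\<in>{-int N..int N}. c k * z powi k))
    \<and> (\<forall>k. \<bar>k\<bar> > int N \<longrightarrow> c k = 0)" for i j c and N :: nat
  have "\<exists>c N. R i j c N" if ij: "i < n" "j < n" for i j
  proof -
    obtain c N where "\<And>z. z \<noteq> 0 \<Longrightarrow> F z $$ (i, j) = (\<Sum>k\<in>{-int N..int N}. c k * z powi k)"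
      "\<And>k. \<bar>k\<bar> > int N \<Longrightarrow> c k = 0"
      by (rule lpoly_coeffs[OF lmat_index[OF assms ij]]) (rule that)
    then show ?thesis unfolding R_def by blast
  qed
  then obtain c N where R: "\<And>i j. i < n \<Longrightarrow> j < n \<Longrightarrow> R i j (c i j) (N i j)" by metis
  have c: "\<And>i j z. i < n \<Longrightarrow> j < n \<Longrightarrow> z \<noteq> 0 \<Longrightarrow> F z $$ (i, j) = (\<Sum>k\<in>{-int (N i j)..int (N i j)}. c i j k * z powi k)"
    "\<And>i j k. i < n \<Longrightarrow> j < n \<Longrightarrow> \<bar>k\<bar> > int (N i j) \<Longrightarrow> c i j k = 0"
    using R unfolding R_def by blast+
  define U where "U k = mat n n (\<lambda>(i, j). c i j k)" for k
  let ?K = "{k. U k \<noteq> 0\<^sub>m n n}"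
  define M where "M = (\<Sum>i<n. \<Sum>j<n. N i j)"
  have NM: "N i j \<le> M" if "i < n" "j < n" for i j
  proof -
    have "N i j \<le> (\<Sum>j<n. N i j)" using that by (intro member_le_sum) auto
    also have "\<dots> \<le> M" unfolding M_def using that by (intro member_le_sum) auto
    finally show ?thesis .
  qed
  have KM: "?K \<subseteq> {- int M..int M}"
  proof
    fix k assume k: "k \<in> ?K"
    show "k \<in> {- int M..int M}"
    proof (rule ccontr)
      assume "k \<notin> {- int M..int M}"
      then have kM: "\<bar>k\<bar> > int M" by auto
      have "c i j k = 0" if "i < n" "j < n" for i j
        using c(2)[OF that, of k] NM[OF that] kM by simp
      then have "U k = 0\<^sub>m n n" by (intro eq_matI) (auto simp: U_def)
      then show False using k by simp
    qed
  qed
  then have fin: "finite ?K" using finite_subset by blast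
  show ?thesis
  proof (rule that[of U])
    show "laurent_mat n U" using fin by (simp add: laurent_mat_def U_def)
    fix z :: complex assume z: "z \<noteq> 0"
    show "leval n U z = F z"
    proof (rule eq_matI)
      fix i j assume "i < dim_row (F z)" "j < dim_col (F z)"
      then have ij: "i < n" "j < n" using lmat_dim[OF assms] by auto
      have "leval n U z $$ (i, j) = (\<Sum>k\<in>?K. z powi k * U k $$ (i, j))" using ij by (simp add: leval_def)
      also have "\<dots> = (\<Sum>k\<in>{- int M..int M}. z powi k * U k $$ (i, j))"
        using KM ij by (intro sum.mono_neutral_left) auto
      also have "\<dots> = (\<Sum>k\<in>{- int M..int M}. c i j k * z powi k)"
        using ij by (intro sum.cong) (auto simp: U_def)
      also have "\<dots> = (\<Sum>k\<in>{- int (N i j)..int (N i j)}. c i j k * z powi k)"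
        using NM[OF ij] c(2)[OF ij] by (intro sum.mono_neutral_right) (auto simp: not_le)
      finally show "leval n U z $$ (i, j) = F z $$ (i, j)" using c(1)[OF ij z] by simp
    qed (use lmat_dim[OF assms] in \<open>auto simp: leval_def\<close>)
  qed
qed

text \<open>At a circle point outside the exceptional set the bounds apply to the constant matrix of
  signs. The positive and negative signs number at most \<open>p\<close> and \<open>q\<close> but
  together \<open>n\<close>, and \<open>p + q \<le> n\<close> forces equality.\<close>

lemma inertia_diag:
  fixes s :: "nat \<Rightarrow> real"
  assumes "inertia_le n F p q" "p + q \<le> n" "lmat n F" "lmat n W" "w \<noteq> 0" "det (F w) \<noteq> 0"
    and s: "\<And>i. s i = 1 \<or> s i = -1"
    and FW: "\<And>z. z \<noteq> 0 \<Longrightarrow> F z = fstar W z * mat_diag n (\<lambda>i. of_real (s i)) * W z"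
  shows "card {i. i < n \<and> s i = 1} = p"
proof -
  let ?D = "mat_diag n (\<lambda>i. complex_of_real (s i))"
  have cong: "lcong n F (\<lambda>_. ?D)" unfolding lcong_def using assms(4) FW by blast
  have "inertia_le n (\<lambda>_. ?D) p q"
    by (rule inertia_le_lcong[OF assms(1) cong assms(3) lmat_const[OF mat_diag_dim] assms(5,6)])
  then obtain X :: "complex set" where X: "finite X"
    "\<And>z Q S. cmod z = 1 \<Longrightarrow> z \<notin> X \<Longrightarrow> Q \<in> carrier_mat n n \<Longrightarrow> S \<subseteq> {..<n} \<Longrightarrow>
       posdef_on S (cadjoint Q * ?D * Q) \<Longrightarrow> card S \<le> p"
    "\<And>z Q S. cmod z = 1 \<Longrightarrow> z \<notin> X \<Longrightarrow> Q \<in> carrier_mat n n \<Longrightarrow> S \<subseteq> {..<n} \<Longrightarrow>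
       posdef_on S (cadjoint Q * (- ?D) * Q) \<Longrightarrow> card S \<le> q"
    by (rule inertia_leE) (rule that)
  obtain t where t: "1 * cis (1 * t) \<notin> X"
    using eventually_happens'[OF trivial_limit_at_right_real eventually_circle_path_avoids[OF X(1), of 1 1]] by auto
  \<comment> \<open>The factor \<open>e\<close> is 1 or -1 below, covering the matrix and its
    negative at once.\<close>
  have pd: "posdef_on {i. i < n \<and> e * s i = 1} (mat_diag n (\<lambda>i. complex_of_real (e * s i)))" for e
    unfolding posdef_on_def
  proof (intro allI impI)
    let ?S = "{i. i < n \<and> e * s i = 1}"
    fix x :: "nat \<Rightarrow> complex" assume "\<exists>i\<in>?S. x i \<noteq> 0"
    then obtain i where i: "i \<in> ?S" "x i \<noteq> 0" by blast
    have "hform ?S (mat_diag n (\<lambda>i. complex_of_real (e * s i))) x = (\<Sum>i\<in>?S. \<Sum>j\<in>?S. if j = i then x i * cnj (x i) else 0)"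
      unfolding hform_def by (intro sum.cong refl) (auto simp: mat_diag_def simp flip: of_real_mult)
    also have "\<dots> = (\<Sum>i\<in>?S. x i * cnj (x i))" by (intro sum.cong refl) auto
    also have "\<dots> = of_real (\<Sum>i\<in>?S. (cmod (x i))\<^sup>2)" unfolding of_real_sum complex_norm_square ..
    finally show "0 < Re (hform ?S (mat_diag n (\<lambda>i. complex_of_real (e * s i))) x)"
      using i by (auto intro!: sum_pos2[of _ i])
  qed
  have one: "cadjoint (1\<^sub>m n) * A * 1\<^sub>m n = A" if "A \<in> carrier_mat n n" for A
    using that by simp
  have neg: "- ?D = mat_diag n (\<lambda>i. complex_of_real (-1 * s i))"
    by (rule eq_matI) (auto simp: mat_diag_def)
  have D: "?D \<in> carrier_mat n n" "- ?D \<in> carrier_mat n n" by auto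
  have z: "cmod (1 * cis (1 * t)) = 1" by simp
  have "card {i. i < n \<and> s i = 1} \<le> p"
    using pd[of 1] by (intro X(2)[OF z t one_carrier_mat]) (auto simp: one[OF D(1)])
  moreover have "card {i. i < n \<and> s i = -1} \<le> q"
  proof (intro X(3)[OF z t one_carrier_mat])
    have "{i. i < n \<and> s i = -1} = {i. i < n \<and> -1 * s i = 1}" by (auto simp: minus_equation_iff)
    then show "posdef_on {i. i < n \<and> s i = -1} (cadjoint (1\<^sub>m n) * (- ?D) * 1\<^sub>m n)"
      using pd[of "-1"] unfolding one[OF D(2)] neg by simp
  qed auto
  moreover have "card {i. i < n \<and> s i = 1} + card {i. i < n \<and> s i = -1} = card ({i. i < n \<and> s i = 1} \<union> {i. i < n \<and> s i = -1})"
    by (subst card_Un_disjoint) auto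
  moreover have "{i. i < n \<and> s i = 1} \<union> {i. i < n \<and> s i = -1} = {..<n}" using s by auto
  ultimately show ?thesis using assms(2) by simp
qed

theorem theorem1p2:
  fixes n p q :: nat and A :: "int \<Rightarrow> complex mat"
  assumes "hermite_laurent_mat n A"
    and "\<exists>z. z \<noteq> 0 \<and> det (leval n A z) \<noteq> 0"
    and "\<forall>z. cmod z = 1 \<and> det (leval n A z) \<noteq> 0 \<longrightarrow>
               nu_plus (leval n A z) = p \<and> nu_minus (leval n A z) = q"
  shows "\<exists>U. laurent_mat n U \<and>
           (\<forall>z. z \<noteq> 0 \<longrightarrow>
              leval n A z = leval n U z * sig_diag n p * leval n (lstar U) z)"
proof -
  let ?F = "leval n A"
  have A: "laurent_mat n A" "lstar A = A" using assms(1) by (auto simp: hermite_laurent_mat_def)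
  have Fl: "lmat n ?F" by (rule lmat_leval[OF A(1)])
  have Fh: "lhermitian n ?F" using Fl leval_lstar[OF A(1)] A(2) by (simp add: lhermitian_def)
  obtain w where w: "w \<noteq> 0" "det (?F w) \<noteq> 0" using assms(2) by blast
  let ?X = "{z. z \<noteq> 0 \<and> det (?F z) = 0}"
  have finX: "finite ?X" by (rule lpoly_finite_zeros[OF lpoly_det[OF Fl] w])
  have circ: "?F z \<in> carrier_mat n n" "cadjoint (?F z) = ?F z" "nu_plus (?F z) = p" "nu_minus (?F z) = q"
    if "cmod z = 1" "z \<notin> ?X" for z
  proof -
    have z: "z \<noteq> 0" using that by auto
    show "?F z \<in> carrier_mat n n" by (rule lmat_carrier[OF Fl])
    show "cadjoint (?F z) = ?F z" using lhermitianD(2)[OF Fh z] fstar_circle[OF that(1), of ?F] by simp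
    show "nu_plus (?F z) = p" "nu_minus (?F z) = q" using assms(3) that z by auto
  qed
  have inert: "inertia_le n ?F p q"
    unfolding inertia_le_def
  proof (intro exI[of _ ?X] conjI finX allI impI; elim conjE)
    fix z :: complex and Q :: "complex mat" and S assume z: "cmod z = 1" "z \<notin> ?X" and Q: "Q \<in> carrier_mat n n" "S \<subseteq> {..<n}"
    show "posdef_on S (cadjoint Q * ?F z * Q) \<Longrightarrow> card S \<le> p"
      using nu_bounds(1)[OF circ(1,2)[OF z] Q] circ(3)[OF z] by simp
    show "posdef_on S (cadjoint Q * (- ?F z) * Q) \<Longrightarrow> card S \<le> q"
      using nu_bounds(2)[OF circ(1,2)[OF z] Q] circ(4)[OF z] by simp
  qed
  \<comment> \<open>The values \<open>p\<close> and \<open>q\<close> are tied to actual eigenvalue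
    counts only at circle points off the zero set; one such point yields
    \<open>p + q \<le> n\<close>.\<close>
  obtain t where t: "1 * cis (1 * t) \<notin> ?X"
    using eventually_happens'[OF trivial_limit_at_right_real eventually_circle_path_avoids[OF finX, of 1 1]] by auto
  have "cmod (1 * cis (1 * t)) = 1" by simp
  from nu_bounds(3)[OF circ(1,2)[OF this t]] have pq: "p + q \<le> n"
    unfolding circ(3,4)[OF \<open>cmod (1 * cis (1 * t)) = 1\<close> t] .
  obtain B c where B: "lhermitian n B" "lcong n ?F B" "c \<noteq> 0" "\<And>z. z \<noteq> 0 \<Longrightarrow> det (B z) = c"
    using reduce_to_unimodular[OF Fh w inert pq] by blast
  have "unimod n B" using B by (simp add: unimod_def)
  then obtain V s where V: "lmat n V" "\<And>i. s i = 1 \<or> s i = (-1::real)"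
    "\<And>z. z \<noteq> 0 \<Longrightarrow> B z = fstar V z * mat_diag n (\<lambda>i. of_real (s i)) * V z"
    using unimod_diagonalize by blast
  obtain U where U: "lmat n U" "\<And>z. z \<noteq> 0 \<Longrightarrow> ?F z = fstar U z * B z * U z"
    using B(2) unfolding lcong_def by blast
  define W where "W z = V z * U z" for z
  have Wl: "lmat n W" unfolding W_def by (rule lmat_mult[OF V(1) U(1)])
  have FW: "?F z = fstar W z * mat_diag n (\<lambda>i. of_real (s i)) * W z" if z: "z \<noteq> 0" for z
    unfolding U(2)[OF z] V(3)[OF z] W_def fstar_mult[OF V(1) U(1)]
    using lmat_dim[OF V(1)] lmat_dim[OF U(1)] lmat_dim[OF lmat_fstar[OF V(1)]] lmat_dim[OF lmat_fstar[OF U(1)]]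
    by (simp add: mat_mult_assoc)
  have card: "card {i. i < n \<and> s i = 1} = p"
    by (rule inertia_diag[OF inert pq Fl Wl w V(2) FW])
  have pn: "p \<le> n" using pq by simp
  have "card {..<p} = card {i. i < n \<and> s i = 1}" using card by simp
  then obtain f where f: "bij_betw f {..<p} {i. i < n \<and> s i = 1}"
    using finite_same_card_bij[of "{..<p}" "{i. i < n \<and> s i = 1}"] by auto
  have "{i. i < n \<and> s i \<noteq> 1} = {..<n} - {i. i < n \<and> s i = 1}" by auto
  then have "card {i. i < n \<and> s i \<noteq> 1} = n - p" using card by (simp add: card_Diff_subset subset_iff)
  then obtain g where g: "bij_betw g {p..<n} {i. i < n \<and> s i \<noteq> 1}"
    using finite_same_card_bij[of "{p..<n}" "{i. i < n \<and> s i \<noteq> 1}"] by auto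
  \<comment> \<open>A permutation listing the indices with sign 1 first; permuting the rows of
    \<open>W\<close> by it turns the signs into \<open>sig_diag n p\<close>.\<close>
  define h where "h i = (if i < p then f i else g i)" for i
  have "bij_betw h {..<p} {i. i < n \<and> s i = 1}"
    using f by (subst bij_betw_cong[of _ _ f]) (auto simp: h_def)
  moreover have "bij_betw h {p..<n} {i. i < n \<and> s i \<noteq> 1}"
    using g by (subst bij_betw_cong[of _ _ g]) (auto simp: h_def)
  ultimately have "bij_betw h ({..<p} \<union> {p..<n}) ({i. i < n \<and> s i = 1} \<union> {i. i < n \<and> s i \<noteq> 1})"
    and sh: "\<And>i. i < p \<Longrightarrow> s (h i) = 1" "\<And>i. p \<le> i \<Longrightarrow> i < n \<Longrightarrow> s (h i) \<noteq> 1"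
    by (intro bij_betw_combine, auto dest: bij_betwE)
  moreover have "{..<p} \<union> {p..<n} = {..<n}" "{i. i < n \<and> s i = 1} \<union> {i. i < n \<and> s i \<noteq> 1} = {..<n}"
    using pn by auto
  ultimately have h: "bij_betw h {..<n} {..<n}" by simp
  have hn: "h i < n" if "i < n" for i using h that by (auto dest: bij_betwE)
  define W' where "W' z = mat n n (\<lambda>(i, j). W z $$ (h i, j))" for z
  have W'l: "lmat n W'" unfolding W'_def by (rule lmat_matI) (intro lmat_index[OF Wl] hn)
  have sig: "sig_diag n p = mat_diag n (\<lambda>i. of_real (s (h i)))"
  proof -
    have "complex_of_real (s (h i)) = (if i < p then 1 else -1)" if "i < n" for i
      using sh[of i] V(2)[of "h i"] that by auto
    then show ?thesis by (intro eq_matI) (auto simp: sig_diag_def mat_diag_def)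
  qed
  have FW': "?F z = fstar W' z * sig_diag n p * W' z" if z: "z \<noteq> 0" for z
  proof (rule eq_matI)
    fix i j assume "i < dim_row (fstar W' z * sig_diag n p * W' z)" "j < dim_col (fstar W' z * sig_diag n p * W' z)"
    then have ij: "i < n" "j < n" using lmat_dim[OF W'l] lmat_dim[OF lmat_fstar[OF W'l]] by auto
    have "?F z $$ (i, j) = (\<Sum>k<n. cnj (W (1 / cnj z) $$ (k, i)) * of_real (s k) * W z $$ (k, j))"
      unfolding FW[OF z] by (rule index_fstar_diag[OF Wl ij])
    also have "\<dots> = (\<Sum>k<n. cnj (W (1 / cnj z) $$ (h k, i)) * of_real (s (h k)) * W z $$ (h k, j))"
      by (rule sum.reindex_bij_betw[OF h, symmetric])
    also have "\<dots> = (\<Sum>k<n. cnj (W' (1 / cnj z) $$ (k, i)) * of_real (s (h k)) * W' z $$ (k, j))"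
      using ij by (intro sum.cong refl) (auto simp: W'_def)
    also have "\<dots> = (fstar W' z * sig_diag n p * W' z) $$ (i, j)"
      unfolding sig by (rule index_fstar_diag[OF W'l ij, symmetric])
    finally show "?F z $$ (i, j) = (fstar W' z * sig_diag n p * W' z) $$ (i, j)" .
  qed (use lmat_dim[OF Fl] lmat_dim[OF W'l] lmat_dim[OF lmat_fstar[OF W'l]] in auto)
  \<comment> \<open>The congruence has the starred factor on the left, the claim has it on the
    right; so the required matrix is the star of \<open>W'\<close>.\<close>
  obtain Z where Z: "laurent_mat n Z" "\<And>z. z \<noteq> 0 \<Longrightarrow> leval n Z z = fstar W' z"
    using laurent_mat_of_lmat[OF lmat_fstar[OF W'l]] by metis
  have "leval n (lstar Z) z = W' z" if z: "z \<noteq> 0" for z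
  proof -
    have "leval n (lstar Z) z = cadjoint (leval n Z (1 / cnj z))"
      unfolding leval_lstar[OF Z(1) z] fstar_def ..
    also have "leval n Z (1 / cnj z) = fstar W' (1 / cnj z)" using Z(2) z by simp
    finally show ?thesis by (simp add: fstar_def)
  qed
  then show ?thesis using Z FW' by (intro exI[of _ Z]) simp
qed

end
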